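(* Let $d\ge5$ and let $\mu$ be a Borel probability measure on $\mathbb{T}^d$ satisfying $$\sum_{j\ge0}2^{j(d-2)}\sup_{k\in\mathbb{Z}^d,\ |k|\in[2^j,2^{j+1}]}|\widehat{\mu}_k|<\infty.$$ Then the trace inequality and the observability inequality hold for $\mu$.
   Context: $\mathbb{T}^d=\mathbb{R}^d/\mathbb{Z}^d$ with Lebesgue measure $dx$. $\sqrt{\mathbb{N}}=\{\sqrt n : n\in\mathbb{N}\}$. For $\lambda\in\sqrt{\mathbb{N}}$, $\mathcal{S}^{d-1}_\lambda=\{k\in\mathbb{Z}^d : |k|=\lambda\}$ and $E_\lambda=\{\sum_{k\in\mathcal{S}^{d-1}_\lambda} \widehat{u}_k e^{2\pi i k\cdot x} : \widehat{u}_k\in\mathbb{C}\}$ (the Laplace eigenspace with eigenvalue $-4\pi^2\lambda^2$). The trace inequality holds for $\mu$ if there is a finite constant $\mathfrak{C}$ such that $\int_{\mathbb{T}^d}|u|^2\,d\mu\le \mathfrak{C}\int_{\mathbb{T}^d}|u|^2\,dx$ for all $u\in\bigcup_{\lambda\in\sqrt{\mathbb{N}}}E_\lambda$. The observability inequality holds for $\mu$ if there is a finite constant $\mathfrak{c}$ such that $\int_{\mathbb{T}^d}|u|^2\,dx\le \mathfrak{c}\int_{\mathbb{T}^d}|u|^2\,d\mu$ for all $u\in\bigcup_{\lambda\in\sqrt{\mathbb{N}}}E_\lambda$. Fourier coefficients: $\widehat{\mu}_k=\int_{\mathbb{T}^d}e^{-2\pi i k\cdot x}\,d\mu(x)$,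 $k\in\mathbb{Z}^d$. *)

theory Defs
  imports "HOL-Probability.Probability"
begin

definition real_vec :: "int ^ 'd \<Rightarrow> real ^ 'd" where
  "real_vec k = (\<chi> i. real_of_int (k $ i))"

definition torus_rel :: "real ^ 'd \<Rightarrow> real ^ 'd \<Rightarrow> bool" where
  "torus_rel x y \<longleftrightarrow> x - y \<in> range real_vec"

lemma torus_rel_iff: "torus_rel x y \<longleftrightarrow> (\<forall>i. x $ i - y $ i \<in> \<int>)"
proof
  assume "torus_rel x y"
  then obtain k where "x - y = real_vec k" by (auto simp: torus_rel_def)
  then show "\<forall>i. x $ i - y $ i \<in> \<int>"
    by (metis Ints_of_int real_vec_def vec_lambda_beta vector_minus_component)
next
  assume "\<forall>i. x $ i - y $ i \<in> \<int>"
  then have "x - y = real_vec (\<chi> i. \<lfloor>x $ i - y $ i\<rfloor>)"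
    by (simp add: real_vec_def vec_eq_iff)
  then show "torus_rel x y" by (auto simp: torus_rel_def)
qed

quotient_type 'd torus = "real ^ 'd" / torus_rel
proof (rule equivpI)
  show "reflp (torus_rel :: real ^ 'd \<Rightarrow> _)"
    by (simp add: reflp_def torus_rel_iff)
  show "symp (torus_rel :: real ^ 'd \<Rightarrow> _)"
    unfolding symp_def torus_rel_iff by (metis Ints_minus minus_diff_eq)
  show "transp (torus_rel :: real ^ 'd \<Rightarrow> _)"
    unfolding transp_def torus_rel_iff
    by (metis Ints_add diff_add_cancel add_diff_eq)
qed

text \<open>The quotient topology; it makes \<open>borel\<close> available on the torus.\<close>

instantiation torus :: (finite) topological_space
begin

definition open_torus :: "'a torus set \<Rightarrow> bool" where
  "open_torus U \<longleftrightarrow> open (abs_torus -` U)"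

instance
  by standard (auto simp: open_torus_def vimage_Union intro!: open_Int open_UN)

end

lemma continuous_on_abs_torus: "continuous_on UNIV abs_torus"
  by (simp add: continuous_on_open_vimage open_torus_def)

lemma measurable_abs_torus [measurable]: "abs_torus \<in> borel_measurable borel"
  by (rule borel_measurable_continuous_onI) (rule continuous_on_abs_torus)

text \<open>Lebesgue measure on the torus, as the image of Lebesgue measure on the fundamental
  domain \<open>[0,1)\<^sup>d\<close>.\<close>

definition torus_lebesgue :: "'d::finite torus measure" where
  "torus_lebesgue =
     distr (restrict_space lborel {x. \<forall>i. 0 \<le> x $ i \<and> x $ i < 1}) borel abs_torus"

text \<open>The function \<open>x \<mapsto> e\<^bsup>2\<pi>i k\<cdot>x\<^esup>\<close>, which is invariant under translation by integer vectors.\<close>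

lift_definition character :: "int ^ 'd \<Rightarrow> 'd::finite torus \<Rightarrow> complex" is
  "\<lambda>k x. exp (2 * of_real pi * \<i> * of_real (real_vec k \<bullet> x))"
proof -
  fix k :: "int ^ 'd" and x y :: "real ^ 'd"
  assume "torus_rel x y"
  then obtain l where l: "x = y + real_vec l"
    by (auto simp: torus_rel_def algebra_simps)
  have "real_vec k \<bullet> real_vec l = of_int (\<Sum>i\<in>UNIV. k $ i * l $ i)"
    by (simp add: real_vec_def inner_vec_def)
  then show "exp (2 * of_real pi * \<i> * of_real (real_vec k \<bullet> x)) =
      exp (2 * of_real pi * \<i> * complex_of_real (real_vec k \<bullet> y))"
    unfolding l exp_eq
    by (intro exI[of _ "\<Sum>i\<in>UNIV. k $ i * l $ i"]) (simp add: inner_add_right algebra_simps)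
qed

definition fourier_coeff :: "'d::finite torus measure \<Rightarrow> int ^ 'd \<Rightarrow> complex" where
  "fourier_coeff \<mu> k = (\<integral>x. character (- k) x \<partial>\<mu>)"

definition lattice_sphere :: "real \<Rightarrow> (int ^ 'd) set" where
  "lattice_sphere r = {k. norm (real_vec k) = r}"

definition eigenspace :: "real \<Rightarrow> ('d::finite torus \<Rightarrow> complex) set" where
  "eigenspace r = {u. \<exists>c. u = (\<lambda>x. \<Sum>k\<in>lattice_sphere r. c k * character k x)}"

definition eigenfunctions :: "('d::finite torus \<Rightarrow> complex) set" where
  "eigenfunctions = (\<Union>r\<in>range (\<lambda>n::nat. sqrt (real n)). eigenspace r)"

definition trace_inequality :: "'d::finite torus measure \<Rightarrow> bool" where
  "trace_inequality \<mu> \<longleftrightarrow> (\<exists>C::real. \<forall>u\<in>eigenfunctions.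
     (\<integral>x. (cmod (u x))\<^sup>2 \<partial>\<mu>) \<le> C * (\<integral>x. (cmod (u x))\<^sup>2 \<partial>torus_lebesgue))"

definition observability_inequality :: "'d::finite torus measure \<Rightarrow> bool" where
  "observability_inequality \<mu> \<longleftrightarrow> (\<exists>c::real. \<forall>u\<in>eigenfunctions.
     (\<integral>x. (cmod (u x))\<^sup>2 \<partial>torus_lebesgue) \<le> c * (\<integral>x. (cmod (u x))\<^sup>2 \<partial>\<mu>))"

end

theory Submission
  imports Defs
begin

text \<open>
  Let \<open>u = \<Sum>k. c k * e\<^sub>k\<close> with \<open>e\<^sub>k\<close> the characters and \<open>k\<close> running through the lattice points of a sphere.
  Then \<open>\<integral>\<bar>u\<bar>\<^sup>2 d\<mu> = \<Sum>k. \<Sum>l. c k * cnj (c l) * m (l - k)\<close>, where \<open>m\<close> is the Fourier transform of \<open>\<mu>\<close>, and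
  \<open>\<integral>\<bar>u\<bar>\<^sup>2 dx = \<Sum>k. \<bar>c k\<bar>\<^sup>2\<close>. So the two inequalities are an upper and a lower bound for the
  hermitian matrices \<open>m (l - k)\<close>, whose diagonal entries are 1, uniformly over all spheres.

  The arithmetic input is \<open>card_lattice_cap_le\<close>: for \<open>d \<ge> 5\<close> a ball of radius \<open>N \<ge> 1\<close> around a lattice point \<open>k\<close>
  contains at most \<open>C * N ^ (d - 2)\<close> lattice points of the sphere around the origin through \<open>k\<close>. The number of lattice points \<open>l\<close> in a box with
  \<open>\<bar>l\<bar>\<^sup>2 = n\<close> is an integral over \<open>\<theta> \<in> [0, 1]\<close> of a product of \<open>d\<close> sums \<open>\<Sum> e(\<theta> * l\<^sup>2)\<close>, one for each coordinate.
  Weyl differencing bounds such a sum, uniformly in the interval of summation, by a multiple of \<open>N powr (3/5)\<close> plus a major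
  arc term that decays away from fractions with small denominator; the fifth power of the latter
  integrates to \<open>O(N ^ 3)\<close>. Five factors thus contribute \<open>N ^ 3\<close> and each further factor at most \<open>N\<close>.

  By the hypothesis on \<open>m\<close>, the sum of \<open>\<bar>m (l - k)\<bar>\<close> over the points \<open>l\<close> of the sphere at distance at least \<open>2 ^ J\<close> from
  \<open>k\<close> is at most a constant times the tail of a convergent series (\<open>decay_tail\<close>). With \<open>J = 0\<close> and
  Schur's test this is the trace inequality.

  For the observability inequality, a finite frequency set is handled by compactness: the decay makes \<open>m\<close> square
  summable, so \<open>\<mu>\<close> is bounded by the \<open>L\<^sup>2\<close> norm on trigonometric polynomials and cannot live on the zero set of a nonzero one
  (\<open>coercive_finite_set\<close>). By translation invariance the constant depends only on the diameter of the frequency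
  set. The passage to all spheres is an induction on the dimension \<open>n\<close> of an affine subspace containing
  the frequencies (\<open>coercive_sphere_slices\<close>). Given the constant \<open>\<delta>\<close> for dimension \<open>n\<close>, choose \<open>R\<close> so large that interactions
  at distance beyond \<open>R\<close> have norm at most \<open>\<delta> / 2\<close>, and split the frequencies into clusters connected by
  steps of length at most \<open>R\<close>. By \<open>cluster_dichotomy\<close> either each cluster lies in an affine subspace of lower dimension, and
  the induction hypothesis applies to it, or the whole frequency set has diameter bounded in terms of \<open>R\<close>
  alone. The dichotomy holds because a step \<open>m\<close> of length at most \<open>R\<close> that leads from \<open>k\<close> to another point of the same
  sphere around \<open>0\<close> forces \<open>\<bar>k \<bullet> m\<bar> \<le> R\<^sup>2 / 2\<close>: a cluster that moves in all directions of a subspace has bounded projection to it, so it lies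
  on a sphere of bounded radius there.
\<close>

section \<open>Quadratic exponential sums\<close>

definition nint_dist :: "real \<Rightarrow> real" where
  "nint_dist x = \<bar>x - of_int (round x)\<bar>"

lemma nint_dist_le: "nint_dist x \<le> \<bar>x - of_int m\<bar>"
  by (simp add: nint_dist_def round_diff_minimal)

lemma nint_dist_nonneg [simp]: "0 \<le> nint_dist x"
  by (simp add: nint_dist_def)

lemma nint_dist_le_half: "nint_dist x \<le> 1 / 2"
  using of_int_round_abs_le[of x] by (simp add: nint_dist_def abs_minus_commute)

lemma nint_dist_triangle: "nint_dist x \<le> nint_dist y + \<bar>x - y\<bar>"
  using nint_dist_le[of x "round y"] by (simp add: nint_dist_def)

lemma nint_dist_eq: "\<bar>x - of_int m\<bar> \<le> 1 / 2 \<Longrightarrow> nint_dist x = \<bar>x - of_int m\<bar>"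
proof -
  assume h: "\<bar>x - of_int m\<bar> \<le> 1 / 2"
  show ?thesis
  proof (cases "round x = m")
    case False
    then have "1 \<le> \<bar>of_int m - of_int (round x) :: real\<bar>"
      by (metis abs_minus_commute eq_iff_diff_eq_0 int_one_le_iff_zero_less of_int_1 of_int_abs of_int_diff of_int_le_iff zero_less_abs_iff)
    then show ?thesis
      using nint_dist_le[of x m] h nint_dist_le_half[of x] unfolding nint_dist_def by linarith
  qed (simp add: nint_dist_def)
qed

text \<open>With \<open>t\<close> the representative of \<open>pi * x\<close> modulo \<open>pi\<close> of smallest modulus, \<open>\<bar>t\<bar> \<le> 2\<close>, and the cubic
  Taylor bound for the sine gives \<open>\<bar>sin t\<bar> \<ge> \<bar>t\<bar> / 3\<close>.\<close>

lemma nint_dist_le_sin: "nint_dist x \<le> \<bar>sin (pi * x)\<bar>"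
proof -
  define t where "t = pi * (x - of_int (round x))"
  have "pi * x = t + of_int (round x) * pi"
    by (simp add: t_def algebra_simps)
  then have "\<bar>sin (pi * x)\<bar> = \<bar>sin t\<bar>"
    by (simp add: sin_add abs_mult sin_npi_int cos_npi_int mult.commute[of _ pi] del: of_int_round_abs_le)
  have tt: "\<bar>t\<bar> = pi * nint_dist x"
    by (simp add: t_def nint_dist_def abs_mult)
  have t2: "\<bar>t\<bar> \<le> 2"
    using nint_dist_le_half[of x] pi_less_4 unfolding tt
    using mult_mono[of pi 4 "nint_dist x" "1/2"] by simp
  have "\<bar>sin t - (\<Sum>m<3. sin_coeff m * t ^ m)\<bar> \<le> inverse (fact 3) * \<bar>t\<bar> ^ 3"
    by (rule Maclaurin_sin_bound)
  then have "\<bar>sin t - t\<bar> \<le> \<bar>t\<bar> ^ 3 / 6"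
    by (simp add: numeral_3_eq_3 sin_coeff_def fact_numeral field_simps)
  also have "\<bar>t\<bar> ^ 3 / 6 \<le> \<bar>t\<bar> * (2/3)"
  proof -
    have "\<bar>t\<bar> ^ 2 \<le> 2\<^sup>2" using t2 by (intro power_mono) auto
    then have "\<bar>t\<bar> * \<bar>t\<bar> ^ 2 \<le> \<bar>t\<bar> * 4" by (intro mult_left_mono) auto
    then show ?thesis by (simp add: power3_eq_cube power2_eq_square)
  qed
  finally have "\<bar>t\<bar> / 3 \<le> \<bar>sin t\<bar>" by linarith
  moreover have "nint_dist x \<le> \<bar>t\<bar> / 3"
    using mult_right_mono[of 3 pi "nint_dist x"] pi_gt3 unfolding tt by simp
  ultimately show ?thesis using \<open>\<bar>sin (pi * x)\<bar> = \<bar>sin t\<bar>\<close> by simp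
qed

text \<open>The usual bound of a geometric sum by the reciprocal of \<open>nint_dist x\<close>, written as a product so
  that it covers integers \<open>x\<close> as well.\<close>

lemma norm_geometric_cis_sum:
  "norm (\<Sum>n<N. cis (2 * pi * (x * real n + y))) * nint_dist x \<le> 1"
proof (cases "nint_dist x = 0")
  case False
  define z where "z = cis (2 * pi * x)"
  have eq: "(\<Sum>n<N. cis (2 * pi * (x * real n + y))) = cis (2 * pi * y) * (\<Sum>n<N. z ^ n)"
    unfolding sum_distrib_left z_def
    by (intro sum.cong refl) (simp add: Complex.DeMoivre cis_mult algebra_simps)
  have "(norm (z - 1))\<^sup>2 = (2 * sin (pi * x))\<^sup>2"
  proof -
    have "(norm (z - 1))\<^sup>2 = (cos (2 * pi * x) - 1)\<^sup>2 + (sin (2 * pi * x))\<^sup>2"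
      by (simp add: z_def cmod_power2)
    also have "\<dots> = 2 - 2 * cos (2 * (pi * x))"
      using sin_cos_squared_add[of "2 * pi * x"] by (simp add: power2_eq_square algebra_simps)
    also have "\<dots> = (2 * sin (pi * x))\<^sup>2"
      by (simp add: cos_double_sin power2_eq_square)
    finally show ?thesis .
  qed
  then have nz: "norm (z - 1) = 2 * \<bar>sin (pi * x)\<bar>"
    using power2_eq_iff_nonneg[of "norm (z - 1)" "2 * \<bar>sin (pi * x)\<bar>"] by (simp add: power_mult_distrib)
  then have nz': "norm (z - 1) \<ge> 2 * nint_dist x"
    using nint_dist_le_sin[of x] by simp
  then have "z \<noteq> 1" using False nint_dist_nonneg[of x] by (auto simp del: nint_dist_nonneg)
  have "norm (\<Sum>n<N. z ^ n) * norm (z - 1) = norm (z ^ N - 1)"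
    by (metis norm_mult power_diff_1_eq mult.commute)
  also have "\<dots> \<le> norm (z ^ N) + norm (1 :: complex)" by (rule norm_triangle_ineq4)
  also have "\<dots> = 2" by (simp add: z_def norm_power)
  finally have "norm (\<Sum>n<N. z ^ n) * (2 * nint_dist x) \<le> 2"
    using nz' by (meson mult_left_mono norm_ge_zero order_trans)
  then show ?thesis unfolding eq by (simp add: norm_mult)
qed simp

text \<open>The summation interval is arbitrary and the bounds below do not depend on its position \<open>a\<close>: this is
  what makes the lattice point count uniform over all boxes.\<close>

definition quad_sum :: "real \<Rightarrow> int \<Rightarrow> nat \<Rightarrow> complex" where
  "quad_sum \<theta> a M = (\<Sum>i<M. cis (2 * pi * (\<theta> * of_int ((a + int i)\<^sup>2))))"

lemma norm_quad_sum_le: "norm (quad_sum \<theta> a M) \<le> M"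
  unfolding quad_sum_def by (rule order_trans[OF norm_sum]) simp

text \<open>In \<open>\<bar>quad_sum \<theta> a M\<bar>\<^sup>2\<close> collect the pairs \<open>(j + h, j)\<close> of indices with a common difference \<open>h\<close>. As
  \<open>(a + j + h)\<^sup>2 - (a + j)\<^sup>2\<close> is linear in \<open>j\<close> with slope \<open>2 * h\<close>, the pairs form a geometric sum, whose modulus is
  \<open>T h\<close>. Pairs with negative difference are conjugate to these, which accounts for the factor 2.\<close>

lemma weyl_differencing:
  obtains T :: "nat \<Rightarrow> real" where
    "(norm (quad_sum \<theta> a M))\<^sup>2 \<le> 2 * (\<Sum>h<M. T h)"
    "\<And>h. 0 \<le> T h" "\<And>h. T h \<le> M" "\<And>h. T h * nint_dist (real h * (2 * \<theta>)) \<le> 1"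
proof
  define f where "f i = cis (2 * pi * (\<theta> * of_int ((a + int i)\<^sup>2)))" for i :: nat
  define D where "D h = (\<Sum>j<M-h. f (j + h) * cnj (f j))" for h
  let ?T = "\<lambda>h. norm (D h)"
  have D_eq: "D h = (\<Sum>j<M-h. cis (2 * pi * ((real h * (2 * \<theta>)) * real j +
       \<theta> * (2 * of_int a * real h + (real h)\<^sup>2))))" for h
    unfolding D_def f_def
    by (intro sum.cong refl) (simp add: cis_cnj cis_mult power2_eq_square algebra_simps)
  show "0 \<le> ?T h" for h by simp
  show "?T h \<le> M" for h
  proof -
    have "?T h \<le> (\<Sum>j<M-h. 1)" unfolding D_eq by (rule order_trans[OF norm_sum]) simp
    then show ?thesis by simp
  qed
  show "?T h * nint_dist (real h * (2 * \<theta>)) \<le> 1" for h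
    unfolding D_eq by (rule norm_geometric_cis_sum)
  let ?L = "{(i, j). i < M \<and> j < M \<and> j \<le> i}" and ?U = "{(i, j). i < M \<and> j < M \<and> i < j}"
  have fin: "finite ?L" "finite ?U"
    by (rule finite_subset[of _ "{..<M} \<times> {..<M}"]; auto)+
  define g where "g = (\<lambda>(i, j). f i * cnj (f j))"
  have L: "sum g ?L = (\<Sum>h<M. D h)"
  proof -
    have "(\<Sum>h<M. D h) = (\<Sum>(h, j)\<in>(SIGMA h:{..<M}. {..<M-h}). f (j + h) * cnj (f j))"
      unfolding D_def by (rule sum.Sigma) auto
    also have "\<dots> = sum g ?L"
      by (rule sum.reindex_bij_witness[of _ "\<lambda>(i, j). (i - j, j)" "\<lambda>(h, j). (j + h, j)"])
        (auto simp: g_def)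
    finally show ?thesis by simp
  qed
  have U: "norm (sum g ?U) \<le> norm (\<Sum>h\<in>{1..<M}. D h)"
  proof -
    have "(\<Sum>h\<in>{1..<M}. D h) = (\<Sum>(h, j)\<in>(SIGMA h:{1..<M}. {..<M-h}). f (j + h) * cnj (f j))"
      unfolding D_def by (rule sum.Sigma) auto
    also have "\<dots> = (\<Sum>p\<in>?U. cnj (g p))"
      by (rule sum.reindex_bij_witness[of _ "\<lambda>(i, j). (j - i, i)" "\<lambda>(h, j). (j, j + h)"])
        (auto simp: g_def)
    finally have "(\<Sum>h\<in>{1..<M}. D h) = cnj (sum g ?U)" by (simp only: cnj_sum)
    then show ?thesis by (simp only: complex_mod_cnj order_refl)
  qed
  have "(quad_sum \<theta> a M) * cnj (quad_sum \<theta> a M) = (\<Sum>i<M. \<Sum>j<M. f i * cnj (f j))"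
    unfolding quad_sum_def f_def[symmetric] by (simp add: sum_product)
  also have "\<dots> = sum g ({..<M} \<times> {..<M})"
    unfolding g_def by (rule sum.cartesian_product)
  also have "{..<M} \<times> {..<M} = ?L \<union> ?U" by auto
  also have "sum g (?L \<union> ?U) = sum g ?L + sum g ?U"
    using fin by (intro sum.union_disjoint) auto
  finally have "norm (quad_sum \<theta> a M * cnj (quad_sum \<theta> a M)) \<le> norm (sum g ?L) + norm (sum g ?U)"
    by (simp only: norm_triangle_ineq)
  also have "\<dots> \<le> (\<Sum>h<M. ?T h) + (\<Sum>h\<in>{1..<M}. ?T h)"
    unfolding L by (rule add_mono[OF norm_sum order_trans[OF U norm_sum]])
  also have "\<dots> \<le> (\<Sum>h<M. ?T h) + (\<Sum>h<M. ?T h)"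
    by (intro add_left_mono sum_mono2) auto
  finally show "(norm (quad_sum \<theta> a M))\<^sup>2 \<le> 2 * (\<Sum>h<M. ?T h)"
    by (simp add: norm_mult power2_eq_square)
qed

text \<open>A logarithm is affordable in the end: \<open>M * M powr (1/5)\<close> raised to the power \<open>5/2\<close>
  is \<open>M ^ 3\<close>, exactly the order of the main term.\<close>

lemma harm_le_powr: "0 < n \<Longrightarrow> (harm n :: real) \<le> 5 * real n powr (1/5)"
proof -
  assume n: "0 < n"
  have "harm n \<le> 1 + ln (real n)"
    using euler_mascheroni_sequence_decreasing[of 1 n] n by (simp add: harm_def)
  moreover have "ln (real n powr (1/5)) \<le> real n powr (1/5) - 1"
    using n by (intro ln_le_minus_one) simp
  ultimately show ?thesis using n by (simp add: ln_powr)
qed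

lemma sum_powr_le: "(\<Sum>t=1..n. real t powr (-4/5)) \<le> 5 * real n powr (1/5)"
proof (induction n)
  case (Suc n)
  have "real (Suc n) powr (-4/5) \<le> 5 * real (Suc n) powr (1/5) - 5 * real n powr (1/5)"
  proof (cases "n = 0")
    case False
    then have n: "0 < real n" by simp
    have "\<exists>z::real. real n < z \<and> z < real n + 1 \<and> 5 * (real n + 1) powr (1/5) - 5 * real n powr (1/5) =
        ((real n + 1) - real n) * (z powr (-4/5))"
      using n by (intro MVT2) (auto intro!: derivative_eq_intros)
    then obtain z where z: "real n < z" "z < real n + 1"
      "5 * (real n + 1) powr (1/5) - 5 * real n powr (1/5) = z powr (-(4/5))"
      by auto
    have "real (Suc n) powr (-4/5) \<le> z powr (-4/5)"
      using z n by (intro powr_mono2') auto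
    then show ?thesis using z(3) by (simp add: add.commute)
  qed simp
  then show ?case using Suc by simp
qed simp

text \<open>For \<open>h\<close> not divisible by \<open>q\<close>, \<open>h * b / q\<close> is at distance at least \<open>1 / q\<close> from the integers, and replacing
  \<open>b / q\<close> by \<open>\<phi>\<close> changes it by at most \<open>1 / (2 * q)\<close>. So \<open>T h\<close> is at most twice the reciprocal of that distance.
  Over each of the at most \<open>M / q + 1\<close> blocks of \<open>q\<close> consecutive \<open>h\<close>, the residues of \<open>h * b\<close> run through
  everything once, and the reciprocals add up to \<open>O(q * ln q)\<close>.\<close>

lemma nonmultiples_bound:
  fixes T :: "nat \<Rightarrow> real" and q M :: nat and b :: int
  assumes M: "0 < M" and q: "0 < q" "q \<le> 2 * M" and cop: "coprime b (int q)"
    and approx: "\<bar>real q * \<phi> - of_int b\<bar> \<le> 1 / (2 * real M)"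
    and T0: "\<And>h. 0 \<le> T h"
    and T: "\<And>h. T h * nint_dist (real h * \<phi>) \<le> 1"
  shows "(\<Sum>h\<in>{h. h < M \<and> \<not> q dvd h}. T h) \<le> 120 * real M powr (6/5)"
proof -
  define s where "s h = nat ((int h * b) mod int q)" for h
  define G where "G s = 2 * (real q / real s + real q / (real q - real s))" for s :: nat
  have s_less: "s h < q" for h
    using q by (simp add: s_def nat_less_iff)
  have G0: "0 \<le> G (s h)" for h
    using s_less[of h] by (simp add: G_def)
  have TG: "T h \<le> G (s h)" if h: "h < M" "\<not> q dvd h" for h
  proof -
    define x where "x = real h * of_int b / real q"
    have "\<not> int q dvd int h * b"
      using h coprime_dvd_mult_left_iff[of "int q" b "int h"] cop by (simp add: coprime_commute)
    then have s0: "0 < s h"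
      unfolding s_def dvd_eq_mod_eq_0 zero_less_nat_eq
      using q pos_mod_sign[of "int q" "int h * b"] by linarith
    have "int h * b = int q * ((int h * b) div int q) + int (s h)"
      using q by (simp add: s_def)
    then have "real h * of_int b = real q * of_int ((int h * b) div int q) + real (s h)"
      by (metis of_int_add of_int_mult of_int_of_nat_eq)
    then have x: "x = of_int ((int h * b) div int q) + real (s h) / real q"
      using q by (simp add: x_def field_simps)
    define z where "z = (int h * b) div int q"
    have dist: "nint_dist x \<ge> min (real (s h) / real q) (1 - real (s h) / real q)"
    proof (cases "round x \<le> z")
      case True
      then have "of_int (round x) \<le> (of_int z :: real)" by simp
      then show ?thesis unfolding nint_dist_def x z_def[symmetric] by linarith
    next
      case False
      then have "of_int (round x) \<ge> (of_int (z + 1) :: real)" by (subst of_int_le_iff) simp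
      then show ?thesis unfolding nint_dist_def x z_def[symmetric] by simp
    qed
    define m where "m = min (real (s h)) (real q - real (s h))"
    have m1: "1 \<le> m" using s0 s_less[of h] by (simp add: m_def)
    have dist': "m / real q \<le> nint_dist x"
      using dist q by (simp add: m_def min_def field_simps split: if_splits)
    \<comment> \<open>The approximation error is at most half the distance from \<open>x\<close> to the integers.\<close>
    have "x - real h * \<phi> = - (real h / real q) * (real q * \<phi> - of_int b)"
      using q by (simp add: x_def field_simps)
    then have "\<bar>x - real h * \<phi>\<bar> = real h / real q * \<bar>real q * \<phi> - of_int b\<bar>"
      by (simp add: abs_mult)
    also have "\<dots> \<le> real M / real q * (1 / (2 * real M))"
      using h approx by (intro mult_mono divide_right_mono) auto
    also have "\<dots> \<le> m / real q / 2" using m1 q M by (simp add: field_simps)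
    finally have "m / real q / 2 \<le> nint_dist (real h * \<phi>)"
      using dist' nint_dist_triangle[of x "real h * \<phi>"] by linarith
    then have "T h * (m / real q / 2) \<le> 1"
      using T[of h] T0[of h] by (meson mult_left_mono order_trans)
    then have "T h \<le> 2 * (real q / m)"
      using m1 q by (simp add: field_simps)
    also have "real q / m \<le> real q / real (s h) + real q / (real q - real (s h))"
      using s_less[of h] by (simp add: m_def min_def)
    finally show ?thesis by (simp add: G_def)
  qed
  have per: "s (h + k * q) = s h" for h k
    by (simp add: s_def distrib_right mult.assoc mult.left_commute[of _ "int q"])
  \<comment> \<open>Multiplication by \<open>b\<close> permutes the residues modulo \<open>q\<close>.\<close>
  have inj: "inj_on s {..<q}"
  proof (rule inj_onI)
    fix x y assume xy: "x \<in> {..<q}" "y \<in> {..<q}" "s x = s y"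
    then have "(int x * b) mod int q = (int y * b) mod int q"
      using q by (simp add: s_def nat_eq_iff2)
    then have "int q dvd (int x - int y) * b"
      by (simp add: mod_eq_dvd_iff left_diff_distrib)
    then have "int q dvd int x - int y"
      using coprime_dvd_mult_left_iff[of "int q" b "int x - int y"] cop by (simp add: coprime_commute)
    moreover have "\<bar>int x - int y\<bar> < int q"
      using xy(1,2) by auto
    ultimately have "int x - int y = 0"
      using dvd_imp_le_int[of "int x - int y" "int q"] by fastforce
    then show "x = y" by simp
  qed
  have bij: "bij_betw s {..<q} {..<q}"
    unfolding bij_betw_def using inj s_less endo_inj_surj[of "{..<q}" s] by auto
  have block: "(\<Sum>h<q. G (s h)) \<le> 4 * real q * harm q"
  proof -
    have "(\<Sum>h<q. G (s h)) = (\<Sum>s<q. G s)"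
      by (rule sum.reindex_bij_betw[OF bij])
    also have "\<dots> = 2 * real q * ((\<Sum>s<q. 1 / real s) + (\<Sum>s<q. 1 / (real q - real s)))"
    proof -
      have "G s = 2 * real q * (1 / real s + 1 / (real q - real s))" for s
        by (simp add: G_def distrib_left)
      then show ?thesis by (simp only: sum_distrib_left[symmetric] sum.distrib)
    qed
    also have "(\<Sum>s<q. 1 / (real q - real s)) = harm q"
      unfolding harm_def
      by (rule sum.reindex_bij_witness[of _ "\<lambda>k. q - k" "\<lambda>s. q - s"]) (auto simp: field_simps of_nat_diff)
    also have "(\<Sum>s<q. 1 / real s) \<le> harm q"
    proof -
      have "(\<Sum>s<q. 1 / real s) = (\<Sum>s\<in>{1..<q}. 1 / real s)"
        by (rule sum.mono_neutral_right) auto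
      also have "\<dots> \<le> (\<Sum>s\<in>{1..q}. 1 / real s)" by (rule sum_mono2) auto
      finally show ?thesis by (simp add: harm_def inverse_eq_divide)
    qed
    finally show ?thesis using q by (simp add: algebra_simps)
  qed
  define n where "n = M div q + 1"
  have "(\<Sum>h\<in>{h. h < M \<and> \<not> q dvd h}. T h) \<le> (\<Sum>h\<in>{h. h < M \<and> \<not> q dvd h}. G (s h))"
    by (intro sum_mono TG) auto
  also have "\<dots> \<le> (\<Sum>h<n * q. G (s h))"
  proof (intro sum_mono2 G0)
    have "M \<le> n * q"
      using q mod_less_divisor[of q M] div_mult_mod_eq[of M q]
      unfolding n_def add_mult_distrib by linarith
    then show "{h. h < M \<and> \<not> q dvd h} \<subseteq> {..<n * q}" by auto
  qed auto
  also have "\<dots> = (\<Sum>m<n. \<Sum>h\<in>{m*q..<m*q+q}. G (s h))"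
    by (simp only: sum.nat_group)
  also have "\<dots> = (\<Sum>m<n. \<Sum>h<q. G (s h))"
  proof (rule sum.cong[OF refl])
    fix m
    have per': "s (h - m * q) = s h" if "m * q \<le> h" for h
      using per[of "h - m * q" m] that by simp
    show "(\<Sum>h\<in>{m*q..<m*q+q}. G (s h)) = (\<Sum>h<q. G (s h))"
      by (rule sum.reindex_bij_witness[of _ "\<lambda>h. h + m * q" "\<lambda>h. h - m * q"])
        (auto simp: per per')
  qed
  also have "\<dots> = real n * (\<Sum>h<q. G (s h))" by simp
  also have "\<dots> \<le> real n * (4 * real q * harm q)"
    using block by (intro mult_left_mono) auto
  also have "\<dots> = 4 * (real n * real q) * harm q" by simp
  also have "\<dots> \<le> 4 * (3 * real M) * (5 * real M powr (1/5) * 2)"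
  proof (rule mult_mono[OF mult_left_mono])
    have "n * q \<le> 3 * M"
      using q div_times_less_eq_dividend[of M q] unfolding n_def distrib_right by linarith
    then show "real n * real q \<le> 3 * real M" by (metis of_nat_le_iff of_nat_mult of_nat_numeral)
    have "harm q \<le> 5 * real q powr (1/5)" using q by (intro harm_le_powr) auto
    also have "real q powr (1/5) \<le> (2 * real M) powr (1/5)" using q by (intro powr_mono2) auto
    also have "\<dots> = 2 powr (1/5) * real M powr (1/5)" by (simp add: powr_mult)
    also have "\<dots> \<le> 2 powr 1 * real M powr (1/5)" by (intro mult_right_mono powr_mono) auto
    finally show "harm q \<le> 5 * real M powr (1/5) * 2" by simp
  qed (auto simp: harm_nonneg)
  also have "\<dots> = 120 * (real M powr 1 * real M powr (1/5))" using M by simp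
  also have "real M powr 1 * real M powr (1/5) = real M powr (6/5)"
    by (simp only: powr_add[symmetric]) simp
  finally show ?thesis .
qed


lemma square_powr_five_halves:
  fixes x :: real
  assumes "0 \<le> x"
  shows "(x\<^sup>2) powr (5/2) = x ^ 5"
proof (cases "x = 0")
  case False
  then have "(x\<^sup>2) powr (5/2) = (x powr 2) powr (5/2)"
    using assms by (simp add: powr_numeral)
  also have "\<dots> = x powr 5" by (simp only: powr_powr) simp
  finally show ?thesis using False assms by (simp add: powr_numeral)
qed simp

text \<open>For \<open>h = q * t\<close> the distance from \<open>h * \<phi>\<close> to the integers is exactly \<open>t * q * \<beta>\<close>, where
  \<open>\<beta> = \<bar>\<phi> - b / q\<bar>\<close>, hence \<open>T h \<le> min M (1 / (t * q * \<beta>))\<close>. Summing the interpolated bound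
  \<open>M powr (1/5) * (t * q * \<beta>) powr (-4/5)\<close> over \<open>t \<le> M / q\<close> yields a multiple of \<open>M\<^sup>2 / q * (M\<^sup>2 * \<beta>) powr (-4/5)\<close>. The
  exponent \<open>4/5\<close> is chosen so that the power \<open>5/2\<close> turns it into the decay of the function \<open>1 / (1 + X\<^sup>2)\<close>, whose
  primitive is the arctangent.\<close>

lemma multiples_bound:
  fixes T :: "nat \<Rightarrow> real" and q M :: nat and b :: int
  assumes M: "0 < M" and q: "0 < q" "q \<le> 2 * M"
    and approx: "\<bar>real q * \<phi> - of_int b\<bar> \<le> 1 / (2 * real M)"
    and T0: "\<And>h. 0 \<le> T h" and TM: "\<And>h. T h \<le> M"
    and T: "\<And>h. T h * nint_dist (real h * \<phi>) \<le> 1"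
  shows "(\<Sum>h\<in>{h. 0 < h \<and> h < M \<and> q dvd h}. T h) powr (5/2) \<le>
    112 * (real M ^ 5 * real q powr (-5/2) / (1 + ((real M)\<^sup>2 * (\<phi> - of_int b / real q))\<^sup>2))"
    (is "?E powr _ \<le> _")
proof -
  define \<beta> where "\<beta> = \<bar>\<phi> - of_int b / real q\<bar>"
  define n where "n = (M - 1) div q"
  define E where "E = ?E"
  define Y where "Y = (real M)\<^sup>2 / real q"
  have Y0: "0 < Y" using M q by (simp add: Y_def)
  have E0: "0 \<le> E" unfolding E_def by (intro sum_nonneg T0)
  have set_eq: "{h. 0 < h \<and> h < M \<and> q dvd h} = (\<lambda>t. q * t) ` {1..n}"
  proof (intro set_eqI iffI)
    fix h assume "h \<in> {h. 0 < h \<and> h < M \<and> q dvd h}"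
    then obtain t where t: "h = q * t" "0 < t" "q * t < M" by (auto elim!: dvdE)
    then have "t \<le> n" using q by (simp add: n_def less_eq_div_iff_mult_less_eq mult.commute)
    then show "h \<in> (\<lambda>t. q * t) ` {1..n}" using t by auto
  next
    fix h assume "h \<in> (\<lambda>t. q * t) ` {1..n}"
    then obtain t where t: "h = q * t" "1 \<le> t" "t \<le> n"
      by (metis imageE atLeastAtMost_iff)
    then have "t * q \<le> M - 1" using q by (simp add: n_def less_eq_div_iff_mult_less_eq)
    then show "h \<in> {h. 0 < h \<and> h < M \<and> q dvd h}" using t q M by (auto simp: mult.commute)
  qed
  have E_eq: "E = (\<Sum>t=1..n. T (q * t))"
    unfolding E_def set_eq using q by (subst sum.reindex) (auto simp: inj_on_def)
  have nq: "n * q \<le> M - 1" unfolding n_def by (rule div_times_less_eq_dividend)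
  then have nMq: "real n \<le> real M / real q"
    using q M by (simp add: field_simps flip: of_nat_mult)
  have dist: "nint_dist (real (q * t) * \<phi>) = real t * (real q * \<beta>)" if t: "t \<le> n" for t
  proof -
    have "\<bar>real (q * t) * \<phi> - of_int (int t * b)\<bar> = real t * \<bar>real q * \<phi> - of_int b\<bar>"
    proof -
      have "real (q * t) * \<phi> - of_int (int t * b) = real t * (real q * \<phi> - of_int b)"
        by (simp add: algebra_simps)
      then show ?thesis by (simp add: abs_mult)
    qed
    moreover have "\<bar>real q * \<phi> - of_int b\<bar> = real q * \<beta>"
    proof -
      have "real q * \<phi> - of_int b = real q * (\<phi> - of_int b / real q)"
        using q by (simp add: field_simps)
      then show ?thesis by (simp add: \<beta>_def abs_mult)
    qed
    moreover have "real t * \<bar>real q * \<phi> - of_int b\<bar> \<le> real M * (1 / (2 * real M))"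
    proof (intro mult_mono approx)
      have "t \<le> M" using t nq q by (metis diff_le_self le_trans mult_le_mono2 nat_mult_1_right Suc_leI One_nat_def)
      then show "real t \<le> real M" by simp
    qed auto
    ultimately show ?thesis using nint_dist_eq[of "real (q * t) * \<phi>" "int t * b"] M by simp
  qed
  have E1: "E \<le> Y"
  proof -
    have "E \<le> (\<Sum>t=1..n. real M)" unfolding E_eq by (intro sum_mono TM)
    also have "\<dots> = real n * real M" by simp
    also have "\<dots> \<le> real M / real q * real M" using nMq by (intro mult_right_mono) auto
    finally show ?thesis by (simp add: Y_def power2_eq_square)
  qed
  define X where "X = (real M)\<^sup>2 * \<beta>"
  have E2: "E \<le> 5 * Y * X powr (-4/5)" if b: "\<beta> \<noteq> 0"
  proof -
    have b0: "0 < \<beta>" using b by (simp add: \<beta>_def)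
    have each: "T (q * t) \<le> real M powr (1/5) * (real q * \<beta>) powr (-4/5) * real t powr (-4/5)"
      if t: "t \<in> {1..n}" for t
    proof (cases "T (q * t) = 0")
      case False
      then have pos: "0 < T (q * t)" using T0[of "q * t"] by simp
      define y where "y = real t * (real q * \<beta>)"
      have y: "0 < y" using t q b0 by (simp add: y_def)
      have "T (q * t) * y \<le> 1"
        using T[of "q * t"] dist[of t] t by (simp add: y_def)
      then have Ty: "T (q * t) \<le> 1 / y" using y by (simp add: field_simps)
      \<comment> \<open>Interpolate between the two bounds \<open>M\<close> and \<open>1 / y\<close> with weights \<open>1/5\<close> and \<open>4/5\<close>.\<close>
      have "T (q * t) = T (q * t) powr (1/5) * T (q * t) powr (4/5)"
        using pos by (simp flip: powr_add)
      also have "\<dots> \<le> real M powr (1/5) * (1 / y) powr (4/5)"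
        using pos Ty TM by (intro mult_mono powr_mono2) auto
      also have "(1 / y) powr (4/5) = y powr (-4/5)"
        using y by (simp add: powr_divide powr_minus_divide)
      also have "y powr (-4/5) = real t powr (-4/5) * (real q * \<beta>) powr (-4/5)"
        unfolding y_def by (rule powr_mult)
      finally show ?thesis by (simp add: mult_ac)
    qed simp
    have "E \<le> (\<Sum>t=1..n. real M powr (1/5) * (real q * \<beta>) powr (-4/5) * real t powr (-4/5))"
      unfolding E_eq by (intro sum_mono each)
    also have "\<dots> = real M powr (1/5) * (real q * \<beta>) powr (-4/5) * (\<Sum>t=1..n. real t powr (-4/5))"
      by (simp add: sum_distrib_left)
    also have "\<dots> \<le> real M powr (1/5) * (real q * \<beta>) powr (-4/5) * (5 * (real M / real q) powr (1/5))"
    proof (intro mult_left_mono)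
      have "real n powr (1/5) \<le> (real M / real q) powr (1/5)"
        using nMq by (intro powr_mono2) auto
      then show "(\<Sum>t=1..n. real t powr (-4/5)) \<le> 5 * (real M / real q) powr (1/5)"
        using sum_powr_le[of n] by linarith
    qed auto
    also have "\<dots> = 5 * (Y * X powr (-4/5))"
    proof -
      have "ln (real M powr (1/5) * (real q * \<beta>) powr (-4/5) * (real M / real q) powr (1/5)) =
          ln (Y * X powr (-4/5))"
        using M q b0 by (simp add: Y_def X_def ln_mult ln_div ln_powr ln_realpow field_simps)
      then have "real M powr (1/5) * (real q * \<beta>) powr (-4/5) * (real M / real q) powr (1/5) =
          Y * X powr (-4/5)"
        using M q b0 by (subst (asm) ln_inj_iff) (auto simp: Y_def X_def)
      then show ?thesis by simp
    qed
    finally show ?thesis by simp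
  qed
  have "E powr (5/2) \<le> 112 * (Y powr (5/2) / (1 + X\<^sup>2))"
  proof (cases "X \<le> 1")
    case True
    have "X\<^sup>2 \<le> 1" using True M by (simp add: X_def \<beta>_def abs_square_le_1 mult_nonneg_nonneg power_le_one)
    have "E powr (5/2) \<le> Y powr (5/2)" using E0 E1 by (intro powr_mono2) auto
    also have "\<dots> = 2 * (Y powr (5/2) / 2)" by simp
    also have "\<dots> \<le> 2 * (Y powr (5/2) / (1 + X\<^sup>2))"
      using \<open>X\<^sup>2 \<le> 1\<close> by (intro mult_left_mono divide_left_mono) (auto intro: add_pos_nonneg)
    also have "\<dots> \<le> 112 * (Y powr (5/2) / (1 + X\<^sup>2))"
      by (intro mult_right_mono) (auto intro: divide_nonneg_nonneg)
    finally show ?thesis .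
  next
    case False
    then have X: "1 < X" by simp
    then have "\<beta> \<noteq> 0" by (auto simp: X_def)
    have "E powr (5/2) \<le> (5 * Y * X powr (-4/5)) powr (5/2)"
      using E0 E2[OF \<open>\<beta> \<noteq> 0\<close>] by (intro powr_mono2) auto
    also have "\<dots> = 5 powr (5/2) * Y powr (5/2) * X powr (-2)"
      by (simp add: powr_mult powr_powr)
    finally have E3: "E powr (5/2) \<le> 5 powr (5/2) * Y powr (5/2) * X powr (-2)" .
    have "1 \<le> X\<^sup>2" using X by simp
    then have pos: "0 < 1 + X\<^sup>2" "0 < X\<^sup>2" by linarith+
    have "X powr (-2) = 1 / X\<^sup>2"
      using X by (simp add: powr_minus_divide powr_numeral)
    also have "\<dots> \<le> 2 / (1 + X\<^sup>2)"
      using pos \<open>1 \<le> X\<^sup>2\<close> by (simp add: divide_le_eq pos_le_divide_eq)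
    finally have X2: "X powr (-2) \<le> 2 / (1 + X\<^sup>2)" .
    \<comment> \<open>The constant 112 is \<open>2 * 56\<close>, where \<open>5 powr (5/2) \<le> 56\<close> since \<open>5 ^ 5 = 3125 \<le> 56\<^sup>2\<close>.\<close>
    have "((5::real) powr (5/2))\<^sup>2 = 5 powr 5" by (simp add: power2_eq_square flip: powr_add)
    also have "\<dots> = 3125" using powr_realpow[of "5::real" 5] by simp
    finally have "((5::real) powr (5/2))\<^sup>2 \<le> 56\<^sup>2" by simp
    then have "(5::real) powr (5/2) \<le> 56" by (rule power2_le_imp_le) simp
    then have "5 powr (5/2) * Y powr (5/2) * X powr (-2) \<le> 56 * Y powr (5/2) * (2 / (1 + X\<^sup>2))"
      using X2 by (intro mult_mono) auto
    with E3 show ?thesis by simp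
  qed
  moreover have "Y powr (5/2) = real M ^ 5 * real q powr (-5/2)"
  proof -
    have "Y powr (5/2) = ((real M)\<^sup>2) powr (5/2) / real q powr (5/2)"
      by (simp add: Y_def powr_divide)
    also have "((real M)\<^sup>2) powr (5/2) = real M ^ 5"
      by (rule square_powr_five_halves) simp
    finally show ?thesis by (simp add: powr_minus_divide)
  qed
  moreover have "X\<^sup>2 = ((real M)\<^sup>2 * (\<phi> - of_int b / real q))\<^sup>2"
    by (simp add: X_def \<beta>_def power_mult_distrib)
  ultimately show ?thesis by (simp add: E_def)
qed

lemma powr_add_le:
  fixes x y p :: real
  assumes "0 \<le> x" "0 \<le> y" "0 \<le> p"
  shows "(x + y) powr p \<le> 2 powr p * (x powr p + y powr p)"
proof -
  have "(x + y) powr p \<le> (2 * max x y) powr p" using assms by (intro powr_mono2) auto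
  also have "\<dots> = 2 powr p * max x y powr p" by (rule powr_mult)
  also have "\<dots> \<le> 2 powr p * (x powr p + y powr p)"
    by (intro mult_left_mono) (auto simp: max_def)
  finally show ?thesis .
qed

text \<open>Weyl differencing with the contributions of \<open>h = 0\<close>, of the non-multiples and of the multiples of \<open>q\<close>;
  the constant is \<open>242 = 2 * (1 + 120)\<close>. The fifth power of the sum is the power \<open>5/2\<close> of its square.\<close>

lemma quad_sum_bound:
  obtains C :: real where "0 < C" and
    "\<And>\<theta> a M q b. 0 < M \<Longrightarrow> 0 < q \<Longrightarrow> q \<le> 2 * M \<Longrightarrow> coprime b (int q) \<Longrightarrow>
       \<bar>real q * (2 * \<theta>) - of_int b\<bar> \<le> 1 / (2 * real M) \<Longrightarrow>
       norm (quad_sum \<theta> a M) ^ 5 \<le> C * (real M ^ 3 +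
         real M ^ 5 * real q powr (-5/2) / (1 + ((real M)\<^sup>2 * (2 * \<theta> - of_int b / real q))\<^sup>2))"
proof
  define C1 :: real where "C1 = 2 powr (5/2) * (242 powr (5/2) + 2 powr (5/2) * 112)"
  show "0 < C1" by (simp add: C1_def add_pos_nonneg)
  fix \<theta> :: real and a :: int and M q :: nat and b :: int
  assume M: "0 < M" and q: "0 < q" "q \<le> 2 * M" and cop: "coprime b (int q)"
    and approx: "\<bar>real q * (2 * \<theta>) - of_int b\<bar> \<le> 1 / (2 * real M)"
  obtain T :: "nat \<Rightarrow> real" where T:
    "(norm (quad_sum \<theta> a M))\<^sup>2 \<le> 2 * (\<Sum>h<M. T h)"
    "\<And>h. 0 \<le> T h" "\<And>h. T h \<le> M" "\<And>h. T h * nint_dist (real h * (2 * \<theta>)) \<le> 1"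
    using weyl_differencing by blast
  define E where "E = (\<Sum>h\<in>{h. 0 < h \<and> h < M \<and> q dvd h}. T h)"
  define F where "F = real M ^ 5 * real q powr (-5/2) / (1 + ((real M)\<^sup>2 * (2 * \<theta> - of_int b / real q))\<^sup>2)"
  have E0: "0 \<le> E" unfolding E_def by (intro sum_nonneg T(2))
  have F0: "0 \<le> F" unfolding F_def by (intro divide_nonneg_nonneg) auto
  have E: "E powr (5/2) \<le> 112 * F"
    unfolding E_def F_def using M q approx T(2-4) by (rule multiples_bound)
  have "{..<M} = insert 0 {h. 0 < h \<and> h < M \<and> q dvd h} \<union> {h. h < M \<and> \<not> q dvd h}"
    using M by auto
  then have "(\<Sum>h<M. T h) = (\<Sum>h\<in>insert 0 {h. 0 < h \<and> h < M \<and> q dvd h}. T h) +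
      (\<Sum>h\<in>{h. h < M \<and> \<not> q dvd h}. T h)"
    by (simp only:) (rule sum.union_disjoint; auto)
  also have "(\<Sum>h\<in>insert 0 {h. 0 < h \<and> h < M \<and> q dvd h}. T h) = T 0 + E"
    unfolding E_def by (rule sum.insert) auto
  finally have "(\<Sum>h<M. T h) \<le> real M + E + 120 * real M powr (6/5)"
    using T(3)[of 0] nonmultiples_bound[OF M q cop approx T(2) T(4)] by simp
  moreover have "real M \<le> real M powr (6/5)"
    using M powr_mono[of 1 "6/5" "real M"] by simp
  ultimately have "(norm (quad_sum \<theta> a M))\<^sup>2 \<le> 242 * real M powr (6/5) + 2 * E"
    using T(1) by linarith
  then have "((norm (quad_sum \<theta> a M))\<^sup>2) powr (5/2) \<le> (242 * real M powr (6/5) + 2 * E) powr (5/2)"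
    by (intro powr_mono2) auto
  also have "\<dots> \<le> 2 powr (5/2) * ((242 * real M powr (6/5)) powr (5/2) + (2 * E) powr (5/2))"
    using E0 by (intro powr_add_le) auto
  also have "(242 * real M powr (6/5)) powr (5/2) = 242 powr (5/2) * real M ^ 3"
    using M by (simp add: powr_mult powr_powr powr_numeral)
  also have "(2 * E) powr (5/2) = 2 powr (5/2) * E powr (5/2)"
    by (rule powr_mult)
  also have "2 powr (5/2) * (242 powr (5/2) * real M ^ 3 + 2 powr (5/2) * E powr (5/2)) \<le>
      2 powr (5/2) * (242 powr (5/2) * real M ^ 3 + 2 powr (5/2) * (112 * F))"
    using E by (intro mult_left_mono add_left_mono) auto
  also have "\<dots> \<le> C1 * (real M ^ 3 + F)"
    using F0 by (simp add: C1_def algebra_simps)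
  also have "((norm (quad_sum \<theta> a M))\<^sup>2) powr (5/2) = norm (quad_sum \<theta> a M) ^ 5"
    by (rule square_powr_five_halves) simp
  finally show "norm (quad_sum \<theta> a M) ^ 5 \<le> C1 * (real M ^ 3 +
         real M ^ 5 * real q powr (-5/2) / (1 + ((real M)\<^sup>2 * (2 * \<theta> - of_int b / real q))\<^sup>2))"
    by (simp add: F_def)
qed

section \<open>Lattice points of a sphere in a box\<close>

lemma has_integral_cis:
  fixes m :: int
  shows "((\<lambda>\<theta>. cis (2 * pi * (of_int m * \<theta>))) has_integral (if m = 0 then 1 else 0)) {0..1}"
proof (cases "m = 0")
  case True
  then show ?thesis using has_integral_const_real[of "1::complex" 0 1] by simp
next
  case False
  define w where "w = 2 * of_real pi * of_int m * \<i>"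
  have w: "w \<noteq> 0" using False by (simp add: w_def)
  have eq: "cis (2 * pi * (of_int m * \<theta>)) = exp (w * of_real \<theta>)" for \<theta>
    by (simp add: cis_conv_exp w_def mult_ac)
  have "((\<lambda>\<theta>. exp (w * of_real \<theta>)) has_integral (exp (w * of_real 1) / w - exp (w * of_real 0) / w)) {0..1}"
    using w by (intro fundamental_theorem_of_calculus)
      (auto intro!: derivative_eq_intros has_vector_derivative_real_field)
  moreover have "exp (w * of_real 1) = 1"
    using eq[of 1] cis_multiple_2pi[of "of_int m"] by (simp add: mult.assoc)
  ultimately show ?thesis using False by (simp add: eq)
qed

lemma integral_lorentz_le:
  fixes A c :: real
  assumes A: "0 < A"
  shows "integral {0..1} (\<lambda>\<theta>. 1 / (1 + (A * (2 * \<theta> - c))\<^sup>2)) \<le> 2 / A"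
proof -
  have pos: "1 + (A * (2 * \<theta> - c))\<^sup>2 \<noteq> 0" for \<theta>
    by (smt (verit) zero_le_power2)
  have "((\<lambda>\<theta>. 1 / (1 + (A * (2 * \<theta> - c))\<^sup>2)) has_integral
      (arctan (A * (2 * 1 - c)) / (2 * A) - arctan (A * (2 * 0 - c)) / (2 * A))) {0..1}"
    using A by (intro fundamental_theorem_of_calculus)
      (auto intro!: derivative_eq_intros simp flip: has_real_derivative_iff_has_vector_derivative
        simp: inverse_eq_divide)
  then have "integral {0..1} (\<lambda>\<theta>. 1 / (1 + (A * (2 * \<theta> - c))\<^sup>2)) =
      (arctan (A * (2 - c)) - arctan (- (A * c))) / (2 * A)"
    by (simp add: integral_unique diff_divide_distrib)
  also have "\<dots> \<le> 4 / (2 * A)"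
    using A arctan_ubound[of "A * (2 - c)"] arctan_lbound[of "- (A * c)"] pi_less_4
    by (intro divide_right_mono) auto
  finally show ?thesis by simp
qed

text \<open>By Dirichlet's approximation theorem each \<open>\<theta>\<close> has a fraction \<open>b / q\<close> to which the pointwise bound
  applies; summing the bounds over all \<open>q \<le> 2 * M\<close> and \<open>b \<le> 2 * q\<close> gives one continuous majorant. An individual term
  integrates to \<open>O(M ^ 3 * q powr (-5/2))\<close>, there are \<open>2 * q + 1\<close> of them for each \<open>q\<close>, and the series of
  \<open>q powr (-3/2)\<close> converges. It is here that the fifth power is needed: the fourth would give the harmonic series.\<close>

lemma quad_sum_majorant:
  obtains C :: real where "0 < C" and
    "\<And>M. 0 < M \<Longrightarrow> \<exists>H. continuous_on {0..1} H \<and> (\<forall>\<theta>. 0 \<le> H \<theta>) \<and>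
       (\<forall>\<theta>\<in>{0..1}. \<forall>a. norm (quad_sum \<theta> a M) ^ 5 \<le> H \<theta>) \<and>
       integral {0..1} H \<le> C * real M ^ 3"
proof -
  obtain C0 :: real where C0: "0 < C0" and bd:
    "\<And>\<theta> a M q b. 0 < M \<Longrightarrow> 0 < q \<Longrightarrow> q \<le> 2 * M \<Longrightarrow> coprime b (int q) \<Longrightarrow>
       \<bar>real q * (2 * \<theta>) - of_int b\<bar> \<le> 1 / (2 * real M) \<Longrightarrow>
       norm (quad_sum \<theta> a M) ^ 5 \<le> C0 * (real M ^ 3 +
         real M ^ 5 * real q powr (-5/2) / (1 + ((real M)\<^sup>2 * (2 * \<theta> - of_int b / real q))\<^sup>2))"
    using quad_sum_bound by blast
  have summ: "summable (\<lambda>n. real n powr (-3/2))"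
    by (subst summable_real_powr_iff) simp
  define Z where "Z = (\<Sum>n. real n powr (-3/2))"
  have Z0: "0 \<le> Z" unfolding Z_def by (intro suminf_nonneg summ) auto
  define C where "C = C0 * (1 + 6 * Z)"
  show thesis
  proof (rule that)
    show "0 < C" using C0 Z0 by (simp add: C_def)
    fix M :: nat assume M: "0 < M"
    define F :: "nat \<Rightarrow> nat \<Rightarrow> real \<Rightarrow> real" where
      "F q b \<theta> = 1 / (1 + ((real M)\<^sup>2 * (2 * \<theta> - real b / real q))\<^sup>2)" for q b \<theta>
    define H where "H \<theta> = C0 * (real M ^ 3 +
      (\<Sum>q\<in>{1..2*M}. \<Sum>b\<in>{..2*q}. real M ^ 5 * real q powr (-5/2) * F q b \<theta>))" for \<theta>
    have F0: "0 \<le> F q b \<theta>" for q b \<theta> by (simp add: F_def)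
    have pos: "1 + ((real M)\<^sup>2 * (2 * \<theta> - real b / real q))\<^sup>2 \<noteq> 0" for q b \<theta>
      by (smt (verit) zero_le_power2)
    have Fcont: "continuous_on {0..1} (F q b)" for q b
      unfolding F_def by (intro continuous_intros ballI pos)
    have cont: "continuous_on {0..1} H"
      unfolding H_def by (intro continuous_intros Fcont)
    have H0: "0 \<le> H \<theta>" for \<theta>
      unfolding H_def using C0 F0
      by (intro mult_nonneg_nonneg add_nonneg_nonneg sum_nonneg) auto
    have dom: "norm (quad_sum \<theta> a M) ^ 5 \<le> H \<theta>" if \<theta>: "\<theta> \<in> {0..1}" for \<theta> a
    proof -
      obtain h k where hk: "coprime h k" "0 < k" "k \<le> int (2 * M)"
        "\<bar>of_int k * (2 * \<theta>) - of_int h\<bar> < 1 / real (2 * M)"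
        using Dirichlet_approx_coprime[of "2 * M" "2 * \<theta>"] M by auto
      define q where "q = nat k"
      have q: "0 < q" "q \<le> 2 * M" "k = int q" using hk by (auto simp: q_def)
      \<comment> \<open>As \<open>2 * \<theta>\<close> lies in \<open>[0, 2]\<close> and the error is at most \<open>1/2\<close>, the numerator lies in
        \<open>{0..2 * k}\<close>.\<close>
      have half: "1 / real (2 * M) \<le> 1 / 2" using M by simp
      have kk: "0 \<le> of_int k * (2 * \<theta>)" "of_int k * (2 * \<theta>) \<le> of_int k * 2"
        using \<theta> hk(2) by (auto intro!: mult_nonneg_nonneg mult_left_mono)
      have "of_int h > (-1 :: real)" using hk(4) half kk by linarith
      then have h0: "0 \<le> h" by linarith
      have "of_int h < 2 * (of_int k :: real) + 1" using hk(4) half kk by linarith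
      then have "of_int h < (of_int (2 * k + 1) :: real)" by simp
      then have h1: "h \<le> 2 * k" by linarith
      define b where "b = nat h"
      have b: "h = int b" "b \<le> 2 * q" using h0 h1 q by (auto simp: b_def)
      have "norm (quad_sum \<theta> a M) ^ 5 \<le> C0 * (real M ^ 3 +
         real M ^ 5 * real q powr (-5/2) / (1 + ((real M)\<^sup>2 * (2 * \<theta> - of_int h / real q))\<^sup>2))"
        using M q hk by (intro bd) (auto simp: less_eq_real_def)
      also have "\<dots> = C0 * (real M ^ 3 + real M ^ 5 * real q powr (-5/2) * F q b \<theta>)"
        by (simp add: F_def b)
      also have "\<dots> \<le> H \<theta>"
      proof -
        have "real M ^ 5 * real q powr (-5/2) * F q b \<theta> \<le>
            (\<Sum>b\<in>{..2*q}. real M ^ 5 * real q powr (-5/2) * F q b \<theta>)"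
          using b F0 by (intro member_le_sum[where f = "\<lambda>b. real M ^ 5 * real q powr (-5/2) * F q b \<theta>"]) auto
        also have "\<dots> \<le> (\<Sum>q\<in>{1..2*M}. \<Sum>b\<in>{..2*q}. real M ^ 5 * real q powr (-5/2) * F q b \<theta>)"
          using q F0 by (intro member_le_sum[where f =
            "\<lambda>q. \<Sum>b\<in>{..2*q}. real M ^ 5 * real q powr (-5/2) * F q b \<theta>"]) (auto intro!: sum_nonneg)
        finally show ?thesis unfolding H_def using C0 by (intro mult_left_mono add_left_mono) auto
      qed
      finally show ?thesis .
    qed
    have "integral {0..1} H = C0 * (real M ^ 3 +
      (\<Sum>q\<in>{1..2*M}. \<Sum>b\<in>{..2*q}. real M ^ 5 * real q powr (-5/2) * integral {0..1} (F q b)))"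
    proof -
      have "(H has_integral C0 * (real M ^ 3 * (1 - 0) +
        (\<Sum>q\<in>{1..2*M}. \<Sum>b\<in>{..2*q}. real M ^ 5 * real q powr (-5/2) * integral {0..1} (F q b)))) {0..1}"
        unfolding H_def
        by (intro has_integral_mult_right has_integral_add has_integral_sum integrable_integral
            integrable_continuous_interval Fcont)
          (use has_integral_const_real[of "real M ^ 3" 0 1] in auto)
      then show ?thesis by (simp add: integral_unique)
    qed
    also have "\<dots> \<le> C0 * (real M ^ 3 + (\<Sum>q\<in>{1..2*M}. 6 * real M ^ 3 * real q powr (-3/2)))"
    proof (intro mult_left_mono add_left_mono sum_mono)
      fix q assume q: "q \<in> {1..2*M}"
      have "(\<Sum>b\<in>{..2*q}. real M ^ 5 * real q powr (-5/2) * integral {0..1} (F q b)) \<le>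
          (\<Sum>b\<in>{..2*q}. real M ^ 5 * real q powr (-5/2) * (2 / (real M)\<^sup>2))"
        unfolding F_def using M
        by (intro sum_mono mult_left_mono integral_lorentz_le) auto
      also have "\<dots> = real (2 * q + 1) * (2 * real M ^ 3 * real q powr (-5/2))"
        using M by (simp add: field_simps power_numeral_reduce)
      also have "\<dots> \<le> 3 * real q * (2 * real M ^ 3 * real q powr (-5/2))"
        using q by (intro mult_right_mono) auto
      also have "\<dots> = 6 * real M ^ 3 * (real q powr 1 * real q powr (-5/2))"
        using q by simp
      also have "real q powr 1 * real q powr (-5/2) = real q powr (-3/2)"
        by (simp only: powr_add[symmetric]) simp
      finally show "(\<Sum>b\<in>{..2*q}. real M ^ 5 * real q powr (-5/2) * integral {0..1} (F q b)) \<le>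
          6 * real M ^ 3 * real q powr (-3/2)" .
    qed (use C0 in auto)
    also have "\<dots> = C0 * (real M ^ 3 + 6 * real M ^ 3 * (\<Sum>q\<in>{1..2*M}. real q powr (-3/2)))"
      by (simp add: sum_distrib_left)
    also have "\<dots> \<le> C0 * (real M ^ 3 + 6 * real M ^ 3 * Z)"
      unfolding Z_def using C0 summ
      by (intro mult_left_mono add_left_mono sum_le_suminf) auto
    also have "\<dots> = C * real M ^ 3" by (simp add: C_def algebra_simps)
    finally show "\<exists>H. continuous_on {0..1} H \<and> (\<forall>\<theta>. 0 \<le> H \<theta>) \<and>
       (\<forall>\<theta>\<in>{0..1}. \<forall>a. norm (quad_sum \<theta> a M) ^ 5 \<le> H \<theta>) \<and>
       integral {0..1} H \<le> C * real M ^ 3"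
      using cont H0 dom by blast
  qed
qed

lemma continuous_on_quad_sum: "continuous_on S (\<lambda>\<theta>. quad_sum \<theta> a M)"
  unfolding quad_sum_def by (intro continuous_intros)

text \<open>Multiplying out the product of the quadratic sums gives one exponential with frequency \<open>\<bar>l\<bar>\<^sup>2\<close> for each \<open>l\<close>
  in the box; integrating against the exponential with frequency \<open>- n\<close> counts the \<open>l\<close> with \<open>\<bar>l\<bar>\<^sup>2 = n\<close>.\<close>

lemma card_sphere_box_le_integral:
  fixes a :: "'d::finite \<Rightarrow> int" and n :: int
  shows "real (card {l :: int ^ 'd. (\<forall>i. l $ i \<in> {a i..<a i + int M}) \<and> (\<Sum>i\<in>UNIV. (l $ i)\<^sup>2) = n}) \<le>
    integral {0..1} (\<lambda>\<theta>. \<Prod>i\<in>UNIV. norm (quad_sum \<theta> (a i) M))"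
proof -
  define X where "X = PiE (UNIV :: 'd set) (\<lambda>_. {..<M})"
  define s where "s f = (\<Sum>i\<in>UNIV. (a i + int (f i))\<^sup>2)" for f :: "'d \<Rightarrow> nat"
  let ?A = "{l :: int ^ 'd. (\<forall>i. l $ i \<in> {a i..<a i + int M}) \<and> (\<Sum>i\<in>UNIV. (l $ i)\<^sup>2) = n}"
  have finX: "finite X" unfolding X_def by (intro finite_PiE) auto
  have card_eq: "card ?A = card {f \<in> X. s f = n}"
  proof (rule bij_betw_same_card[of "\<lambda>l i. nat (l $ i - a i)"], rule bij_betw_byWitness[where f' = "\<lambda>f. \<chi> i. a i + int (f i)"])
    have "nat (l $ i - a i) < M" if "\<forall>i. a i \<le> l $ i \<and> l $ i < a i + int M" for l :: "int ^ 'd" and i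
      using that[rule_format, of i] by linarith
    then show "(\<lambda>l i. nat (l $ i - a i)) ` ?A \<subseteq> {f \<in> X. s f = n}"
      by (auto simp: X_def s_def)
  qed (auto simp: X_def s_def vec_eq_iff)
  define P where "P \<theta> = (\<Prod>i\<in>UNIV. quad_sum \<theta> (a i) M) * cis (- (2 * pi * (of_int n * \<theta>)))" for \<theta>
  have P_eq: "P \<theta> = (\<Sum>f\<in>X. cis (2 * pi * (of_int (s f - n) * \<theta>)))" for \<theta>
  proof -
    have prod_cis: "(\<Prod>i\<in>I. cis (g i)) = cis (\<Sum>i\<in>I. g i)" for g :: "'d \<Rightarrow> real" and I
      by (induction I rule: infinite_finite_induct) (auto simp: cis_mult)
    show ?thesis
      unfolding P_def quad_sum_def X_def
      by (subst prod_sum_PiE) (auto simp: prod_cis s_def sum_distrib_right cis_mult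
          sum_distrib_left algebra_simps intro!: sum.cong)
  qed
  have "(P has_integral (\<Sum>f\<in>X. if s f - n = 0 then 1 else 0)) {0..1}"
    unfolding P_eq[abs_def] by (intro has_integral_sum finX has_integral_cis)
  also have "(\<Sum>f\<in>X. if s f - n = 0 then 1 else 0 :: complex) = of_nat (card {f \<in> X. s f = n})"
    using finX by (subst sum.inter_filter[symmetric]) auto
  finally have int: "(P has_integral of_nat (card ?A)) {0..1}" by (simp only: card_eq)
  have "norm (integral {0..1} P) \<le> integral {0..1} (\<lambda>\<theta>. \<Prod>i\<in>UNIV. norm (quad_sum \<theta> (a i) M))"
  proof (rule Henstock_Kurzweil_Integration.integral_norm_bound_integral)
    show "P integrable_on {0..1}" using int by (rule has_integral_integrable)
    show "(\<lambda>\<theta>. \<Prod>i\<in>UNIV. norm (quad_sum \<theta> (a i) M)) integrable_on {0..1}"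
      by (intro integrable_continuous_interval continuous_intros continuous_on_quad_sum)
  qed (simp add: P_def norm_mult prod_norm)
  then show ?thesis using int by (simp add: integral_unique)
qed

theorem card_sphere_box_le:
  assumes d: "5 \<le> CARD('d::finite)"
  obtains C :: real where "0 < C" and
    "\<And>M (a :: 'd \<Rightarrow> int) n. 0 < M \<Longrightarrow>
      real (card {l :: int ^ 'd. (\<forall>i. l $ i \<in> {a i..<a i + int M}) \<and> (\<Sum>i\<in>UNIV. (l $ i)\<^sup>2) = n}) \<le>
        C * real M ^ (CARD('d) - 2)"
proof -
  obtain C :: real where C: "0 < C" and
    maj: "\<And>M. 0 < M \<Longrightarrow> \<exists>H. continuous_on {0..1} H \<and> (\<forall>\<theta>. 0 \<le> H \<theta>) \<and>
       (\<forall>\<theta>\<in>{0..1}. \<forall>a. norm (quad_sum \<theta> a M) ^ 5 \<le> H \<theta>) \<and>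
       integral {0..1} H \<le> C * real M ^ 3"
    using quad_sum_majorant by blast
  show thesis
  proof (rule that[OF C])
    fix M :: nat and a :: "'d \<Rightarrow> int" and n :: int
    assume M: "0 < M"
    obtain H where H: "continuous_on {0..1} H" "\<And>\<theta>. 0 \<le> H \<theta>"
       "\<And>\<theta> a. \<theta>\<in>{0..1} \<Longrightarrow> norm (quad_sum \<theta> a M) ^ 5 \<le> H \<theta>"
       "integral {0..1} H \<le> C * real M ^ 3"
      using maj[OF M] by blast
    have prod_le: "(\<Prod>i\<in>UNIV. norm (quad_sum \<theta> (a i) M)) \<le> real M ^ (CARD('d) - 5) * H \<theta>"
      if \<theta>: "\<theta> \<in> {0..1}" for \<theta>
    proof -
      \<comment> \<open>Five factors are estimated by the majorant, the other ones trivially.\<close>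
      define g where "g = min (real M) (root 5 (H \<theta>))"
      have g0: "0 \<le> g" using H(2) by (simp add: g_def)
      have "norm (quad_sum \<theta> (a i) M) \<le> g" for i
        unfolding g_def using real_root_le_mono[OF _ H(3)[OF \<theta>, of "a i"], of 5]
          norm_quad_sum_le[of \<theta> "a i" M] by (simp add: real_root_power_cancel)
      then have "(\<Prod>i\<in>(UNIV :: 'd set). norm (quad_sum \<theta> (a i) M)) \<le> (\<Prod>i\<in>(UNIV :: 'd set). g)"
        by (intro prod_mono) auto
      also have "\<dots> = g ^ (CARD('d) - 5) * g ^ 5" using d by (simp flip: power_add)
      also have "\<dots> \<le> real M ^ (CARD('d) - 5) * (root 5 (H \<theta>)) ^ 5"
        using g0 by (intro mult_mono power_mono) (auto simp: g_def)
      also have "(root 5 (H \<theta>)) ^ 5 = H \<theta>" using H(2) by simp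
      finally show ?thesis .
    qed
    have "integral {0..1} (\<lambda>\<theta>. \<Prod>i\<in>UNIV. norm (quad_sum \<theta> (a i) M)) \<le>
        integral {0..1} (\<lambda>\<theta>. real M ^ (CARD('d) - 5) * H \<theta>)"
      by (intro Henstock_Kurzweil_Integration.integral_le integrable_continuous_interval
          continuous_intros continuous_on_quad_sum H prod_le)
    also have "\<dots> = real M ^ (CARD('d) - 5) * integral {0..1} H" by simp
    also have "\<dots> \<le> real M ^ (CARD('d) - 5) * (C * real M ^ 3)"
      using H(4) by (intro mult_left_mono) auto
    also have "\<dots> = C * (real M ^ (CARD('d) - 5) * real M ^ 3)" by simp
    also have "real M ^ (CARD('d) - 5) * real M ^ 3 = real M ^ (CARD('d) - 2)"
      using d by (simp flip: power_add)
    finally show "real (card {l :: int ^ 'd. (\<forall>i. l $ i \<in> {a i..<a i + int M}) \<and> (\<Sum>i\<in>UNIV. (l $ i)\<^sup>2) = n}) \<le>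
        C * real M ^ (CARD('d) - 2)"
      using card_sphere_box_le_integral[of a M n] by linarith
  qed
qed

section \<open>Trigonometric polynomials on the torus\<close>

lemma real_vec_add: "real_vec (k + l) = real_vec k + real_vec l"
  by (simp add: real_vec_def vec_eq_iff)

lemma real_vec_minus: "real_vec (- k) = - real_vec k"
  by (simp add: real_vec_def vec_eq_iff)

lemma real_vec_diff: "real_vec (k - l) = real_vec k - real_vec l"
  by (simp add: real_vec_def vec_eq_iff)

lemma real_vec_0 [simp]: "real_vec 0 = 0"
  by (simp add: real_vec_def vec_eq_iff)

lemma real_vec_eq_iff [simp]: "real_vec k = real_vec l \<longleftrightarrow> k = l"
  by (simp add: real_vec_def vec_eq_iff)

lemma character_abs_torus: "character k (abs_torus x) = cis (2 * pi * (real_vec k \<bullet> x))"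
  by (simp add: character.abs_eq cis_conv_exp mult_ac)

lemma character_0 [simp]: "character 0 x = 1"
  by (induction x rule: torus.abs_induct) (simp add: character_abs_torus)

lemma character_add: "character (k + l) x = character k x * character l x"
  by (induction x rule: torus.abs_induct)
    (simp add: character_abs_torus cis_mult real_vec_add inner_add_left distrib_left)

lemma cnj_character: "cnj (character k x) = character (- k) x"
  by (induction x rule: torus.abs_induct)
    (simp add: character_abs_torus cis_cnj real_vec_minus)

lemma norm_character [simp]: "norm (character k x) = 1"
  by (induction x rule: torus.abs_induct) (simp add: character_abs_torus)

lemma continuous_on_character: "continuous_on UNIV (character k)"
proof -
  have "open (abs_torus -` (character k -` B))" if "open B" for B
  proof -
    have "continuous_on UNIV (\<lambda>x. character k (abs_torus x))"
      unfolding character_abs_torus by (intro continuous_intros)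
    then have "open ((\<lambda>x. character k (abs_torus x)) -` B)"
      using that continuous_on_open_vimage[of UNIV "\<lambda>x. character k (abs_torus x)"] by simp
    then show ?thesis by (simp add: vimage_def)
  qed
  then show ?thesis by (simp add: continuous_on_open_vimage open_torus_def)
qed

lemma measurable_character [measurable]: "character k \<in> borel_measurable borel"
  by (rule borel_measurable_continuous_onI) (rule continuous_on_character)

lemma measurable_cis_linear [measurable]: "(\<lambda>t. cis (2 * pi * (a * t))) \<in> borel_measurable borel"
  by (intro borel_measurable_continuous_onI continuous_intros)

lemma lebesgue_integral_cis:
  fixes m :: int
  defines "h \<equiv> \<lambda>t. indicator {0..<1} t *\<^sub>R cis (2 * pi * (of_int m * t))"
  shows "integrable lborel h" and "(\<integral>t. h t \<partial>lborel) = (if m = 0 then 1 else 0)"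
proof -
  define h' where "h' = (\<lambda>t. indicator {0..1} t *\<^sub>R cis (2 * pi * (of_int m * t)))"
  have cont: "continuous_on {0..1} (\<lambda>t. cis (2 * pi * (of_int m * t)))"
    by (intro continuous_intros)
  have int': "set_integrable lborel {0..1} (\<lambda>t. cis (2 * pi * (of_int m * t)))"
    by (rule borel_integrable_atLeastAtMost'[OF cont])
  have ae: "AE t in lborel. h t = h' t"
  proof -
    have "AE t in lborel. t \<noteq> (1::real)" by (rule AE_lborel_singleton)
    then show ?thesis by eventually_elim (auto simp: h_def h'_def indicator_def)
  qed
  have meas: "h \<in> borel_measurable lborel" "h' \<in> borel_measurable lborel"
    unfolding h_def h'_def by measurable
  show "integrable lborel h"
    using int' integrable_cong_AE[OF meas ae] by (simp add: set_integrable_def h'_def)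
  have "(\<integral>t. h t \<partial>lborel) = (\<integral>t. h' t \<partial>lborel)"
    using ae meas by (intro integral_cong_AE)
  also have "\<dots> = integral {0..1} (\<lambda>t. cis (2 * pi * (of_int m * t)))"
    using set_borel_integral_eq_integral(2)[OF int'] by (simp add: set_lebesgue_integral_def h'_def)
  also have "\<dots> = (if m = 0 then 1 else 0)"
    by (rule integral_unique[OF has_integral_cis])
  finally show "(\<integral>t. h t \<partial>lborel) = (if m = 0 then 1 else 0)" .
qed

abbreviation unit_cube :: "(real ^ 'd) set" where
  "unit_cube \<equiv> {x. \<forall>i. 0 \<le> x $ i \<and> x $ i < 1}"

lemma unit_cube_borel [measurable]: "(unit_cube :: (real ^ 'd::finite) set) \<in> sets borel"
  by measurable

lemma integral_torus_lebesgue: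
  fixes f :: "'d::finite torus \<Rightarrow> 'b::{banach, second_countable_topology}"
  assumes [measurable]: "f \<in> borel_measurable borel"
  shows "(\<integral>x. f x \<partial>torus_lebesgue) = (\<integral>x. indicator unit_cube x *\<^sub>R f (abs_torus x) \<partial>lborel)"
proof -
  have [measurable]: "abs_torus \<in> measurable (restrict_space lborel (unit_cube :: (real ^ 'd) set)) borel"
    by (rule measurable_restrict_space1) simp
  show ?thesis
    unfolding torus_lebesgue_def
    by (subst integral_distr) (auto simp: integral_restrict_space)
qed

lemma sets_torus_lebesgue [measurable_cong, simp]: "sets torus_lebesgue = sets borel"
  by (simp add: torus_lebesgue_def)

text \<open>Lebesgue measure on \<open>real ^ 'd\<close> is the image of a product measure, and the character restricted to the unit
  cube factors over the coordinates; a coordinate with nonzero frequency has integral zero.\<close>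

lemma integral_character:
  "(\<integral>x. character k x \<partial>torus_lebesgue) = (if k = 0 then 1 else 0)"
proof -
  interpret product_sigma_finite "\<lambda>_ :: real ^ 'a. lborel :: real measure"
    by standard
  define h where "h b t = indicator {0..<1} t *\<^sub>R cis (2 * pi * ((real_vec k \<bullet> b) * t))"
    for b :: "real ^ 'a" and t :: real
  have coord: "\<exists>m. real_vec k \<bullet> b = of_int m" if "b \<in> Basis" for b
    using that by (auto simp: Basis_vec_def inner_axis real_vec_def)
  have h_int: "integrable lborel (h b)"
    and h_val: "(\<integral>t. h b t \<partial>lborel) = (if real_vec k \<bullet> b = 0 then 1 else 0)" if "b \<in> Basis" for b
    using coord[OF that] lebesgue_integral_cis by (auto simp: h_def[abs_def])
  have prod_cis: "(\<Prod>i\<in>I. cis (g i)) = cis (\<Sum>i\<in>I. g i)" for g :: "real ^ 'a \<Rightarrow> real" and I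
    by (induction I rule: infinite_finite_induct) (auto simp: cis_mult)
  have fac: "indicator unit_cube x *\<^sub>R character k (abs_torus x) = (\<Prod>b\<in>Basis. h b (x \<bullet> b))" for x
  proof -
    have "(indicator unit_cube x :: real) = (\<Prod>b\<in>Basis. indicator {0..<1} (x \<bullet> b))"
    proof (cases "x \<in> unit_cube")
      case True
      then have "indicator {0..<1} (x \<bullet> b) = (1 :: real)" if "b \<in> Basis" for b
        using that by (auto simp: Basis_vec_def inner_axis)
      with True show ?thesis by simp
    next
      case False
      then obtain i where "\<not> (0 \<le> x $ i \<and> x $ i < 1)" by auto
      then have "indicator {0..<1} (x \<bullet> axis i 1) = (0 :: real)" by (auto simp: inner_axis)
      then have "(\<Prod>b\<in>Basis. indicator {0..<1} (x \<bullet> b)) = (0 :: real)"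
        by (intro prod_zero finite_Basis bexI[of _ "axis i 1"]) auto
      with False show ?thesis by simp
    qed
    moreover have "character k (abs_torus x) = (\<Prod>b\<in>Basis. cis (2 * pi * ((real_vec k \<bullet> b) * (x \<bullet> b))))"
      unfolding prod_cis character_abs_torus
      by (subst euclidean_inner) (simp add: sum_distrib_left)
    ultimately show ?thesis
      by (simp add: h_def scaleR_conv_of_real prod.distrib)
  qed
  have "(\<integral>x. character k x \<partial>torus_lebesgue) = (\<integral>x. (\<Prod>b\<in>Basis. h b (x \<bullet> b)) \<partial>lborel)"
    by (subst integral_torus_lebesgue) (auto simp: fac)
  also have "\<dots> = (\<integral>f. (\<Prod>b\<in>Basis. h b ((\<Sum>b\<in>Basis. f b *\<^sub>R b) \<bullet> b)) \<partial>(\<Pi>\<^sub>M b\<in>Basis. lborel))"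
  proof (subst lborel_eq, rule integral_distr)
    have "h b \<in> borel_measurable borel" for b
      unfolding h_def by measurable
    then show "(\<lambda>x. \<Prod>b\<in>Basis. h b (x \<bullet> b)) \<in> borel_measurable borel" by measurable
  qed measurable
  also have "\<dots> = (\<integral>f. (\<Prod>b\<in>Basis. h b (f b)) \<partial>(\<Pi>\<^sub>M b\<in>Basis. lborel))"
    by (intro Bochner_Integration.integral_cong prod.cong refl) (simp add: inner_sum_left inner_Basis if_distrib sum.delta cong: if_cong)
  also have "\<dots> = (\<Prod>b\<in>Basis. \<integral>t. h b t \<partial>lborel)"
    by (rule product_integral_prod) (auto intro: h_int)
  also have "\<dots> = (if k = 0 then 1 else 0)"
  proof (cases "k = 0")
    case False
    then have "real_vec k \<noteq> 0" by (metis real_vec_0 real_vec_eq_iff)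
    then obtain b where "b \<in> Basis" "real_vec k \<bullet> b \<noteq> 0" by (metis euclidean_all_zero_iff)
    then have "(\<Prod>b\<in>Basis. \<integral>t. h b t \<partial>lborel) = 0"
      by (intro prod_zero finite_Basis bexI[of _ b]) (auto simp: h_val)
    with False show ?thesis by simp
  qed (simp add: h_val)
  finally show ?thesis .
qed

lemma prob_space_torus_lebesgue: "prob_space (torus_lebesgue :: 'd::finite torus measure)"
proof
  have "emeasure torus_lebesgue (space (torus_lebesgue :: 'd torus measure)) =
      emeasure lborel (unit_cube :: (real ^ 'd) set)"
    unfolding torus_lebesgue_def
    by (subst emeasure_distr)
      (auto intro!: measurable_restrict_space1 simp: space_restrict_space emeasure_restrict_space)
  also have "\<dots> < \<infinity>"
  proof -
    have "(unit_cube :: (real ^ 'd) set) \<subseteq> cbox 0 (\<chi> i. (1::real))"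
      by (auto simp: mem_box_cart less_imp_le)
    then have "emeasure lborel (unit_cube :: (real ^ 'd) set) \<le> emeasure lborel (cbox 0 (\<chi> i. (1::real)) :: (real ^ 'd) set)"
      by (intro emeasure_mono) auto
    also have "\<dots> < \<infinity>" by (rule emeasure_lborel_cbox_finite)
    finally show ?thesis .
  qed
  finally have fin: "emeasure torus_lebesgue (space (torus_lebesgue :: 'd torus measure)) \<noteq> \<infinity>" by simp
  have "(\<integral>x. character 0 x \<partial>(torus_lebesgue :: 'd torus measure)) = 1"
    by (subst integral_character) simp
  then have "measure (torus_lebesgue :: 'd torus measure) (space torus_lebesgue) = 1"
    by (simp add: complex_eq_iff)
  then show "emeasure torus_lebesgue (space (torus_lebesgue :: 'd torus measure)) = 1"
    using fin by (simp add: emeasure_eq_ennreal_measure)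
qed

definition trig_sum :: "(int ^ 'd) set \<Rightarrow> (int ^ 'd \<Rightarrow> complex) \<Rightarrow> 'd::finite torus \<Rightarrow> complex" where
  "trig_sum A c x = (\<Sum>k\<in>A. c k * character k x)"

lemma measurable_trig_sum [measurable]: "trig_sum A c \<in> borel_measurable borel"
  unfolding trig_sum_def[abs_def] by measurable

lemma norm_trig_sum_le: "norm (trig_sum A c x) \<le> (\<Sum>k\<in>A. norm (c k))"
  unfolding trig_sum_def by (rule order_trans[OF norm_sum]) (simp add: norm_mult)

lemma cmod_trig_sum_square:
  "complex_of_real ((cmod (trig_sum A c x))\<^sup>2) =
    (\<Sum>k\<in>A. \<Sum>l\<in>A. c k * cnj (c l) * character (- (l - k)) x)"
proof -
  have "complex_of_real ((cmod (trig_sum A c x))\<^sup>2) = trig_sum A c x * cnj (trig_sum A c x)"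
    by (rule complex_norm_square)
  also have "\<dots> = (\<Sum>k\<in>A. \<Sum>l\<in>A. (c k * character k x) * cnj (c l * character l x))"
    by (simp add: trig_sum_def sum_product)
  also have "\<dots> = (\<Sum>k\<in>A. \<Sum>l\<in>A. c k * cnj (c l) * character (- (l - k)) x)"
  proof (intro sum.cong refl)
    fix k l
    have "character (- (l - k)) x = character k x * character (- l) x"
      by (simp flip: character_add)
    then show "(c k * character k x) * cnj (c l * character l x) = c k * cnj (c l) * character (- (l - k)) x"
      by (simp add: cnj_character)
  qed
  finally show ?thesis .
qed

context
  fixes \<mu> :: "'d::finite torus measure"
  assumes prob: "prob_space \<mu>" and sets_\<mu>: "sets \<mu> = sets borel"
begin

interpretation prob_space \<mu> by (rule prob)

lemma integrable_character [simp]: "integrable \<mu> (character k)"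
proof (rule integrable_const_bound[of _ 1])
  show "character k \<in> borel_measurable \<mu>"
    using measurable_character by (simp add: measurable_cong_sets[OF sets_\<mu> refl])
qed simp

lemma fourier_coeff_0: "fourier_coeff \<mu> 0 = 1"
  by (simp add: fourier_coeff_def prob_space)

lemma fourier_coeff_uminus: "fourier_coeff \<mu> (- k) = cnj (fourier_coeff \<mu> k)"
proof -
  have "cnj (fourier_coeff \<mu> k) = (\<integral>x. cnj (character (- k) x) \<partial>\<mu>)"
    unfolding fourier_coeff_def by (simp add: Bochner_Integration.integral_cnj)
  then show ?thesis by (simp add: fourier_coeff_def cnj_character)
qed

lemma norm_fourier_coeff_le_1: "norm (fourier_coeff \<mu> k) \<le> 1"
proof -
  have "norm (fourier_coeff \<mu> k) \<le> (\<integral>x. norm (character (- k) x) \<partial>\<mu>)"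
    unfolding fourier_coeff_def by (rule integral_norm_bound)
  then show ?thesis by (simp add: prob_space)
qed

lemma integral_trig_sum: "(\<integral>x. trig_sum A c x \<partial>\<mu>) = (\<Sum>k\<in>A. c k * fourier_coeff \<mu> (- k))"
  unfolding trig_sum_def fourier_coeff_def by simp

lemma integral_cmod_trig_sum:
  "complex_of_real (\<integral>x. (cmod (trig_sum A c x))\<^sup>2 \<partial>\<mu>) =
    (\<Sum>k\<in>A. \<Sum>l\<in>A. c k * cnj (c l) * fourier_coeff \<mu> (l - k))"
  unfolding integral_complex_of_real[symmetric] cmod_trig_sum_square fourier_coeff_def by simp

end

lemma parseval_trig_sum:
  assumes "finite A"
  shows "(\<integral>x. (cmod (trig_sum A c x))\<^sup>2 \<partial>torus_lebesgue) = (\<Sum>k\<in>A. (cmod (c k))\<^sup>2)"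
proof -
  have fc: "fourier_coeff torus_lebesgue m = (if m = 0 then 1 else 0)" for m :: "int ^ 'a"
    by (simp add: fourier_coeff_def integral_character)
  have "complex_of_real (\<integral>x. (cmod (trig_sum A c x))\<^sup>2 \<partial>torus_lebesgue) =
    (\<Sum>k\<in>A. \<Sum>l\<in>A. c k * cnj (c l) * fourier_coeff torus_lebesgue (l - k))"
    by (intro integral_cmod_trig_sum prob_space_torus_lebesgue sets_torus_lebesgue)
  also have "\<dots> = (\<Sum>k\<in>A. \<Sum>l\<in>A. if k = l then c k * cnj (c k) else 0)"
    by (intro sum.cong refl) (simp add: fc)
  also have "\<dots> = (\<Sum>k\<in>A. c k * cnj (c k))"
    using assms by (simp add: sum.delta)
  also have "\<dots> = complex_of_real (\<Sum>k\<in>A. (cmod (c k))\<^sup>2)"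
    by (simp add: complex_norm_square del: of_real_power)
  finally show ?thesis by (simp only: of_real_eq_iff)
qed

section \<open>Lattice caps and the trace inequality\<close>

lemma finite_int_box: "finite {l :: int ^ 'd::finite. \<forall>i. l $ i \<in> {a i..<a i + int M}}"
  and card_int_box: "card {l :: int ^ 'd::finite. \<forall>i. l $ i \<in> {a i..<a i + int M}} = M ^ CARD('d)"
proof -
  let ?B = "PiE (UNIV :: 'd set) (\<lambda>i. {a i..<a i + int M})"
  have bij: "bij_betw vec_lambda ?B {l :: int ^ 'd. \<forall>i. l $ i \<in> {a i..<a i + int M}}"
    by (rule bij_betw_byWitness[where f' = vec_nth]) (auto simp: PiE_def)
  show "finite {l :: int ^ 'd::finite. \<forall>i. l $ i \<in> {a i..<a i + int M}}"
    using bij_betw_finite[OF bij] by (simp add: finite_PiE)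
  show "card {l :: int ^ 'd::finite. \<forall>i. l $ i \<in> {a i..<a i + int M}} = M ^ CARD('d)"
    using bij_betw_same_card[OF bij] by (simp add: card_PiE)
qed

lemma abs_component_le_norm: "real_of_int \<bar>k $ i\<bar> \<le> norm (real_vec k)"
  using component_le_norm_cart[of "real_vec k" i] by (simp add: real_vec_def)

lemma one_le_norm_real_vec:
  assumes "k \<noteq> 0"
  shows "1 \<le> norm (real_vec k)"
proof -
  obtain i where "k $ i \<noteq> 0" using assms by (auto simp: vec_eq_iff)
  then have "1 \<le> \<bar>k $ i\<bar>" by simp
  then have "1 \<le> real_of_int \<bar>k $ i\<bar>" by (simp only: of_int_1_le_iff)
  then show ?thesis using abs_component_le_norm[of k i] by linarith
qed

lemma ball_subset_box:
  "{l :: int ^ 'd::finite. norm (real_vec (l - k)) \<le> real N} \<subseteq>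
    {l. \<forall>i. l $ i \<in> {k $ i - int N..<(k $ i - int N) + int (2 * N + 1)}}"
proof safe
  fix l :: "int ^ 'd" and i
  assume "norm (real_vec (l - k)) \<le> real N"
  then have "real_of_int \<bar>l $ i - k $ i\<bar> \<le> real_of_int (int N)"
    using abs_component_le_norm[of "l - k" i] by simp
  then have "\<bar>l $ i - k $ i\<bar> \<le> int N" by (simp only: of_int_le_iff)
  then show "l $ i \<in> {k $ i - int N..<(k $ i - int N) + int (2 * N + 1)}" by auto
qed

lemma finite_lattice_ball: "finite {l :: int ^ 'd::finite. norm (real_vec (l - k)) \<le> R}"
proof (rule finite_subset)
  show "{l. norm (real_vec (l - k)) \<le> R} \<subseteq> {l. norm (real_vec (l - k)) \<le> real (nat \<lceil>R\<rceil>)}"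
    by (auto intro: order_trans[OF _ real_nat_ceiling_ge])
  show "finite {l. norm (real_vec (l - k)) \<le> real (nat \<lceil>R\<rceil>)}"
    by (rule finite_subset[OF ball_subset_box finite_int_box])
qed

lemma finite_lattice_sphere: "finite (lattice_sphere r :: (int ^ 'd::finite) set)"
  by (rule finite_subset[OF _ finite_lattice_ball[of 0 r]]) (auto simp: lattice_sphere_def)

lemma norm_real_vec_square: "(norm (real_vec k))\<^sup>2 = of_int (\<Sum>i\<in>UNIV. (k $ i)\<^sup>2)"
  unfolding power2_norm_eq_inner inner_vec_def by (simp add: real_vec_def power2_eq_square)

text \<open>A ball of radius \<open>2 ^ (j + 1)\<close> around \<open>k\<close> lies in a box of side \<open>M = 2 * 2 ^ (j + 1) + 1 \<le> 5 * 2 ^ j\<close>.\<close>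

lemma card_lattice_cap_le:
  assumes d: "5 \<le> CARD('d::finite)"
  obtains C :: real where "0 < C" and
    "\<And>r (k :: int ^ 'd) j. k \<in> lattice_sphere r \<Longrightarrow>
      real (card {l \<in> lattice_sphere r. norm (real_vec (l - k)) \<le> 2 ^ (j + 1)}) \<le> C * 2 ^ (j * (CARD('d) - 2))"
proof -
  obtain C :: real where C: "0 < C" and
    le: "\<And>M (a :: 'd \<Rightarrow> int) n. 0 < M \<Longrightarrow>
      real (card {l :: int ^ 'd. (\<forall>i. l $ i \<in> {a i..<a i + int M}) \<and> (\<Sum>i\<in>UNIV. (l $ i)\<^sup>2) = n}) \<le>
        C * real M ^ (CARD('d) - 2)"
    using card_sphere_box_le[OF d] by blast
  show thesis
  proof (rule that)
    show "0 < C * 5 ^ (CARD('d) - 2)" using C by simp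
    fix r and k :: "int ^ 'd" and j :: nat
    assume k: "k \<in> lattice_sphere r"
    define N :: nat where "N = 2 ^ (j + 1)"
    define a where "a i = k $ i - int N" for i
    define n where "n = (\<Sum>i\<in>UNIV. (k $ i)\<^sup>2)"
    let ?B = "{l :: int ^ 'd. (\<forall>i. l $ i \<in> {a i..<a i + int (2 * N + 1)}) \<and> (\<Sum>i\<in>UNIV. (l $ i)\<^sup>2) = n}"
    have "{l \<in> lattice_sphere r. norm (real_vec (l - k)) \<le> 2 ^ (j + 1)} \<subseteq> ?B"
    proof
      fix l assume l: "l \<in> {l \<in> lattice_sphere r. norm (real_vec (l - k)) \<le> 2 ^ (j + 1)}"
      then have "norm (real_vec l) = norm (real_vec k)" using k by (simp add: lattice_sphere_def)
      then have "(\<Sum>i\<in>UNIV. (l $ i)\<^sup>2) = n"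
        unfolding n_def by (metis norm_real_vec_square of_int_eq_iff)
      then show "l \<in> ?B"
        using l ball_subset_box[of k N] by (auto simp: a_def N_def)
    qed
    then have "card {l \<in> lattice_sphere r. norm (real_vec (l - k)) \<le> 2 ^ (j + 1)} \<le> card ?B"
      by (intro card_mono finite_subset[OF _ finite_int_box[of a "2 * N + 1"]]) auto
    then have "real (card {l \<in> lattice_sphere r. norm (real_vec (l - k)) \<le> 2 ^ (j + 1)}) \<le>
        C * real (2 * N + 1) ^ (CARD('d) - 2)"
      using le[of "2 * N + 1" a n] by simp
    also have "\<dots> \<le> C * (5 * 2 ^ j) ^ (CARD('d) - 2)"
    proof -
      have "(1::nat) \<le> 2 ^ j" by simp
      then have "2 * N + 1 \<le> 5 * 2 ^ j" by (simp add: N_def)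
      then have "real (2 * N + 1) \<le> real (5 * 2 ^ j)" by (simp only: of_nat_le_iff)
      then show ?thesis using C by (intro mult_left_mono power_mono) auto
    qed
    also have "\<dots> = C * 5 ^ (CARD('d) - 2) * 2 ^ (j * (CARD('d) - 2))"
      by (simp add: power_mult_distrib power_mult)
    finally show "real (card {l \<in> lattice_sphere r. norm (real_vec (l - k)) \<le> 2 ^ (j + 1)}) \<le>
        C * 5 ^ (CARD('d) - 2) * 2 ^ (j * (CARD('d) - 2))" .
  qed
qed

lemma dyadic_shell:
  fixes x :: real
  assumes "1 \<le> x"
  obtains j :: nat where "2 ^ j \<le> x" "x < 2 ^ (j + 1)"
proof -
  define n where "n = (LEAST n. x < 2 ^ n)"
  have ex: "\<exists>n. x < 2 ^ n" using real_arch_pow[of 2 x] by simp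
  then have n: "x < 2 ^ n" unfolding n_def by (rule LeastI_ex)
  with assms have "n \<noteq> 0" by (metis leD power_0)
  then obtain j where j: "n = Suc j" by (metis not0_implies_Suc)
  then have "\<not> x < 2 ^ j" unfolding n_def by (metis lessI not_less_Least)
  then show ?thesis using n j that[of j] by simp
qed

definition shell_sup :: "'d::finite torus measure \<Rightarrow> nat \<Rightarrow> real" where
  "shell_sup \<mu> j = (SUP k\<in>{k. norm (real_vec k) \<in> {2 ^ j .. 2 ^ (j + 1)}}. cmod (fourier_coeff \<mu> k))"

text \<open>Dyadic decomposition. The shells overlap in their boundaries, as in the hypothesis of the theorem;
  this is harmless for nonnegative terms.\<close>

lemma sum_over_shells:
  fixes g :: "'a \<Rightarrow> real" and x :: "'a \<Rightarrow> real" and f :: "nat \<Rightarrow> real"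
  assumes fin: "finite L" and x: "\<And>l. l \<in> L \<Longrightarrow> 2 ^ J \<le> x l"
    and shell: "\<And>j. (\<Sum>l\<in>{l \<in> L. 2 ^ j \<le> x l \<and> x l \<le> 2 ^ (j + 1)}. g l) \<le> f j"
    and g: "\<And>l. l \<in> L \<Longrightarrow> 0 \<le> g l"
    and f: "summable f" "\<And>j. 0 \<le> f j"
  shows "(\<Sum>l\<in>L. g l) \<le> (\<Sum>j. f (j + J))"
proof -
  have "\<exists>j. 2 ^ j \<le> x l \<and> x l < 2 ^ (j + 1)" if "l \<in> L" for l
  proof -
    have "(1::real) \<le> 2 ^ J" by simp
    then have "1 \<le> x l" using x[OF that] by linarith
    then show ?thesis by (metis dyadic_shell)
  qed
  then obtain jj where jj: "\<And>l. l \<in> L \<Longrightarrow> 2 ^ jj l \<le> x l \<and> x l < 2 ^ (jj l + 1)"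
    by metis
  have jjJ: "J \<le> jj l" if "l \<in> L" for l
  proof -
    have "(2::real) ^ J < 2 ^ (jj l + 1)" using x[OF that] jj[OF that] by linarith
    then have "J < jj l + 1" by (rule power_less_imp_less_exp[rotated]) simp
    then show ?thesis by simp
  qed
  have "(\<Sum>l\<in>L. g l) = (\<Sum>j\<in>jj ` L. \<Sum>l\<in>{l \<in> L. jj l = j}. g l)"
    using fin by (intro sum.group[symmetric]) auto
  also have "\<dots> \<le> (\<Sum>j\<in>jj ` L. f j)"
  proof (rule sum_mono)
    fix j
    have "(\<Sum>l\<in>{l \<in> L. jj l = j}. g l) \<le> (\<Sum>l\<in>{l \<in> L. 2 ^ j \<le> x l \<and> x l \<le> 2 ^ (j + 1)}. g l)"
      using fin g jj by (intro sum_mono2) (auto simp: less_imp_le)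
    then show "(\<Sum>l\<in>{l \<in> L. jj l = j}. g l) \<le> f j" using shell[of j] by linarith
  qed
  also have "\<dots> = (\<Sum>i\<in>(\<lambda>j. j - J) ` jj ` L. f (i + J))"
    by (subst sum.reindex) (auto simp: jjJ inj_on_def eq_diff_iff intro!: sum.cong)
  also have "\<dots> \<le> (\<Sum>j. f (j + J))"
    using fin f by (intro sum_le_suminf) (auto simp: summable_iff_shift)
  finally show ?thesis .
qed

lemma schur_test:
  fixes c :: "'a \<Rightarrow> complex" and g :: "'a \<Rightarrow> 'a \<Rightarrow> complex"
  assumes fin: "finite A" and sym: "\<And>k l. k \<in> A \<Longrightarrow> l \<in> A \<Longrightarrow> norm (g k l) = norm (g l k)"
    and row: "\<And>k. k \<in> A \<Longrightarrow> (\<Sum>l\<in>A. norm (g k l)) \<le> T"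
  shows "norm (\<Sum>k\<in>A. \<Sum>l\<in>A. c k * cnj (c l) * g k l) \<le> T * (\<Sum>k\<in>A. (cmod (c k))\<^sup>2)"
proof -
  have "norm (\<Sum>k\<in>A. \<Sum>l\<in>A. c k * cnj (c l) * g k l) \<le>
      (\<Sum>k\<in>A. \<Sum>l\<in>A. norm (c k * cnj (c l) * g k l))"
    by (rule order_trans[OF norm_sum sum_mono[OF norm_sum]])
  also have "\<dots> \<le> (\<Sum>k\<in>A. \<Sum>l\<in>A. ((cmod (c k))\<^sup>2 / 2 + (cmod (c l))\<^sup>2 / 2) * norm (g k l))"
  proof (intro sum_mono)
    fix k l
    have "cmod (c k) * cmod (c l) \<le> (cmod (c k))\<^sup>2 / 2 + (cmod (c l))\<^sup>2 / 2"
      using sum_squares_bound[of "cmod (c k)" "cmod (c l)"] by simp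
    then show "norm (c k * cnj (c l) * g k l) \<le> ((cmod (c k))\<^sup>2 / 2 + (cmod (c l))\<^sup>2 / 2) * norm (g k l)"
      by (simp add: norm_mult mult_right_mono)
  qed
  also have "\<dots> = (\<Sum>k\<in>A. \<Sum>l\<in>A. (cmod (c k))\<^sup>2 / 2 * norm (g k l)) +
      (\<Sum>k\<in>A. \<Sum>l\<in>A. (cmod (c l))\<^sup>2 / 2 * norm (g k l))"
    by (simp add: distrib_right sum.distrib)
  also have "(\<Sum>k\<in>A. \<Sum>l\<in>A. (cmod (c l))\<^sup>2 / 2 * norm (g k l)) =
      (\<Sum>k\<in>A. \<Sum>l\<in>A. (cmod (c k))\<^sup>2 / 2 * norm (g k l))"
    by (subst sum.swap) (auto intro!: sum.cong simp: sym)
  also have "(\<Sum>k\<in>A. \<Sum>l\<in>A. (cmod (c k))\<^sup>2 / 2 * norm (g k l)) + (\<Sum>k\<in>A. \<Sum>l\<in>A. (cmod (c k))\<^sup>2 / 2 * norm (g k l))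
      = (\<Sum>k\<in>A. (cmod (c k))\<^sup>2 * (\<Sum>l\<in>A. norm (g k l)))"
    by (simp add: sum_distrib_left sum_distrib_right mult.commute flip: sum.distrib)
  also have "\<dots> \<le> (\<Sum>k\<in>A. (cmod (c k))\<^sup>2 * T)"
    by (intro sum_mono mult_left_mono row) auto
  also have "\<dots> = T * (\<Sum>k\<in>A. (cmod (c k))\<^sup>2)"
    by (simp add: sum_distrib_left mult.commute)
  finally show ?thesis .
qed

context
  fixes \<mu> :: "'d::finite torus measure"
  assumes d: "5 \<le> CARD('d)" and prob: "prob_space \<mu>" and sets_\<mu>: "sets \<mu> = sets borel"
    and decay: "summable (\<lambda>j. 2 ^ (j * (CARD('d) - 2)) * shell_sup \<mu> j)"
begin

lemma fourier_coeff_le_shell_sup: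
  assumes "2 ^ j \<le> norm (real_vec k)" "norm (real_vec k) \<le> 2 ^ (j + 1)"
  shows "cmod (fourier_coeff \<mu> k) \<le> shell_sup \<mu> j"
  unfolding shell_sup_def using assms norm_fourier_coeff_le_1[OF prob sets_\<mu>]
  by (intro cSUP_upper bdd_aboveI2[of _ _ 1]) auto

lemma shell_sup_nonneg: "0 \<le> shell_sup \<mu> j"
proof -
  fix i :: 'd
  have "real_vec (axis i (2 ^ j)) = (axis i (2 ^ j) :: real ^ 'd)"
    by (simp add: real_vec_def axis_def vec_eq_iff)
  then have "norm (real_vec (axis i (2 ^ j) :: int ^ 'd)) = 2 ^ j"
    by (simp add: norm_eq_sqrt_inner inner_axis_axis)
  then show ?thesis
    using fourier_coeff_le_shell_sup[of j "axis i (2 ^ j)"]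
    by (auto intro: order_trans[OF norm_ge_zero])
qed

text \<open>In the shell of radius \<open>2 ^ j\<close> around \<open>k\<close> the sphere has \<open>O(2 ^ (j * (d - 2)))\<close> lattice points, and there the
  Fourier coefficient is at most \<open>shell_sup \<mu> j\<close>.\<close>

lemma decay_tail:
  obtains C :: real where "0 < C" and
    "\<And>r k J. k \<in> lattice_sphere r \<Longrightarrow>
       (\<Sum>l\<in>{l \<in> lattice_sphere r. 2 ^ J \<le> norm (real_vec (l - k))}. cmod (fourier_coeff \<mu> (l - k)))
         \<le> C * (\<Sum>j. 2 ^ ((j + J) * (CARD('d) - 2)) * shell_sup \<mu> (j + J))"
proof -
  obtain C :: real where C: "0 < C" and
    cap: "\<And>r (k :: int ^ 'd) j. k \<in> lattice_sphere r \<Longrightarrow>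
      real (card {l \<in> lattice_sphere r. norm (real_vec (l - k)) \<le> 2 ^ (j + 1)}) \<le> C * 2 ^ (j * (CARD('d) - 2))"
    using card_lattice_cap_le[OF d] by blast
  show thesis
  proof (rule that[OF C])
    fix r and k :: "int ^ 'd" and J :: nat
    assume k: "k \<in> lattice_sphere r"
    define f where "f j = C * (2 ^ (j * (CARD('d) - 2)) * shell_sup \<mu> j)" for j
    let ?L = "{l \<in> lattice_sphere r. 2 ^ J \<le> norm (real_vec (l - k))}"
    have "(\<Sum>l\<in>?L. cmod (fourier_coeff \<mu> (l - k))) \<le> (\<Sum>j. f (j + J))"
    proof (rule sum_over_shells[where x = "\<lambda>l. norm (real_vec (l - k))"])
      show "finite ?L" by (simp add: finite_lattice_sphere)
      show "summable f" unfolding f_def by (intro summable_mult decay)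
      show "0 \<le> f j" for j using C shell_sup_nonneg by (simp add: f_def)
      fix j
      let ?S = "{l \<in> ?L. 2 ^ j \<le> norm (real_vec (l - k)) \<and> norm (real_vec (l - k)) \<le> 2 ^ (j + 1)}"
      have "(\<Sum>l\<in>?S. cmod (fourier_coeff \<mu> (l - k))) \<le> (\<Sum>l\<in>?S. shell_sup \<mu> j)"
        by (intro sum_mono fourier_coeff_le_shell_sup) auto
      also have "\<dots> = real (card ?S) * shell_sup \<mu> j" by simp
      also have "\<dots> \<le> (C * 2 ^ (j * (CARD('d) - 2))) * shell_sup \<mu> j"
      proof (intro mult_right_mono shell_sup_nonneg)
        have "card ?S \<le> card {l \<in> lattice_sphere r. norm (real_vec (l - k)) \<le> 2 ^ (j + 1)}"
          by (intro card_mono) (auto simp: finite_lattice_sphere)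
        then show "real (card ?S) \<le> C * 2 ^ (j * (CARD('d) - 2))" using cap[OF k, of j] by simp
      qed
      finally show "(\<Sum>l\<in>?S. cmod (fourier_coeff \<mu> (l - k))) \<le> f j" by (simp add: f_def)
    qed auto
    also have "\<dots> = C * (\<Sum>j. 2 ^ ((j + J) * (CARD('d) - 2)) * shell_sup \<mu> (j + J))"
      unfolding f_def using decay
      by (intro suminf_mult) (simp only: summable_iff_shift[where f = "\<lambda>j. 2 ^ (j * (CARD('d) - 2)) * shell_sup \<mu> j"])
    finally show "(\<Sum>l\<in>?L. cmod (fourier_coeff \<mu> (l - k)))
         \<le> C * (\<Sum>j. 2 ^ ((j + J) * (CARD('d) - 2)) * shell_sup \<mu> (j + J))" .
  qed
qed

text \<open>The shell of radius \<open>2 ^ j\<close> around the origin has \<open>O(2 ^ (j * d))\<close> lattice points, and \<open>d \<le> 2 * (d - 2)\<close>, so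
  the shell contributes at most a multiple of the square of the \<open>j\<close>-th term of the given series.\<close>

lemma fourier_coeff_square_summable:
  obtains B :: real where "\<And>A. finite A \<Longrightarrow> (\<Sum>k\<in>A. (cmod (fourier_coeff \<mu> k))\<^sup>2) \<le> B"
proof -
  define f where "f j = 2 ^ (j * (CARD('d) - 2)) * shell_sup \<mu> j" for j
  define F where "F = (\<Sum>j. f j)"
  have f0: "0 \<le> f j" for j using shell_sup_nonneg by (simp add: f_def)
  have sf: "summable f" using decay by (simp add: f_def[abs_def])
  have fF: "f j \<le> F" for j
    using sum_le_suminf[OF sf, of "{j}"] f0 by (simp add: F_def)
  have F0: "0 \<le> F" using f0[of 0] fF[of 0] by linarith
  show thesis
  proof
    fix A :: "(int ^ 'd) set" assume A: "finite A"
    have "(\<Sum>k\<in>A - {0}. (cmod (fourier_coeff \<mu> k))\<^sup>2) \<le> (\<Sum>j. 5 ^ CARD('d) * (F * f (j + 0)))"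
    proof (rule sum_over_shells[where x = "\<lambda>k. norm (real_vec k)" and f = "\<lambda>j. 5 ^ CARD('d) * (F * f j)"])
      fix k :: "int ^ 'd" assume "k \<in> A - {0}"
      then show "2 ^ 0 \<le> norm (real_vec k)" using one_le_norm_real_vec[of k] by simp
    next
      fix j
      let ?S = "{k \<in> A - {0}. 2 ^ j \<le> norm (real_vec k) \<and> norm (real_vec k) \<le> 2 ^ (j + 1)}"
      define N :: nat where "N = 2 ^ (j + 1)"
      have "card ?S \<le> card {l :: int ^ 'd. \<forall>i. l $ i \<in> {(0 :: int ^ 'd) $ i - int N..<((0 :: int ^ 'd) $ i - int N) + int (2 * N + 1)}}"
        using ball_subset_box[of 0 N] by (intro card_mono finite_int_box) (auto simp: N_def)
      also have "\<dots> = (2 * N + 1) ^ CARD('d)" by (rule card_int_box)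
      also have "\<dots> \<le> (5 * 2 ^ j) ^ CARD('d)"
      proof (intro power_mono)
        have "(1::nat) \<le> 2 ^ j" by simp
        then show "2 * N + 1 \<le> 5 * 2 ^ j" by (simp add: N_def)
      qed auto
      finally have "real (card ?S) \<le> real ((5 * 2 ^ j) ^ CARD('d))" by (simp only: of_nat_le_iff)
      then have card_S: "real (card ?S) \<le> 5 ^ CARD('d) * 2 ^ (j * CARD('d))"
        by (simp add: power_mult_distrib power_mult)
      have "(\<Sum>k\<in>?S. (cmod (fourier_coeff \<mu> k))\<^sup>2) \<le> (\<Sum>k\<in>?S. (shell_sup \<mu> j)\<^sup>2)"
        by (intro sum_mono power_mono fourier_coeff_le_shell_sup) auto
      also have "\<dots> = real (card ?S) * (shell_sup \<mu> j)\<^sup>2" by simp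
      also have "\<dots> \<le> (5 ^ CARD('d) * 2 ^ (j * CARD('d))) * (shell_sup \<mu> j)\<^sup>2"
        using card_S by (intro mult_right_mono) auto
      also have "\<dots> \<le> (5 ^ CARD('d) * 2 ^ (2 * (j * (CARD('d) - 2)))) * (shell_sup \<mu> j)\<^sup>2"
      proof (intro mult_right_mono mult_left_mono power_increasing)
        have "CARD('d) \<le> 2 * (CARD('d) - 2)" using d by simp
        then have "j * CARD('d) \<le> j * (2 * (CARD('d) - 2))" by (rule mult_le_mono2)
        then show "j * CARD('d) \<le> 2 * (j * (CARD('d) - 2))" by (simp add: mult_ac)
      qed auto
      also have "\<dots> = 5 ^ CARD('d) * (f j)\<^sup>2"
        by (simp add: f_def power_mult_distrib power_mult mult.commute[of 2])
      also have "\<dots> \<le> 5 ^ CARD('d) * (F * f j)"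
        using fF[of j] f0[of j] by (intro mult_left_mono) (auto simp: power2_eq_square intro: mult_right_mono)
      finally show "(\<Sum>k\<in>?S. (cmod (fourier_coeff \<mu> k))\<^sup>2) \<le> 5 ^ CARD('d) * (F * f j)" .
    qed (use A F0 f0 sf in \<open>auto intro!: summable_mult\<close>)
    moreover have "(\<Sum>k\<in>A. (cmod (fourier_coeff \<mu> k))\<^sup>2) \<le> (\<Sum>k\<in>insert 0 (A - {0}). (cmod (fourier_coeff \<mu> k))\<^sup>2)"
      using A by (intro sum_mono2) auto
    moreover have "(\<Sum>k\<in>insert 0 (A - {0}). (cmod (fourier_coeff \<mu> k))\<^sup>2) = 1 + (\<Sum>k\<in>A - {0}. (cmod (fourier_coeff \<mu> k))\<^sup>2)"
      using A by (subst sum.insert) (auto simp: fourier_coeff_0[OF prob sets_\<mu>])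
    ultimately show "(\<Sum>k\<in>A. (cmod (fourier_coeff \<mu> k))\<^sup>2) \<le> 1 + (\<Sum>j. 5 ^ CARD('d) * (F * f (j + 0)))"
      by linarith
  qed
qed

lemma trace_inequality_if_decay: "trace_inequality \<mu>"
proof -
  obtain C :: real where C: "0 < C" and
    tail: "\<And>r k J. k \<in> lattice_sphere r \<Longrightarrow>
       (\<Sum>l\<in>{l \<in> lattice_sphere r. 2 ^ J \<le> norm (real_vec (l - k))}. cmod (fourier_coeff \<mu> (l - k)))
         \<le> C * (\<Sum>j. 2 ^ ((j + J) * (CARD('d) - 2)) * shell_sup \<mu> (j + J))"
    using decay_tail by blast
  define T where "T = 1 + C * (\<Sum>j. 2 ^ ((j + 0) * (CARD('d) - 2)) * shell_sup \<mu> (j + 0))"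
  show ?thesis
    unfolding trace_inequality_def
  proof (intro exI ballI)
    fix u :: "'d torus \<Rightarrow> complex" assume "u \<in> eigenfunctions"
    then obtain r c where u: "u = trig_sum (lattice_sphere r) c"
      by (auto simp: eigenfunctions_def eigenspace_def trig_sum_def[abs_def])
    let ?S = "lattice_sphere r :: (int ^ 'd) set"
    have fin: "finite ?S" by (rule finite_lattice_sphere)
    have "\<bar>\<integral>x. (cmod (u x))\<^sup>2 \<partial>\<mu>\<bar> = norm (\<Sum>k\<in>?S. \<Sum>l\<in>?S. c k * cnj (c l) * fourier_coeff \<mu> (l - k))"
      unfolding u by (simp only: integral_cmod_trig_sum[OF prob sets_\<mu>, symmetric] norm_of_real)
    also have "\<dots> \<le> T * (\<Sum>k\<in>?S. (cmod (c k))\<^sup>2)"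
    proof (rule schur_test[OF fin])
      show "norm (fourier_coeff \<mu> (l - k)) = norm (fourier_coeff \<mu> (k - l))" for k l
        using fourier_coeff_uminus[OF prob sets_\<mu>, of "k - l"] by simp
      fix k assume k: "k \<in> ?S"
      have "?S = insert k {l \<in> ?S. 2 ^ 0 \<le> norm (real_vec (l - k))}"
        using k one_le_norm_real_vec[of "_ - k"] by auto
      then have "(\<Sum>l\<in>?S. norm (fourier_coeff \<mu> (l - k))) =
        (\<Sum>l\<in>insert k {l \<in> ?S. 2 ^ 0 \<le> norm (real_vec (l - k))}. norm (fourier_coeff \<mu> (l - k)))"
        by simp
      also have "\<dots> = 1 + (\<Sum>l\<in>{l \<in> ?S. 2 ^ 0 \<le> norm (real_vec (l - k))}. norm (fourier_coeff \<mu> (l - k)))"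
        using fin by (subst sum.insert) (auto simp: fourier_coeff_0[OF prob sets_\<mu>])
      also have "\<dots> \<le> T" unfolding T_def using tail[OF k, of 0] by linarith
      finally show "(\<Sum>l\<in>?S. norm (fourier_coeff \<mu> (l - k))) \<le> T" .
    qed
    also have "(\<Sum>k\<in>?S. (cmod (c k))\<^sup>2) = (\<integral>x. (cmod (u x))\<^sup>2 \<partial>torus_lebesgue)"
      unfolding u by (rule parseval_trig_sum[OF fin, symmetric])
    finally show "(\<integral>x. (cmod (u x))\<^sup>2 \<partial>\<mu>) \<le> T * (\<integral>x. (cmod (u x))\<^sup>2 \<partial>torus_lebesgue)"
      by linarith
  qed
qed

end

section \<open>Coercivity for finitely many frequencies\<close>

text \<open>Induction on \<open>F\<close>: if \<open>v\<close> works for \<open>F\<close> but is orthogonal to the new vector \<open>w0\<close>, then \<open>M * v + w0\<close> with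
  large \<open>M\<close> works for all.\<close>

lemma ex_integer_vector_nonorthogonal:
  fixes F :: "(int ^ 'd::finite) set"
  assumes "finite F" "0 \<notin> F"
  shows "\<exists>v :: int ^ 'd. \<forall>w\<in>F. (\<Sum>i\<in>UNIV. w $ i * v $ i) \<noteq> 0"
  using assms
proof (induction F rule: finite_induct)
  case (insert w0 F)
  define dot where "dot w v = (\<Sum>i\<in>UNIV. w $ i * v $ i)" for w v :: "int ^ 'd"
  obtain v where v: "\<And>w. w \<in> F \<Longrightarrow> dot w v \<noteq> 0"
    using insert by (auto simp: dot_def)
  show ?case
  proof (cases "dot w0 v = 0")
    case False
    then show ?thesis using v by (auto simp: dot_def)
  next
    case True
    define M where "M = 1 + (\<Sum>w\<in>F. \<bar>dot w w0\<bar>)"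
    have M: "1 \<le> M" by (simp add: M_def sum_nonneg)
    define v' where "v' = (\<chi> i. M * v $ i + w0 $ i)"
    have dot_v': "dot w v' = M * dot w v + dot w w0" for w
      by (simp add: dot_def v'_def distrib_left sum.distrib sum_distrib_left mult.left_commute)
    have "dot w v' \<noteq> 0" if w: "w \<in> F" for w
    proof
      assume "dot w v' = 0"
      then have eq: "dot w w0 = - (M * dot w v)" unfolding dot_v' by linarith
      have "1 \<le> \<bar>dot w v\<bar>" using v[OF w] by linarith
      then have "M * 1 \<le> M * \<bar>dot w v\<bar>" using M by (intro mult_left_mono) auto
      also have "\<dots> = \<bar>dot w w0\<bar>" using M by (simp add: eq abs_mult)
      also have "\<dots> \<le> (\<Sum>w\<in>F. \<bar>dot w w0\<bar>)"
        using w insert.hyps(1) by (intro member_le_sum[where f = "\<lambda>w. \<bar>dot w w0\<bar>"]) auto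
      finally show False by (simp add: M_def)
    qed
    moreover have "dot w0 v' \<noteq> 0"
    proof
      assume "dot w0 v' = 0"
      then have "(\<Sum>i\<in>UNIV. w0 $ i * w0 $ i) = 0" by (simp add: dot_v' True) (simp add: dot_def)
      then have "w0 = 0" by (subst (asm) sum_nonneg_eq_0_iff) (auto simp: vec_eq_iff)
      then show False using insert.prems by simp
    qed
    ultimately show ?thesis by (intro exI[of _ v']) (auto simp: dot_def)
  qed
qed auto

text \<open>Up to a nonvanishing factor the sum is a polynomial in \<open>cis (2 * pi * t)\<close>, whose monomials are distinct
  because \<open>\<omega>\<close> is injective.\<close>

lemma finite_zeros_exponential_sum:
  fixes a :: "'a \<Rightarrow> complex" and \<omega> :: "'a \<Rightarrow> int"
  assumes A: "finite A" "inj_on \<omega> A" and a: "k0 \<in> A" "a k0 \<noteq> 0"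
  shows "finite {t \<in> {0..<1}. (\<Sum>k\<in>A. a k * cis (2 * pi * (t * of_int (\<omega> k)))) = 0}"
proof -
  define K where "K = (\<Sum>k\<in>A. \<bar>\<omega> k\<bar>)"
  define n where "n k = nat (\<omega> k + K)" for k
  have K: "\<bar>\<omega> k\<bar> \<le> K" if "k \<in> A" for k
    unfolding K_def using A that by (intro member_le_sum[where f = "\<lambda>k. \<bar>\<omega> k\<bar>"]) auto
  have n: "int (n k) = \<omega> k + K" if "k \<in> A" for k
    using K[OF that] by (simp add: n_def)
  define p where "p = (\<Sum>k\<in>A. monom (a k) (n k))"
  have "coeff p (n k0) = (\<Sum>k\<in>A. if k = k0 then a k else 0)"
    unfolding p_def coeff_sum coeff_monom
  proof (intro sum.cong refl if_cong)
    fix k assume "k \<in> A"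
    show "(n k = n k0) = (k = k0)"
    proof
      assume "n k = n k0"
      then have "\<omega> k = \<omega> k0" using n[OF \<open>k \<in> A\<close>] n[OF a(1)] by simp
      then show "k = k0" using A(2) \<open>k \<in> A\<close> a(1) by (auto dest: inj_onD)
    qed simp
  qed
  also have "\<dots> = a k0" using A a by simp
  finally have "p \<noteq> 0" using a by auto
  then have fin: "finite {z. poly p z = 0}" by (rule poly_roots_finite)
  define e where "e t = cis (2 * pi * t)" for t
  have inj: "inj_on e {0..<1}"
  proof (rule inj_onI)
    fix s t :: real assume st: "s \<in> {0..<1}" "t \<in> {0..<1}" "e s = e t"
    then have "sin (2 * pi * s) = sin (2 * pi * t) \<and> cos (2 * pi * s) = cos (2 * pi * t)"
      by (simp add: e_def cis.ctr)
    then obtain m :: int where "2 * pi * s = 2 * pi * t + 2 * pi * m"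
      unfolding sin_cos_eq_iff by blast
    then have "2 * pi * (s - t - m) = 0" by (simp add: algebra_simps)
    then have "s - t = m" by simp
    moreover have "\<bar>s - t\<bar> < 1" using st by auto
    ultimately have "m = 0" by linarith
    then show "s = t" using \<open>s - t = m\<close> by simp
  qed
  have eq: "(\<Sum>k\<in>A. a k * cis (2 * pi * (t * of_int (\<omega> k)))) = cis (- (2 * pi * (t * of_int K))) * poly p (e t)" for t
  proof -
    have "cis (- (2 * pi * (t * of_int K))) * poly p (e t) =
        (\<Sum>k\<in>A. a k * (cis (- (2 * pi * (t * of_int K))) * e t ^ n k))"
      unfolding p_def poly_sum poly_monom sum_distrib_left by (intro sum.cong refl) (simp add: mult_ac)
    also have "\<dots> = (\<Sum>k\<in>A. a k * cis (2 * pi * (t * of_int (\<omega> k))))"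
    proof (intro sum.cong refl)
      fix k assume k: "k \<in> A"
      have "real (n k) = of_int (\<omega> k + K)" using n[OF k] by (metis of_int_of_nat_eq)
      then show "a k * (cis (- (2 * pi * (t * of_int K))) * e t ^ n k) = a k * cis (2 * pi * (t * of_int (\<omega> k)))"
        by (simp add: e_def Complex.DeMoivre cis_mult algebra_simps)
    qed
    finally show ?thesis by simp
  qed
  have "{t \<in> {0..<1}. (\<Sum>k\<in>A. a k * cis (2 * pi * (t * of_int (\<omega> k)))) = 0} =
      e -` {z. poly p z = 0} \<inter> {0..<1}"
    by (auto simp: eq)
  also have "finite \<dots>" by (rule finite_vimage_IntI[OF fin inj])
  finally show ?thesis .
qed

text \<open>Fubini: averaged over \<open>t \<in> [0, 1)\<close>, the measure of \<open>Z - t * v\<close> is the integral over \<open>x\<close> of the measure of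
  \<open>{t. x + t * v \<in> Z}\<close>. The former is the measure of \<open>Z\<close> by translation invariance, the latter vanishes.\<close>

lemma null_set_if_finite_on_parallel_lines:
  fixes Z :: "'a::euclidean_space set"
  assumes Z[measurable]: "Z \<in> sets borel"
    and line: "\<And>x. finite {t \<in> {0..<1::real}. x + t *\<^sub>R v \<in> Z}"
  shows "emeasure lborel Z = 0"
proof -
  define f where "f t x = (indicator {0..<1} t * indicator Z (x + t *\<^sub>R v) :: ennreal)" for t :: real and x
  have [measurable]: "case_prod f \<in> borel_measurable (lborel \<Otimes>\<^sub>M lborel)"
    unfolding f_def by measurable
  have inner: "(\<integral>\<^sup>+x. f t x \<partial>lborel) = indicator {0..<1} t * emeasure lborel Z" for t
  proof -
    have "(\<integral>\<^sup>+x. indicator Z (x + t *\<^sub>R v) \<partial>lborel) = (\<integral>\<^sup>+x. indicator Z x \<partial>distr lborel borel ((+) (t *\<^sub>R v)))"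
      by (subst nn_integral_distr) (auto simp: add.commute)
    also have "\<dots> = emeasure lborel Z"
      using lborel_distr_plus[of "t *\<^sub>R v"] by simp
    finally show ?thesis unfolding f_def by (subst nn_integral_cmult) auto
  qed
  have "(\<integral>\<^sup>+t. f t x \<partial>lborel) = 0" for x
  proof -
    have "(\<integral>\<^sup>+t. f t x \<partial>lborel) = (\<integral>\<^sup>+t. indicator {t \<in> {0..<1::real}. x + t *\<^sub>R v \<in> Z} t \<partial>lborel)"
      unfolding f_def by (intro nn_integral_cong) (auto simp: indicator_def)
    also have "\<dots> = emeasure lborel {t \<in> {0..<1::real}. x + t *\<^sub>R v \<in> Z}"
      using line[of x] by (intro nn_integral_indicator) (auto intro!: finite_imp_closed borel_closed simp del: sets_lborel)
    also have "\<dots> = 0"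
      using line[of x] by (intro emeasure_lborel_countable countable_finite)
    finally show ?thesis .
  qed
  then have "0 = (\<integral>\<^sup>+x. \<integral>\<^sup>+t. f t x \<partial>lborel \<partial>lborel)" by simp
  also have "\<dots> = (\<integral>\<^sup>+t. \<integral>\<^sup>+x. f t x \<partial>lborel \<partial>lborel)"
    by (rule lborel_pair.Fubini') simp
  also have "\<dots> = emeasure lborel Z"
    by (simp add: inner nn_integral_multc)
  finally show ?thesis by simp
qed

text \<open>Choose an integer direction \<open>v\<close> in which the frequencies in \<open>A\<close> remain distinct. On each line in direction
  \<open>v\<close> the polynomial is an exponential sum in one variable with the same moduli of coefficients, so it has
  finitely many zeros per period.\<close>

lemma AE_trig_sum_nonzero:
  fixes A :: "(int ^ 'd::finite) set"
  assumes A: "finite A" and k0: "k0 \<in> A" "c k0 \<noteq> 0"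
  shows "AE x in torus_lebesgue. trig_sum A c x \<noteq> 0"
proof -
  \<comment> \<open>The direction must not be orthogonal to any difference of two frequencies.\<close>
  obtain v :: "int ^ 'd" where v: "\<And>w. w \<in> (\<lambda>(k, l). k - l) ` (A \<times> A) - {0} \<Longrightarrow> (\<Sum>i\<in>UNIV. w $ i * v $ i) \<noteq> 0"
    using ex_integer_vector_nonorthogonal[of "(\<lambda>(k, l). k - l) ` (A \<times> A) - {0}"] A by auto
  define \<omega> where "\<omega> k = (\<Sum>i\<in>UNIV. k $ i * v $ i)" for k
  have inj: "inj_on \<omega> A"
  proof (rule inj_onI, rule ccontr)
    fix k l assume kl: "k \<in> A" "l \<in> A" "\<omega> k = \<omega> l" "k \<noteq> l"
    have "\<omega> (k - l) = 0"
      using kl by (simp add: \<omega>_def left_diff_distrib sum_subtractf)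
    moreover have "\<omega> (k - l) \<noteq> 0"
      unfolding \<omega>_def using kl by (intro v) auto
    ultimately show False by simp
  qed
  have dot: "real_vec k \<bullet> real_vec v = of_int (\<omega> k)" for k
    by (simp add: \<omega>_def inner_vec_def real_vec_def)
  define Z where "Z = {x. trig_sum A c (abs_torus x) = 0}"
  have Z[measurable]: "Z \<in> sets borel"
    unfolding Z_def by measurable
  have "emeasure lborel Z = 0"
  proof (rule null_set_if_finite_on_parallel_lines[OF Z])
    fix x :: "real ^ 'd"
    have "trig_sum A c (abs_torus (x + t *\<^sub>R real_vec v)) =
        (\<Sum>k\<in>A. (c k * character k (abs_torus x)) * cis (2 * pi * (t * of_int (\<omega> k))))" for t
      by (simp add: trig_sum_def character_abs_torus inner_add_right distrib_left dot cis_mult[symmetric] mult.assoc)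
    moreover have "finite {t \<in> {0..<1}. (\<Sum>k\<in>A. (c k * character k (abs_torus x)) * cis (2 * pi * (t * of_int (\<omega> k)))) = 0}"
      using A inj k0 norm_character[of k0 "abs_torus x"]
      by (intro finite_zeros_exponential_sum[of A \<omega> k0]) (auto simp del: norm_character)
    ultimately show "finite {t \<in> {0..<1::real}. x + t *\<^sub>R real_vec v \<in> Z}"
      by (simp add: Z_def)
  qed
  then have "AE x in lborel. trig_sum A c (abs_torus x) \<noteq> 0"
    using Z by (subst AE_iff_measurable[of Z]) (auto simp: Z_def)
  then show ?thesis
    unfolding torus_lebesgue_def
    by (subst AE_distr_iff) (auto intro!: measurable_restrict_space1 simp: AE_restrict_space_iff)
qed

definition trig_polynomial :: "('d::finite torus \<Rightarrow> complex) \<Rightarrow> bool" where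
  "trig_polynomial f \<longleftrightarrow> (\<exists>A c. finite A \<and> f = trig_sum A c)"

lemma trig_polynomial_trig_sum: "finite A \<Longrightarrow> trig_polynomial (trig_sum A c)"
  by (auto simp: trig_polynomial_def)

lemma trig_polynomial_const: "trig_polynomial (\<lambda>x. a)"
  unfolding trig_polynomial_def
  by (intro exI[of _ "{0}"] exI[of _ "\<lambda>_. a"]) (auto simp: trig_sum_def)

lemma trig_polynomial_add:
  assumes "trig_polynomial f" "trig_polynomial g"
  shows "trig_polynomial (\<lambda>x. f x + g x)"
proof -
  obtain A c B e where fg: "finite A" "f = trig_sum A c" "finite B" "g = trig_sum B e"
    using assms by (auto simp: trig_polynomial_def)
  have "f x = (\<Sum>k\<in>A \<union> B. (if k \<in> A then c k else 0) * character k x)"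
    "g x = (\<Sum>k\<in>A \<union> B. (if k \<in> B then e k else 0) * character k x)" for x
    using fg by (auto simp: trig_sum_def intro!: sum.mono_neutral_cong_left)
  then have "(\<lambda>x. f x + g x) = trig_sum (A \<union> B) (\<lambda>k. (if k \<in> A then c k else 0) + (if k \<in> B then e k else 0))"
    by (simp add: trig_sum_def fun_eq_iff distrib_right sum.distrib)
  then show ?thesis using fg by (auto intro: trig_polynomial_trig_sum)
qed

lemma trig_polynomial_sum:
  "(\<And>i. i \<in> I \<Longrightarrow> trig_polynomial (f i)) \<Longrightarrow> trig_polynomial (\<lambda>x. \<Sum>i\<in>I. f i x)"
  by (induction I rule: infinite_finite_induct)
    (auto intro: trig_polynomial_const trig_polynomial_add)

lemma trig_polynomial_mult:
  assumes "trig_polynomial f" "trig_polynomial g"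
  shows "trig_polynomial (\<lambda>x. f x * g x)"
proof -
  obtain A c B e where fg: "finite A" "f = trig_sum A c" "finite B" "g = trig_sum B e"
    using assms by (auto simp: trig_polynomial_def)
  have shift: "c k * character k x * trig_sum B e x = trig_sum ((+) k ` B) (\<lambda>l. c k * e (l - k)) x" for k x
    by (simp add: trig_sum_def sum.reindex sum_distrib_left character_add mult_ac)
  have "(\<lambda>x. f x * g x) = (\<lambda>x. \<Sum>k\<in>A. trig_sum ((+) k ` B) (\<lambda>l. c k * e (l - k)) x)"
    unfolding fg(2,4) shift[symmetric] by (simp add: trig_sum_def[of A] sum_distrib_right)
  then show ?thesis using fg by (auto intro!: trig_polynomial_sum trig_polynomial_trig_sum)
qed

lemma trig_polynomial_power: "trig_polynomial f \<Longrightarrow> trig_polynomial (\<lambda>x. f x ^ n)"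
  by (induction n) (auto intro: trig_polynomial_const trig_polynomial_mult)

lemma trig_polynomial_cmod_square:
  "finite A \<Longrightarrow> trig_polynomial (\<lambda>x. complex_of_real ((cmod (trig_sum A c x))\<^sup>2))"
proof -
  assume A: "finite A"
  have "character k = trig_sum {k} (\<lambda>_. 1)" for k :: "int ^ 'a"
    by (simp add: trig_sum_def fun_eq_iff)
  then have "trig_polynomial (character k)" for k :: "int ^ 'a"
    by (metis finite.emptyI finite_insert trig_polynomial_trig_sum)
  then show ?thesis
    unfolding cmod_trig_sum_square
    by (intro trig_polynomial_sum trig_polynomial_mult trig_polynomial_const)
qed

text \<open>Cauchy-Schwarz in frequency space: a measure with square summable Fourier coefficients is bounded by the \<open>L\<^sup>2\<close>
  norm on trigonometric polynomials. This replaces the existence of an \<open>L\<^sup>2\<close> density.\<close>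

lemma integral_trig_polynomial_le:
  fixes \<mu> :: "'d::finite torus measure"
  assumes \<mu>: "prob_space \<mu>" "sets \<mu> = sets borel"
    and B: "\<And>A. finite A \<Longrightarrow> (\<Sum>k\<in>A. (cmod (fourier_coeff \<mu> k))\<^sup>2) \<le> B"
    and f: "trig_polynomial f"
  shows "(cmod (\<integral>x. f x \<partial>\<mu>))\<^sup>2 \<le> B * (\<integral>x. (cmod (f x))\<^sup>2 \<partial>torus_lebesgue)"
proof -
  obtain A c where A: "finite A" "f = trig_sum A c" using f by (auto simp: trig_polynomial_def)
  have "cmod (\<integral>x. f x \<partial>\<mu>) \<le> (\<Sum>k\<in>A. cmod (c k) * cmod (fourier_coeff \<mu> (- k)))"
    unfolding A(2) integral_trig_sum[OF \<mu>] by (rule order_trans[OF norm_sum]) (simp add: norm_mult)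
  then have "(cmod (\<integral>x. f x \<partial>\<mu>))\<^sup>2 \<le> (\<Sum>k\<in>A. cmod (c k) * cmod (fourier_coeff \<mu> (- k)))\<^sup>2"
    by (intro power_mono) auto
  also have "\<dots> \<le> (\<Sum>k\<in>A. (cmod (c k))\<^sup>2) * (\<Sum>k\<in>A. (cmod (fourier_coeff \<mu> (- k)))\<^sup>2)"
    by (rule Cauchy_Schwarz_ineq_sum)
  also have "\<dots> \<le> (\<Sum>k\<in>A. (cmod (c k))\<^sup>2) * B"
    using B[OF A(1)] by (intro mult_left_mono sum_nonneg) (auto simp: fourier_coeff_uminus[OF \<mu>])
  finally show ?thesis unfolding A(2) parseval_trig_sum[OF A(1)] by (simp add: mult.commute)
qed

text \<open>Suppose \<open>u = trig_sum A c\<close> vanishes \<open>\<mu>\<close>-almost everywhere. The functions \<open>\<phi> n = (1 - \<bar>u\<bar>\<^sup>2 / M) ^ n\<close> are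
  trigonometric polynomials with \<open>\<mu>\<close>-integral 1 for all \<open>n\<close>. But they tend to \<open>0\<close> off the zero set of \<open>u\<close>, which is a Lebesgue null set,
  so their \<open>L\<^sup>2\<close> norms tend to \<open>0\<close>, contradicting the \<open>L\<^sup>2\<close> bound.\<close>

lemma integral_cmod_trig_sum_pos:
  fixes \<mu> :: "'d::finite torus measure"
  assumes \<mu>: "prob_space \<mu>" "sets \<mu> = sets borel"
    and B: "\<And>A. finite A \<Longrightarrow> (\<Sum>k\<in>A. (cmod (fourier_coeff \<mu> k))\<^sup>2) \<le> B"
    and A: "finite A" and k0: "k0 \<in> A" "c k0 \<noteq> 0"
  shows "0 < (\<integral>x. (cmod (trig_sum A c x))\<^sup>2 \<partial>\<mu>)"
proof (rule ccontr)
  interpret prob_space \<mu> by (rule \<mu>(1))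
  interpret L: prob_space "torus_lebesgue :: 'd torus measure" by (rule prob_space_torus_lebesgue)
  have [measurable_cong]: "sets \<mu> = sets borel" by (rule \<mu>(2))
  define u where "u = trig_sum A c"
  have [measurable]: "u \<in> borel_measurable borel" unfolding u_def by measurable
  define S where "S = (\<Sum>k\<in>A. norm (c k))"
  have uS: "cmod (u x) \<le> S" for x unfolding u_def S_def by (rule norm_trig_sum_le)
  have S0: "0 \<le> S" unfolding S_def by (intro sum_nonneg) auto
  \<comment> \<open>Any constant that exceeds \<open>\<bar>u\<bar>\<^sup>2\<close> everywhere.\<close>
  define M where "M = S\<^sup>2 + 1"
  have M: "0 < M" by (simp add: M_def add_nonneg_pos)
  have uM: "(cmod (u x))\<^sup>2 < M" for x
  proof -
    have "(cmod (u x))\<^sup>2 \<le> S\<^sup>2" using uS by (intro power_mono) auto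
    then show ?thesis by (simp add: M_def)
  qed
  assume "\<not> 0 < (\<integral>x. (cmod (trig_sum A c x))\<^sup>2 \<partial>\<mu>)"
  then have "(\<integral>x. (cmod (u x))\<^sup>2 \<partial>\<mu>) = 0"
    by (simp add: u_def not_less antisym)
  moreover have "integrable \<mu> (\<lambda>x. (cmod (u x))\<^sup>2)"
    using uM by (intro integrable_const_bound[of _ M]) (auto simp: less_imp_le)
  ultimately have AE0: "AE x in \<mu>. u x = 0"
    by (subst (asm) integral_nonneg_eq_0_iff_AE) auto
  define \<phi> where "\<phi> n x = (1 - (cmod (u x))\<^sup>2 / M) ^ n" for n x
  have \<phi>01: "0 \<le> 1 - (cmod (u x))\<^sup>2 / M" "1 - (cmod (u x))\<^sup>2 / M \<le> 1" for x
    using uM[of x] M by (auto simp: field_simps)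
  have trig: "trig_polynomial (\<lambda>x. complex_of_real (\<phi> n x))" for n
  proof -
    have eq: "complex_of_real (\<phi> n x) = (1 + of_real (- 1 / M) * complex_of_real ((cmod (trig_sum A c x))\<^sup>2)) ^ n" for x
      by (simp add: \<phi>_def u_def)
    show ?thesis unfolding eq
      by (intro trig_polynomial_power trig_polynomial_add trig_polynomial_mult trig_polynomial_const
          trig_polynomial_cmod_square A)
  qed
  have lower: "1 \<le> B * (\<integral>x. (\<phi> n x)\<^sup>2 \<partial>torus_lebesgue)" for n
  proof -
    have "(\<integral>x. complex_of_real (\<phi> n x) \<partial>\<mu>) = (\<integral>x. 1 \<partial>\<mu>)"
      using AE0 by (intro integral_cong_AE) (auto simp: \<phi>_def elim!: eventually_mono)
    then have "(\<integral>x. complex_of_real (\<phi> n x) \<partial>\<mu>) = 1" by (simp add: prob_space)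
    then show ?thesis using integral_trig_polynomial_le[OF \<mu> B trig[of n]] by simp
  qed
  have "(\<lambda>n. \<integral>x. (\<phi> n x)\<^sup>2 \<partial>torus_lebesgue) \<longlonglongrightarrow> (\<integral>x. 0 \<partial>(torus_lebesgue :: 'd torus measure))"
  proof (rule integral_dominated_convergence[where w = "\<lambda>_. 1"])
    show "AE x in torus_lebesgue. (\<lambda>n. (\<phi> n x)\<^sup>2) \<longlonglongrightarrow> 0"
      using AE_trig_sum_nonzero[OF A k0(1), of c, OF k0(2)]
    proof eventually_elim
      case (elim x)
      then have "0 < (cmod (u x))\<^sup>2 / M" using M by (simp add: u_def)
      then have "(\<lambda>n. \<phi> n x) \<longlonglongrightarrow> 0"
        unfolding \<phi>_def using \<phi>01[of x] by (intro LIMSEQ_realpow_zero) auto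
      then show ?case using tendsto_power[of "\<lambda>n. \<phi> n x" 0 sequentially 2] by simp
    qed
    show "AE x in torus_lebesgue. norm ((\<phi> n x)\<^sup>2) \<le> 1" for n
      using \<phi>01 by (intro always_eventually allI) (auto simp: \<phi>_def intro!: power_le_one)
    show "(\<lambda>x. (\<phi> n x)\<^sup>2) \<in> borel_measurable torus_lebesgue" for n
      unfolding \<phi>_def by measurable
  qed auto
  then have "(\<lambda>n. B * (\<integral>x. (\<phi> n x)\<^sup>2 \<partial>torus_lebesgue)) \<longlonglongrightarrow> B * 0"
    by (intro tendsto_mult tendsto_const) simp
  then have "1 \<le> B * 0" by (rule LIMSEQ_le_const) (use lower in auto)
  then show False by simp
qed

text \<open>The coefficient families are functions on the whole lattice, so the compactness of a finite-dimensional ball is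
  obtained from Tychonoff's theorem.\<close>

lemma compact_finite_support_ball:
  "compact {c :: 'a \<Rightarrow> complex. (\<forall>k\<in>A. cmod (c k) \<le> 1) \<and> (\<forall>k. k \<notin> A \<longrightarrow> c k = 0)}"
proof -
  have "{c :: 'a \<Rightarrow> complex. (\<forall>k\<in>A. cmod (c k) \<le> 1) \<and> (\<forall>k. k \<notin> A \<longrightarrow> c k = 0)} =
      PiE UNIV (\<lambda>k. if k \<in> A then cball 0 1 else {0})"
    by (auto simp: PiE_def Pi_def split: if_splits)
  moreover have "compactin (product_topology (\<lambda>_. euclidean) UNIV) (PiE UNIV (\<lambda>k :: 'a. if k \<in> A then cball 0 1 else {0 :: complex}))"
    unfolding compactin_PiE by auto
  ultimately show ?thesis by (simp add: euclidean_product_topology)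
qed

lemma coercive_finite_set:
  fixes \<mu> :: "'d::finite torus measure"
  assumes \<mu>: "prob_space \<mu>" "sets \<mu> = sets borel"
    and B: "\<And>A. finite A \<Longrightarrow> (\<Sum>k\<in>A. (cmod (fourier_coeff \<mu> k))\<^sup>2) \<le> B"
    and A: "finite A"
  obtains \<delta> :: real where "0 < \<delta>" "\<And>c. \<delta> * (\<Sum>k\<in>A. (cmod (c k))\<^sup>2) \<le> (\<integral>x. (cmod (trig_sum A c x))\<^sup>2 \<partial>\<mu>)"
proof -
  define Q where "Q c = (\<integral>x. (cmod (trig_sum A c x))\<^sup>2 \<partial>\<mu>)" for c
  define K where "K = {c :: int ^ 'd \<Rightarrow> complex. (\<forall>k\<in>A. cmod (c k) \<le> 1) \<and> (\<forall>k. k \<notin> A \<longrightarrow> c k = 0)}"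
  \<comment> \<open>The unit sphere of the coefficients on \<open>A\<close>; it is empty if \<open>A\<close> is.\<close>
  define X where "X = K \<inter> {c. (\<Sum>k\<in>A. (cmod (c k))\<^sup>2) = 1}"
  have coord: "continuous_on UNIV (\<lambda>c :: int ^ 'd \<Rightarrow> complex. c k)" for k
    by (rule continuous_on_product_coordinates)
  have "closed {c :: int ^ 'd \<Rightarrow> complex. (\<Sum>k\<in>A. (cmod (c k))\<^sup>2) = 1}"
    by (intro closed_Collect_eq continuous_intros coord)
  then have X: "compact X"
    unfolding X_def K_def by (intro compact_Int_closed compact_finite_support_ball)
  have Q_eq: "Q c = Re (\<Sum>k\<in>A. \<Sum>l\<in>A. c k * cnj (c l) * fourier_coeff \<mu> (l - k))" for c
    unfolding Q_def by (simp only: integral_cmod_trig_sum[OF \<mu>, symmetric] Re_complex_of_real)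
  have contQ: "continuous_on X Q"
    unfolding Q_eq[abs_def]
    by (rule continuous_on_subset[of UNIV]) (auto intro!: continuous_intros coord)
  have scale: "Q (\<lambda>k. if k \<in> A then of_real t * c k else 0) = t\<^sup>2 * Q c" for t c
  proof -
    have "trig_sum A (\<lambda>k. if k \<in> A then of_real t * c k else 0) x = of_real t * trig_sum A c x" for x
      by (simp add: trig_sum_def sum_distrib_left mult.assoc)
    then show ?thesis by (simp add: Q_def norm_mult power_mult_distrib)
  qed
  show thesis
  proof (cases "X = {}")
    case False
    then obtain c0 where c0: "c0 \<in> X" "\<And>c. c \<in> X \<Longrightarrow> Q c0 \<le> Q c"
      using continuous_attains_inf[OF X False contQ] by auto
    show thesis
    proof (rule that)
      have "\<exists>k0\<in>A. c0 k0 \<noteq> 0"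
      proof (rule ccontr)
        assume "\<not> (\<exists>k0\<in>A. c0 k0 \<noteq> 0)"
        then have "(\<Sum>k\<in>A. (cmod (c0 k))\<^sup>2) = 0" by simp
        then show False using c0(1) by (simp add: X_def)
      qed
      then show "0 < Q c0"
        unfolding Q_def using integral_cmod_trig_sum_pos[OF \<mu> B A] by blast
      fix c :: "int ^ 'd \<Rightarrow> complex"
      define s where "s = (\<Sum>k\<in>A. (cmod (c k))\<^sup>2)"
      show "Q c0 * (\<Sum>k\<in>A. (cmod (c k))\<^sup>2) \<le> (\<integral>x. (cmod (trig_sum A c x))\<^sup>2 \<partial>\<mu>)"
      proof (cases "s = 0")
        case False
        moreover have "0 \<le> s" unfolding s_def by (intro sum_nonneg) auto
        ultimately have s: "0 < s" by simp
        define c' where "c' = (\<lambda>k. if k \<in> A then of_real (1 / sqrt s) * c k else 0)"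
        have "c' \<in> X"
        proof -
          have le: "(cmod (c k))\<^sup>2 \<le> s" if "k \<in> A" for k
            unfolding s_def using A that by (intro member_le_sum[where f = "\<lambda>k. (cmod (c k))\<^sup>2"]) auto
          have sq: "(cmod (c' k))\<^sup>2 = (cmod (c k))\<^sup>2 / s" if "k \<in> A" for k
            using that s by (simp add: c'_def norm_mult norm_divide power_mult_distrib power_divide)
          have "cmod (c' k) \<le> 1" if "k \<in> A" for k
          proof -
            have "(cmod (c' k))\<^sup>2 \<le> 1\<^sup>2" using sq[OF that] le[OF that] s by simp
            then show ?thesis by (rule power2_le_imp_le) simp
          qed
          moreover have "(\<Sum>k\<in>A. (cmod (c' k))\<^sup>2) = 1"
            using s by (simp add: sq sum_divide_distrib[symmetric]) (simp add: s_def)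
          ultimately show ?thesis by (auto simp: X_def K_def c'_def)
        qed
        then have "Q c0 \<le> Q c'" by (rule c0(2))
        also have "Q c' = Q c / s" using s by (simp add: c'_def scale power_divide)
        finally show ?thesis using s by (simp add: field_simps flip: s_def Q_def)
      qed (simp add: s_def[symmetric])
    qed
  next
    case True
    show thesis
    proof (rule that[of 1])
      fix c :: "int ^ 'd \<Rightarrow> complex"
      have "A = {}"
      proof (rule ccontr)
        assume "A \<noteq> {}"
        then obtain k0 where k0: "k0 \<in> A" by auto
        have "(\<lambda>k. if k = k0 then 1 else 0) \<in> X"
          using k0 A by (auto simp: X_def K_def if_distrib if_distribR cong: if_cong)
        with True show False by simp
      qed
      then show "1 * (\<Sum>k\<in>A. (cmod (c k))\<^sup>2) \<le> (\<integral>x. (cmod (trig_sum A c x))\<^sup>2 \<partial>\<mu>)" by simp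
    qed simp
  qed
qed

text \<open>Multiplying by a character translates the frequency set into a fixed finite ball without changing \<open>\<bar>u\<bar>\<close>.\<close>

lemma coercive_bounded_diameter:
  fixes \<mu> :: "'d::finite torus measure"
  assumes \<mu>: "prob_space \<mu>" "sets \<mu> = sets borel"
    and B: "\<And>A. finite A \<Longrightarrow> (\<Sum>k\<in>A. (cmod (fourier_coeff \<mu> k))\<^sup>2) \<le> B"
  obtains \<delta> :: real where "0 < \<delta>"
    "\<And>A c. (\<And>k l. k \<in> A \<Longrightarrow> l \<in> A \<Longrightarrow> norm (real_vec (l - k)) \<le> R) \<Longrightarrow>
      \<delta> * (\<Sum>k\<in>A. (cmod (c k))\<^sup>2) \<le> (\<integral>x. (cmod (trig_sum A c x))\<^sup>2 \<partial>\<mu>)"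
proof -
  define D where "D = {l :: int ^ 'd. norm (real_vec l) \<le> R}"
  have D: "finite D" using finite_lattice_ball[of 0 R] by (simp add: D_def)
  obtain \<delta> :: real where \<delta>: "0 < \<delta>"
    and le: "\<And>c. \<delta> * (\<Sum>k\<in>D. (cmod (c k))\<^sup>2) \<le> (\<integral>x. (cmod (trig_sum D c x))\<^sup>2 \<partial>\<mu>)"
    using coercive_finite_set[OF \<mu> B D] by blast
  show thesis
  proof (rule that[OF \<delta>])
    fix A :: "(int ^ 'd) set" and c
    assume diam: "\<And>k l. k \<in> A \<Longrightarrow> l \<in> A \<Longrightarrow> norm (real_vec (l - k)) \<le> R"
    show "\<delta> * (\<Sum>k\<in>A. (cmod (c k))\<^sup>2) \<le> (\<integral>x. (cmod (trig_sum A c x))\<^sup>2 \<partial>\<mu>)"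
    proof (cases "A = {}")
      case False
      then obtain k0 where k0: "k0 \<in> A" by auto
      define A' where "A' = (\<lambda>l. l - k0) ` A"
      define c' where "c' l = (if l \<in> A' then c (l + k0) else 0)" for l
      have A': "A' \<subseteq> D" using diam[OF k0] by (auto simp: A'_def D_def)
      have inj: "inj_on (\<lambda>l. l - k0) A" by (simp add: inj_on_def)
      have "(\<Sum>k\<in>D. (cmod (c' k))\<^sup>2) = (\<Sum>k\<in>A'. (cmod (c (k + k0)))\<^sup>2)"
        using A' D by (intro sum.mono_neutral_cong_right) (auto simp: c'_def)
      also have "\<dots> = (\<Sum>k\<in>A. (cmod (c k))\<^sup>2)"
        unfolding A'_def by (subst sum.reindex[OF inj]) simp
      finally have sq: "(\<Sum>k\<in>D. (cmod (c' k))\<^sup>2) = (\<Sum>k\<in>A. (cmod (c k))\<^sup>2)" .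
      have "cmod (trig_sum D c' x) = cmod (trig_sum A c x)" for x
      proof -
        have "trig_sum D c' x = (\<Sum>k\<in>A'. c (k + k0) * character k x)"
          unfolding trig_sum_def using A' D by (intro sum.mono_neutral_cong_right) (auto simp: c'_def)
        also have "\<dots> = (\<Sum>k\<in>A. c k * character (k - k0) x)"
          unfolding A'_def by (subst sum.reindex[OF inj]) simp
        also have "\<dots> = character (- k0) x * trig_sum A c x"
          unfolding trig_sum_def sum_distrib_left
          by (intro sum.cong refl) (metis (no_types, lifting) add_uminus_conv_diff character_add mult.assoc mult.commute)
        finally show ?thesis by (simp add: norm_mult)
      qed
      then show ?thesis using le[of c'] by (simp add: sq)
    qed simp
  qed
qed

section \<open>Clusters of lattice points on spheres\<close>

text \<open>The coordinates with respect to the basis \<open>T\<close> of \<open>span T\<close> are linear, hence bounded by multiples of the norm.\<close>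

lemma inner_bounded_on_span:
  fixes T :: "'a::euclidean_space set"
  assumes T: "independent T"
  shows "\<exists>K\<ge>0. \<forall>x v \<rho>. v \<in> span T \<longrightarrow> (\<forall>t\<in>T. \<bar>x \<bullet> t\<bar> \<le> \<rho>) \<longrightarrow> \<bar>x \<bullet> v\<bar> \<le> K * \<rho> * norm v"
proof -
  have fin: "finite T" using T by (rule independent_imp_finite)
  have "\<exists>g :: 'a \<Rightarrow> real. linear g \<and> (\<forall>t\<in>T. g t = (if t = s then 1 else 0))" for s
    by (rule linear_independent_extend[OF T])
  then obtain g :: "'a \<Rightarrow> 'a \<Rightarrow> real" where
    g: "\<And>s. linear (g s)" "\<And>s t. t \<in> T \<Longrightarrow> g s t = (if t = s then 1 else 0)"
    by metis
  have "\<exists>b. \<forall>v. norm (g s v) \<le> b * norm v" for s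
    by (rule linear_bounded[OF g(1)])
  then obtain b where b: "\<And>s v. norm (g s v) \<le> b s * norm v"
    by metis
  show ?thesis
  proof (intro exI[of _ "\<Sum>t\<in>T. \<bar>b t\<bar>"] conjI allI impI)
    show "0 \<le> (\<Sum>t\<in>T. \<bar>b t\<bar>)" by (intro sum_nonneg) auto
    fix x v :: 'a and \<rho> :: real
    assume v: "v \<in> span T" and x: "\<forall>t\<in>T. \<bar>x \<bullet> t\<bar> \<le> \<rho>"
    obtain u where u: "v = (\<Sum>t\<in>T. u t *\<^sub>R t)" using v by (auto simp: span_finite[OF fin])
    have coord: "\<bar>u s\<bar> \<le> \<bar>b s\<bar> * norm v" if "s \<in> T" for s
    proof -
      have "g s v = (\<Sum>t\<in>T. u t * g s t)"
        unfolding u by (simp add: linear_sum[OF g(1)] linear_scale[OF g(1)])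
      also have "\<dots> = u s" using that fin by (simp add: g(2) if_distrib cong: if_cong)
      finally have "\<bar>u s\<bar> \<le> b s * norm v" using b[of s v] by simp
      also have "\<dots> \<le> \<bar>b s\<bar> * norm v" by (intro mult_right_mono) auto
      finally show ?thesis .
    qed
    have "\<bar>x \<bullet> v\<bar> = \<bar>\<Sum>t\<in>T. u t * (x \<bullet> t)\<bar>"
      unfolding u by (simp add: inner_sum_right)
    also have "\<dots> \<le> (\<Sum>t\<in>T. \<bar>u t\<bar> * \<bar>x \<bullet> t\<bar>)"
      by (rule order_trans[OF sum_abs]) (simp add: abs_mult)
    also have "\<dots> \<le> (\<Sum>t\<in>T. (\<bar>b t\<bar> * norm v) * \<rho>)"
      using coord x by (intro sum_mono mult_mono) auto
    also have "\<dots> = (\<Sum>t\<in>T. \<bar>b t\<bar>) * \<rho> * norm v"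
      by (simp add: sum_distrib_left sum_distrib_right mult_ac)
    finally show "\<bar>x \<bullet> v\<bar> \<le> (\<Sum>t\<in>T. \<bar>b t\<bar>) * \<rho> * norm v" .
  qed
qed

text \<open>If \<open>y\<close> and \<open>x\<close> have equal norms, then \<open>\<bar>y - x\<bar>\<^sup>2 = - 2 * (x \<bullet> (y - x))\<close>. When the inner products of \<open>x\<close> with a
  basis of a space containing \<open>y - x\<close> are at most \<open>\<rho>\<close>, the right-hand side is at most a multiple of \<open>\<rho> * \<bar>y - x\<bar>\<close>. The constant is
  made uniform over all bases taken from a finite set \<open>V\<close>.\<close>

lemma sphere_slice_diameter:
  fixes V :: "'a::euclidean_space set"
  assumes V: "finite V"
  obtains K :: real where "0 \<le> K"
    "\<And>T x y \<rho>. T \<subseteq> V \<Longrightarrow> independent T \<Longrightarrow> 0 \<le> \<rho> \<Longrightarrow> (\<And>t. t \<in> T \<Longrightarrow> \<bar>x \<bullet> t\<bar> \<le> \<rho>) \<Longrightarrow>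
       y - x \<in> span T \<Longrightarrow> norm y = norm x \<Longrightarrow> norm (y - x) \<le> K * \<rho>"
proof -
  define good where "good T K \<longleftrightarrow> 0 \<le> K \<and>
    (\<forall>x v \<rho>. v \<in> span T \<longrightarrow> (\<forall>t\<in>T. \<bar>x \<bullet> t\<bar> \<le> \<rho>) \<longrightarrow> \<bar>x \<bullet> v\<bar> \<le> K * \<rho> * norm v)"
    for T :: "'a set" and K :: real
  have "\<forall>T\<in>{T. T \<subseteq> V \<and> independent T}. \<exists>K. good T K"
    unfolding good_def using inner_bounded_on_span by blast
  then obtain KT where KT: "\<And>T. T \<subseteq> V \<Longrightarrow> independent T \<Longrightarrow> good T (KT T)"
    by (metis (no_types, lifting) bchoice mem_Collect_eq)
  define K where "K = (\<Sum>T\<in>{T. T \<subseteq> V \<and> independent T}. KT T)"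
  have K_ge: "KT T \<le> K" if "T \<subseteq> V" "independent T" for T
    unfolding K_def using V that KT by (intro member_le_sum) (auto simp: good_def)
  have K0: "0 \<le> K" unfolding K_def using KT by (intro sum_nonneg) (auto simp: good_def)
  show thesis
  proof (rule that[of "2 * K"])
    show "0 \<le> 2 * K" using K0 by simp
    fix T x y and \<rho> :: real
    assume T: "T \<subseteq> V" "independent T" and \<rho>: "0 \<le> \<rho>" "\<And>t. t \<in> T \<Longrightarrow> \<bar>x \<bullet> t\<bar> \<le> \<rho>"
      and y: "y - x \<in> span T" "norm y = norm x"
    have "\<bar>x \<bullet> (y - x)\<bar> \<le> KT T * \<rho> * norm (y - x)"
      using KT[OF T] \<rho> y(1) by (simp add: good_def)
    also have "\<dots> \<le> K * \<rho> * norm (y - x)"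
      using K_ge[OF T] \<rho> by (intro mult_right_mono) auto
    finally have 1: "\<bar>x \<bullet> (y - x)\<bar> \<le> K * \<rho> * norm (y - x)" .
    have "y \<bullet> y = x \<bullet> x" using y(2) by (simp add: norm_eq)
    then have "norm (y - x) * norm (y - x) = - 2 * (x \<bullet> (y - x))"
      by (simp add: power2_norm_eq_inner[unfolded power2_eq_square] inner_diff_left inner_diff_right inner_commute)
    then have "norm (y - x) * norm (y - x) \<le> (2 * K * \<rho>) * norm (y - x)"
      using 1 by linarith
    then show "norm (y - x) \<le> 2 * K * \<rho>"
      using K0 \<rho>(1) by (cases "norm (y - x) = 0") auto
  qed
qed

text \<open>Any two points of \<open>B\<close> are joined by a path in \<open>B\<close> with steps of length at most \<open>R\<close>; the closure form
  avoids talking about paths.\<close>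

definition chain_connected :: "real \<Rightarrow> (int ^ 'd::finite) set \<Rightarrow> bool" where
  "chain_connected R B \<longleftrightarrow> (\<forall>S. B \<inter> S \<noteq> {} \<longrightarrow>
     (\<forall>y\<in>B \<inter> S. \<forall>z\<in>B. norm (real_vec (z - y)) \<le> R \<longrightarrow> z \<in> S) \<longrightarrow> B \<subseteq> S)"

lemma chain_components:
  fixes A :: "(int ^ 'd::finite) set"
  assumes A: "finite A"
  obtains P where "\<Union>P = A" "finite P" "\<And>B. B \<in> P \<Longrightarrow> B \<noteq> {}" "\<And>B. B \<in> P \<Longrightarrow> chain_connected R B"
    "\<And>B B'. B \<in> P \<Longrightarrow> B' \<in> P \<Longrightarrow> B \<noteq> B' \<Longrightarrow> B \<inter> B' = {}"
    "\<And>B B' k l. B \<in> P \<Longrightarrow> B' \<in> P \<Longrightarrow> B \<noteq> B' \<Longrightarrow> k \<in> B \<Longrightarrow> l \<in> B' \<Longrightarrow> R < norm (real_vec (l - k))"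
proof -
  define step where "step = {(k, l). k \<in> A \<and> l \<in> A \<and> norm (real_vec (l - k)) \<le> R}"
  define E where "E = step\<^sup>* \<inter> A \<times> A"
  have "sym step"
    by (auto simp: sym_def step_def real_vec_diff norm_minus_commute)
  then have "sym (step\<^sup>*)" by (rule sym_rtrancl)
  have eq: "equiv A E"
  proof (rule equivI)
    show "refl_on A E" by (auto simp: E_def refl_on_def)
    show "sym E" using \<open>sym (step\<^sup>*)\<close> by (auto simp: E_def sym_def)
    show "trans E" by (auto simp: E_def trans_def)
    show "E \<subseteq> A \<times> A" by (auto simp: E_def)
  qed
  show thesis
  proof (rule that[of "A // E"])
    show "\<Union>(A // E) = A" by (rule Union_quotient[OF eq])
    show "finite (A // E)" using A by (intro finite_quotient) (auto simp: E_def)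
    show "B \<noteq> {}" if "B \<in> A // E" for B using in_quotient_imp_non_empty[OF eq that] .
    show "B \<inter> B' = {}" if "B \<in> A // E" "B' \<in> A // E" "B \<noteq> B'" for B B'
      using quotient_disj[OF eq that(1,2)] that(3) by blast
    show "R < norm (real_vec (l - k))"
      if "B \<in> A // E" "B' \<in> A // E" "B \<noteq> B'" "k \<in> B" "l \<in> B'" for B B' k l
    proof (rule ccontr)
      assume "\<not> R < norm (real_vec (l - k))"
      moreover have "k \<in> A" "l \<in> A" using that in_quotient_imp_subset[OF eq] by blast+
      ultimately have "(k, l) \<in> E" by (auto simp: E_def step_def)
      then have "l \<in> B" using in_quotient_imp_closed[OF eq that(1) that(4)] by blast
      then show False using quotient_disj[OF eq that(1,2)] that(3,5) by blast
    qed
    show "chain_connected R B" if B: "B \<in> A // E" for B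
      unfolding chain_connected_def
    proof (intro allI impI subsetI)
      fix S b
      assume S: "B \<inter> S \<noteq> {}" "\<forall>y\<in>B \<inter> S. \<forall>z\<in>B. norm (real_vec (z - y)) \<le> R \<longrightarrow> z \<in> S" and b: "b \<in> B"
      obtain s where s: "s \<in> B" "s \<in> S" using S(1) by blast
      have BA: "B \<subseteq> A" by (rule in_quotient_imp_subset[OF eq B])
      have "(s, b) \<in> E" by (rule in_quotient_imp_in_rel[OF eq B]) (use s b in auto)
      then have "(s, b) \<in> step\<^sup>*" by (simp add: E_def)
      then have "b \<in> B \<and> b \<in> S"
      proof (induction rule: rtrancl_induct)
        case (step y z)
        then have yz: "y \<in> A" "z \<in> A" "norm (real_vec (z - y)) \<le> R" by (auto simp: step_def)
        have "(y, z) \<in> E" using yz step.hyps(2) by (auto simp: E_def)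
        then have "z \<in> B" using in_quotient_imp_closed[OF eq B] step.IH by blast
        then show ?case using S(2) step.IH yz by blast
      qed (use s in auto)
      then show "b \<in> S" by blast
    qed
  qed
qed

text \<open>Along a cluster one can collect independent steps \<open>T\<close>, all of them almost orthogonal to one base point \<open>x\<close>
  (in the sense of bounded inner products), until \<open>x + span T\<close> contains the cluster or \<open>s\<close> of them are found. As long as neither has happened, connectedness
  gives a step \<open>m\<close> leaving \<open>x + span T\<close> at some point \<open>y\<close>. This \<open>y\<close> becomes the new base point: by
  \<open>sphere_slice_diameter\<close> it is near \<open>x\<close>, so it is still almost orthogonal to \<open>T\<close>, and it is almost orthogonal to \<open>m\<close>
  because both ends of the step lie on the same sphere.\<close>

lemma chain_growth:
  fixes R :: real
  assumes R: "0 \<le> R"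
  shows "\<exists>\<rho>\<ge>0. \<forall>(B :: (int ^ 'd::finite) set) r. B \<subseteq> lattice_sphere r \<longrightarrow> B \<noteq> {} \<longrightarrow> chain_connected R B \<longrightarrow>
    (\<exists>x\<in>B. \<exists>T. T \<subseteq> real_vec ` {m. norm (real_vec m) \<le> R} \<and>
       T \<subseteq> (\<lambda>(k, l). real_vec (l - k)) ` (B \<times> B) \<and> independent T \<and>
       (\<forall>t\<in>T. \<bar>real_vec x \<bullet> t\<bar> \<le> \<rho>) \<and>
       (card T = s \<or> (\<forall>y\<in>B. real_vec y - real_vec x \<in> span T)))"
proof (induction s)
  case 0
  show ?case
    by (intro exI[of _ 0] conjI allI impI) (auto intro!: exI[of _ "{} :: (real ^ 'd) set"] independent_empty)
next
  case (Suc s)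
  define V where "V = real_vec ` {m :: int ^ 'd. norm (real_vec m) \<le> R}"
  have V: "finite V" using finite_lattice_ball[of "0 :: int ^ 'd" R] by (simp add: V_def)
  have VR: "norm t \<le> R" if "t \<in> V" for t using that by (auto simp: V_def)
  obtain K :: real where K: "0 \<le> K" and
    slice: "\<And>T x y \<rho>. T \<subseteq> V \<Longrightarrow> independent T \<Longrightarrow> 0 \<le> \<rho> \<Longrightarrow> (\<And>t. t \<in> T \<Longrightarrow> \<bar>x \<bullet> t\<bar> \<le> \<rho>) \<Longrightarrow>
       y - x \<in> span T \<Longrightarrow> norm y = norm x \<Longrightarrow> norm (y - x) \<le> K * \<rho>"
    using sphere_slice_diameter[OF V] by blast
  obtain \<rho> where \<rho>: "0 \<le> \<rho>" and IH: "\<And>(B :: (int ^ 'd::finite) set) r. B \<subseteq> lattice_sphere r \<Longrightarrow> B \<noteq> {} \<Longrightarrow> chain_connected R B \<Longrightarrow>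
    (\<exists>x\<in>B. \<exists>T. T \<subseteq> V \<and>
       T \<subseteq> (\<lambda>(k, l). real_vec (l - k)) ` (B \<times> B) \<and> independent T \<and>
       (\<forall>t\<in>T. \<bar>real_vec x \<bullet> t\<bar> \<le> \<rho>) \<and>
       (card T = s \<or> (\<forall>y\<in>B. real_vec y - real_vec x \<in> span T)))"
    using Suc.IH unfolding V_def by blast
  \<comment> \<open>The middle term pays for moving the base point by \<open>K * \<rho>\<close>, the last one for the new step.\<close>
  define \<rho>' where "\<rho>' = \<rho> + K * \<rho> * R + R * R"
  have \<rho>'0: "0 \<le> \<rho>'" "\<rho> \<le> \<rho>'" using \<rho> K R by (auto simp: \<rho>'_def)
  have "\<exists>x\<in>B. \<exists>T. T \<subseteq> V \<and>
       T \<subseteq> (\<lambda>(k, l). real_vec (l - k)) ` (B \<times> B) \<and> independent T \<and>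
       (\<forall>t\<in>T. \<bar>real_vec x \<bullet> t\<bar> \<le> \<rho>') \<and>
       (card T = Suc s \<or> (\<forall>y\<in>B. real_vec y - real_vec x \<in> span T))"
    if B: "B \<subseteq> lattice_sphere r" "B \<noteq> {}" "chain_connected R B" for B :: "(int ^ 'd) set" and r
  proof -
    obtain x T where x: "x \<in> B" and T: "T \<subseteq> V"
       "T \<subseteq> (\<lambda>(k, l). real_vec (l - k)) ` (B \<times> B)" "independent T"
       "\<forall>t\<in>T. \<bar>real_vec x \<bullet> t\<bar> \<le> \<rho>"
       and or: "card T = s \<or> (\<forall>y\<in>B. real_vec y - real_vec x \<in> span T)"
      using IH[OF B] by blast
    show ?thesis
    proof (cases "\<forall>y\<in>B. real_vec y - real_vec x \<in> span T")
      case True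
      have "\<forall>t\<in>T. \<bar>real_vec x \<bullet> t\<bar> \<le> \<rho>'" using T(4) \<rho>'0(2) by (meson order_trans)
      with True show ?thesis using x T(1-3) by blast
    next
      case False
      define S where "S = {y :: int ^ 'd. real_vec y - real_vec x \<in> span T}"
      have "x \<in> S" by (simp add: S_def span_zero)
      \<comment> \<open>Connectedness gives a step from \<open>y\<close> inside to \<open>z\<close> outside of \<open>S\<close>.\<close>
      have "B \<inter> S \<noteq> {} \<longrightarrow> (\<forall>y\<in>B \<inter> S. \<forall>z\<in>B. norm (real_vec (z - y)) \<le> R \<longrightarrow> z \<in> S) \<longrightarrow> B \<subseteq> S"
        using B(3) unfolding chain_connected_def by (rule spec)
      moreover have "\<not> B \<subseteq> S" using False by (auto simp: S_def)
      ultimately obtain y z where yz: "y \<in> B" "y \<in> S" "z \<in> B" "norm (real_vec (z - y)) \<le> R" "z \<notin> S"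
        using x \<open>x \<in> S\<close> by blast
      define m where "m = real_vec (z - y)"
      have mV: "m \<in> V" using yz by (auto simp: V_def m_def)
      have m_span: "m \<notin> span T"
      proof
        assume "m \<in> span T"
        moreover have "real_vec y - real_vec x \<in> span T" using yz(2) by (simp add: S_def)
        ultimately have "m + (real_vec y - real_vec x) \<in> span T" by (rule span_add)
        then show False using yz(5) by (simp add: S_def m_def real_vec_diff)
      qed
      have norms: "norm (real_vec y) = norm (real_vec x)" "norm (real_vec z) = norm (real_vec y)"
        using B(1) x yz by (auto simp: lattice_sphere_def)
      have yx: "norm (real_vec y - real_vec x) \<le> K * \<rho>"
        using yz(2) norms T \<rho> by (intro slice) (auto simp: S_def)
      have "\<bar>real_vec y \<bullet> t\<bar> \<le> \<rho>'" if t: "t \<in> insert m T" for t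
      proof (cases "t = m")
        case True
        have "real_vec z \<bullet> real_vec z = real_vec y \<bullet> real_vec y"
          using norms(2) by (simp add: norm_eq)
        moreover have "real_vec z = real_vec y + m" by (simp add: m_def real_vec_diff)
        ultimately have "2 * (real_vec y \<bullet> m) = - (m \<bullet> m)"
          by (simp add: inner_add_left inner_add_right inner_commute)
        moreover have "m \<bullet> m = norm m * norm m"
          by (simp add: power2_norm_eq_inner[symmetric] power2_eq_square)
        moreover have "norm m * norm m \<le> R * R" using yz(4) R by (intro mult_mono) (auto simp: m_def)
        moreover have "0 \<le> norm m * norm m" "0 \<le> K * \<rho> * R" using K \<rho> R by auto
        ultimately show ?thesis using \<rho> unfolding True \<rho>'_def by linarith
      next
        case False
        then have tT: "t \<in> T" using t by simp
        have "real_vec y \<bullet> t = real_vec x \<bullet> t + (real_vec y - real_vec x) \<bullet> t"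
          by (simp add: inner_diff_left)
        moreover have "\<bar>(real_vec y - real_vec x) \<bullet> t\<bar> \<le> (K * \<rho>) * R"
        proof -
          have "\<bar>(real_vec y - real_vec x) \<bullet> t\<bar> \<le> norm (real_vec y - real_vec x) * norm t"
            by (rule Cauchy_Schwarz_ineq2)
          also have "\<dots> \<le> (K * \<rho>) * R"
            using yx VR[of t] tT T(1) K \<rho> by (intro mult_mono) auto
          finally show ?thesis .
        qed
        moreover have "0 \<le> R * R" by simp
        moreover have "\<bar>real_vec x \<bullet> t\<bar> \<le> \<rho>" using T(4) tT by blast
        ultimately show ?thesis unfolding \<rho>'_def by linarith
      qed
      moreover have "independent (insert m T)"
        using T(3) m_span by (simp add: independent_insert span_base)
      moreover have "card (insert m T) = Suc s"
      proof -
        have "finite T" using T(3) by (rule independent_imp_finite)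
        moreover have "m \<notin> T" using m_span span_base by blast
        ultimately show ?thesis using or False by simp
      qed
      moreover have "insert m T \<subseteq> V" using mV T(1) by simp
      moreover have "insert m T \<subseteq> (\<lambda>(k, l). real_vec (l - k)) ` (B \<times> B)"
        using T(2) yz(1,3) by (auto simp: m_def)
      ultimately show ?thesis using yz(1) by blast
    qed
  qed
  then show ?case unfolding V_def[symmetric] using \<rho>'0(1) by blast
qed

text \<open>The steps collected by \<open>chain_growth\<close> span either a proper subspace of \<open>U\<close>, which then contains the differences
  within \<open>B\<close>, or all of \<open>U\<close>. In the second case \<open>sphere_slice_diameter\<close> confines not only \<open>B\<close> but all of \<open>A\<close> to
  a ball around the base point.\<close>

lemma cluster_dichotomy:
  fixes R :: real
  assumes R: "0 \<le> R"
  obtains D :: real where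
    "\<And>r U (A :: (int ^ 'd::finite) set) B. A \<subseteq> lattice_sphere r \<Longrightarrow> subspace U \<Longrightarrow>
       (\<And>k l. k \<in> A \<Longrightarrow> l \<in> A \<Longrightarrow> real_vec (l - k) \<in> U) \<Longrightarrow>
       B \<subseteq> A \<Longrightarrow> B \<noteq> {} \<Longrightarrow> chain_connected R B \<Longrightarrow>
       (\<exists>W. subspace W \<and> dim W < dim U \<and> (\<forall>k\<in>B. \<forall>l\<in>B. real_vec (l - k) \<in> W)) \<or>
       (\<forall>k\<in>A. \<forall>l\<in>A. norm (real_vec (l - k)) \<le> D)"
proof -
  define V where "V = real_vec ` {m :: int ^ 'd. norm (real_vec m) \<le> R}"
  have V: "finite V" using finite_lattice_ball[of "0 :: int ^ 'd" R] by (simp add: V_def)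
  obtain K :: real where K: "0 \<le> K" and
    slice: "\<And>T x y \<rho>. T \<subseteq> V \<Longrightarrow> independent T \<Longrightarrow> 0 \<le> \<rho> \<Longrightarrow> (\<And>t. t \<in> T \<Longrightarrow> \<bar>x \<bullet> t\<bar> \<le> \<rho>) \<Longrightarrow>
       y - x \<in> span T \<Longrightarrow> norm y = norm x \<Longrightarrow> norm (y - x) \<le> K * \<rho>"
    using sphere_slice_diameter[OF V] by blast
  obtain \<rho> where \<rho>: "0 \<le> \<rho>" and grow: "\<And>(B :: (int ^ 'd::finite) set) r. B \<subseteq> lattice_sphere r \<Longrightarrow> B \<noteq> {} \<Longrightarrow> chain_connected R B \<Longrightarrow>
    (\<exists>x\<in>B. \<exists>T. T \<subseteq> V \<and>
       T \<subseteq> (\<lambda>(k, l). real_vec (l - k)) ` (B \<times> B) \<and> independent T \<and>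
       (\<forall>t\<in>T. \<bar>real_vec x \<bullet> t\<bar> \<le> \<rho>) \<and>
       (card T = Suc (CARD('d)) \<or> (\<forall>y\<in>B. real_vec y - real_vec x \<in> span T)))"
    using chain_growth[OF R, where s = "Suc (CARD('d))" and 'd = 'd] unfolding V_def by blast
  show thesis
  proof (rule that[of "2 * (K * \<rho>)"])
    fix r U and A B :: "(int ^ 'd) set"
    assume A: "A \<subseteq> lattice_sphere r" and U: "subspace U"
      and diff: "\<And>k l. k \<in> A \<Longrightarrow> l \<in> A \<Longrightarrow> real_vec (l - k) \<in> U"
      and B: "B \<subseteq> A" "B \<noteq> {}" "chain_connected R B"
    obtain x T where x: "x \<in> B" and T: "T \<subseteq> V"
       "T \<subseteq> (\<lambda>(k, l). real_vec (l - k)) ` (B \<times> B)" "independent T"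
       "\<forall>t\<in>T. \<bar>real_vec x \<bullet> t\<bar> \<le> \<rho>"
       and or: "card T = Suc (CARD('d)) \<or> (\<forall>y\<in>B. real_vec y - real_vec x \<in> span T)"
      using grow[of B r] A B by blast
    \<comment> \<open>The growth was asked for more independent vectors than the space admits, so it stopped
      because \<open>T\<close> spans the cluster.\<close>
    have "card T \<le> CARD('d)" using independent_bound[OF T(3)] by simp
    then have BT: "\<And>y. y \<in> B \<Longrightarrow> real_vec y - real_vec x \<in> span T" using or by auto
    have "T \<subseteq> U" using T(2) B(1) diff by fastforce
    then have TU: "span T \<subseteq> U" using U by (rule span_minimal)
    show "(\<exists>W. subspace W \<and> dim W < dim U \<and> (\<forall>k\<in>B. \<forall>l\<in>B. real_vec (l - k) \<in> W)) \<or>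
       (\<forall>k\<in>A. \<forall>l\<in>A. norm (real_vec (l - k)) \<le> 2 * (K * \<rho>))"
    proof (cases "dim (span T) < dim U")
      case True
      have "real_vec (l - k) \<in> span T" if "k \<in> B" "l \<in> B" for k l
        using span_diff[OF BT[OF that(2)] BT[OF that(1)]] by (simp add: real_vec_diff)
      then show ?thesis using True by (intro disjI1 exI[of _ "span T"]) auto
    next
      case False
      then have "span T = U" using U TU by (intro subspace_dim_equal) auto
      have near: "norm (real_vec y - real_vec x) \<le> K * \<rho>" if y: "y \<in> A" for y
      proof (rule slice)
        show "real_vec y - real_vec x \<in> span T"
          using diff[of x y] y x B(1) \<open>span T = U\<close> by (auto simp: real_vec_diff)
        show "norm (real_vec y) = norm (real_vec x)"
          using A B(1) x y by (auto simp: lattice_sphere_def)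
      qed (use T \<rho> in auto)
      have "norm (real_vec (l - k)) \<le> 2 * (K * \<rho>)" if "k \<in> A" "l \<in> A" for k l
      proof -
        have "real_vec (l - k) = (real_vec l - real_vec x) - (real_vec k - real_vec x)"
          by (simp add: real_vec_diff)
        then have "norm (real_vec (l - k)) \<le> norm (real_vec l - real_vec x) + norm (real_vec k - real_vec x)"
          by (metis norm_triangle_ineq4)
        then show ?thesis using near[OF that(1)] near[OF that(2)] by linarith
      qed
      then show ?thesis by blast
    qed
  qed
qed

section \<open>The observability inequality\<close>

text \<open>Deleting the matrix entries that link different members of the partition \<open>P\<close> changes the quadratic form by at
  most \<open>\<epsilon>\<close> times the squared norm of the coefficients, by Schur's test. What remains is block diagonal.\<close>

lemma coercive_decoupled:
  fixes \<mu> :: "'d::finite torus measure"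
  assumes \<mu>: "prob_space \<mu>" "sets \<mu> = sets borel"
    and A: "finite A" and P: "\<Union>P = A" "finite P"
      "\<And>B B'. B \<in> P \<Longrightarrow> B' \<in> P \<Longrightarrow> B \<noteq> B' \<Longrightarrow> B \<inter> B' = {}"
    and far: "\<And>B B' k l. B \<in> P \<Longrightarrow> B' \<in> P \<Longrightarrow> B \<noteq> B' \<Longrightarrow> k \<in> B \<Longrightarrow> l \<in> B' \<Longrightarrow> R < norm (real_vec (l - k))"
    and tail: "\<And>k. k \<in> A \<Longrightarrow> (\<Sum>l\<in>{l \<in> A. R \<le> norm (real_vec (l - k))}. cmod (fourier_coeff \<mu> (l - k))) \<le> \<epsilon>"
  shows "(\<Sum>B\<in>P. \<integral>x. (cmod (trig_sum B c x))\<^sup>2 \<partial>\<mu>) - \<epsilon> * (\<Sum>k\<in>A. (cmod (c k))\<^sup>2)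
      \<le> (\<integral>x. (cmod (trig_sum A c x))\<^sup>2 \<partial>\<mu>)"
proof -
  define Q where "Q B = (\<integral>x. (cmod (trig_sum B c x))\<^sup>2 \<partial>\<mu>)" for B
  define g where "g k l = fourier_coeff \<mu> (l - k)" for k l :: "int ^ 'd"
  define linked where "linked k l \<longleftrightarrow> (\<exists>B\<in>P. k \<in> B \<and> l \<in> B)" for k l
  define h where "h k l = (if linked k l then 0 else g k l)" for k l
  have finB: "finite B" if "B \<in> P" for B using that P(1) A by (auto intro: finite_subset)
  have Q_eq: "complex_of_real (Q B) = (\<Sum>k\<in>B. \<Sum>l\<in>B. c k * cnj (c l) * g k l)" for B
    unfolding Q_def g_def by (rule integral_cmod_trig_sum[OF \<mu>])
  have blocks: "(\<Sum>k\<in>A. \<Sum>l\<in>A. c k * cnj (c l) * (if linked k l then g k l else 0)) = (\<Sum>B\<in>P. complex_of_real (Q B))"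
  proof -
    have "(\<Sum>k\<in>A. \<Sum>l\<in>A. c k * cnj (c l) * (if linked k l then g k l else 0)) =
        (\<Sum>B\<in>P. \<Sum>k\<in>B. \<Sum>l\<in>A. c k * cnj (c l) * (if linked k l then g k l else 0))"
      using finB P(3) by (subst (1) P(1)[symmetric], subst sum.Union_disjoint) auto
    also have "\<dots> = (\<Sum>B\<in>P. complex_of_real (Q B))"
      unfolding Q_eq
    proof (rule sum.cong[OF refl], rule sum.cong[OF refl])
      fix B k assume Bk: "B \<in> P" "k \<in> B"
      have "linked k l \<longleftrightarrow> l \<in> B" for l
        using Bk P(3) unfolding linked_def by blast
      then show "(\<Sum>l\<in>A. c k * cnj (c l) * (if linked k l then g k l else 0)) = (\<Sum>l\<in>B. c k * cnj (c l) * g k l)"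
        using A Bk P(1) by (intro sum.mono_neutral_cong_right) auto
    qed
    finally show ?thesis .
  qed
  have "complex_of_real (Q A) = (\<Sum>k\<in>A. \<Sum>l\<in>A. c k * cnj (c l) * (if linked k l then g k l else 0) + c k * cnj (c l) * h k l)"
    unfolding Q_eq h_def by (intro sum.cong refl) auto
  also have "\<dots> = complex_of_real (\<Sum>B\<in>P. Q B) + (\<Sum>k\<in>A. \<Sum>l\<in>A. c k * cnj (c l) * h k l)"
    by (simp add: sum.distrib blocks)
  finally have split: "(\<Sum>k\<in>A. \<Sum>l\<in>A. c k * cnj (c l) * h k l) = complex_of_real (Q A - (\<Sum>B\<in>P. Q B))"
    by simp
  have "norm (\<Sum>k\<in>A. \<Sum>l\<in>A. c k * cnj (c l) * h k l) \<le> \<epsilon> * (\<Sum>k\<in>A. (cmod (c k))\<^sup>2)"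
  proof (rule schur_test[OF A])
    show "norm (h k l) = norm (h l k)" for k l
      using fourier_coeff_uminus[OF \<mu>, of "k - l"] by (auto simp: h_def g_def linked_def)
    fix k assume k: "k \<in> A"
    have "(\<Sum>l\<in>A. norm (h k l)) = (\<Sum>l\<in>{l \<in> A. \<not> linked k l}. cmod (fourier_coeff \<mu> (l - k)))"
      using A by (intro sum.mono_neutral_cong_right) (auto simp: h_def g_def)
    also have "\<dots> \<le> (\<Sum>l\<in>{l \<in> A. R \<le> norm (real_vec (l - k))}. cmod (fourier_coeff \<mu> (l - k)))"
    proof (rule sum_mono2)
      show "{l \<in> A. \<not> linked k l} \<subseteq> {l \<in> A. R \<le> norm (real_vec (l - k))}"
      proof safe
        fix l assume l: "l \<in> A" "\<not> linked k l"
        obtain B B' where BB: "B \<in> P" "k \<in> B" "B' \<in> P" "l \<in> B'" using k l(1) P(1) by blast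
        have "B \<noteq> B'" using BB l(2) unfolding linked_def by blast
        then have "R < norm (real_vec (l - k))" using BB by (intro far[of B B'])
        then show "R \<le> norm (real_vec (l - k))" by simp
      qed
    qed (use A in auto)
    also have "\<dots> \<le> \<epsilon>" by (rule tail[OF k])
    finally show "(\<Sum>l\<in>A. norm (h k l)) \<le> \<epsilon>" .
  qed
  then have "\<bar>Q A - (\<Sum>B\<in>P. Q B)\<bar> \<le> \<epsilon> * (\<Sum>k\<in>A. (cmod (c k))\<^sup>2)"
    unfolding split norm_of_real .
  then show ?thesis unfolding Q_def[symmetric] by linarith
qed

context
  fixes \<mu> :: "'d::finite torus measure"
  assumes d: "5 \<le> CARD('d)" and prob: "prob_space \<mu>" and sets_\<mu>: "sets \<mu> = sets borel"
    and decay: "summable (\<lambda>j. 2 ^ (j * (CARD('d) - 2)) * shell_sup \<mu> j)"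
begin

text \<open>The order of the choices matters: \<open>R\<close> is fixed by the constant \<open>\<delta>\<close> for dimension \<open>n\<close>, and only then the diameter
  bound \<open>D\<close> by \<open>R\<close>. So the possibly tiny constant for diameter \<open>D\<close> never has to compete with interactions
  between clusters.\<close>

lemma coercive_sphere_slices:
  "\<exists>\<delta>>0. \<forall>r U A c. A \<subseteq> lattice_sphere r \<longrightarrow> subspace U \<longrightarrow> dim U \<le> n \<longrightarrow>
     (\<forall>k\<in>A. \<forall>l\<in>A. real_vec (l - k) \<in> U) \<longrightarrow>
     \<delta> * (\<Sum>k\<in>A. (cmod (c k))\<^sup>2) \<le> (\<integral>x. (cmod (trig_sum A c x))\<^sup>2 \<partial>\<mu>)"
proof -
  obtain Bd :: real where Bd: "\<And>A. finite A \<Longrightarrow> (\<Sum>k\<in>A. (cmod (fourier_coeff \<mu> k))\<^sup>2) \<le> Bd"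
    using fourier_coeff_square_summable[OF d prob sets_\<mu> decay] by blast
  show ?thesis
  proof (induction n)
    case 0
    obtain \<delta> :: real where \<delta>: "0 < \<delta>" "\<And>A c. (\<And>k l. k \<in> A \<Longrightarrow> l \<in> A \<Longrightarrow> norm (real_vec (l - k)) \<le> 0) \<Longrightarrow>
      \<delta> * (\<Sum>k\<in>A. (cmod (c k))\<^sup>2) \<le> (\<integral>x. (cmod (trig_sum A c x))\<^sup>2 \<partial>\<mu>)"
      using coercive_bounded_diameter[OF prob sets_\<mu> Bd, of 0] by blast
    show ?case
    proof (intro exI[of _ \<delta>] conjI allI impI \<delta>)
      fix U :: "(real ^ 'd) set" and A :: "(int ^ 'd) set" and k l
      assume "dim U \<le> 0" "\<forall>k\<in>A. \<forall>l\<in>A. real_vec (l - k) \<in> U" "k \<in> A" "l \<in> A"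
      then have "real_vec (l - k) \<in> U" "U \<subseteq> {0}" by (auto simp: dim_eq_0)
      then show "norm (real_vec (l - k)) \<le> 0" by auto
    qed
  next
    case (Suc n)
    then obtain \<delta> :: real where \<delta>: "0 < \<delta>" and IH: "\<And>r U A c. A \<subseteq> lattice_sphere r \<Longrightarrow> subspace U \<Longrightarrow> dim U \<le> n \<Longrightarrow>
     (\<forall>k\<in>A. \<forall>l\<in>A. real_vec (l - k) \<in> U) \<Longrightarrow>
     \<delta> * (\<Sum>k\<in>A. (cmod (c k))\<^sup>2) \<le> (\<integral>x. (cmod (trig_sum A c x))\<^sup>2 \<partial>\<mu>)"
      by blast
    obtain C :: real where C: "0 < C" and
      tail: "\<And>r k J. k \<in> lattice_sphere r \<Longrightarrow>
       (\<Sum>l\<in>{l \<in> lattice_sphere r. 2 ^ J \<le> norm (real_vec (l - k))}. cmod (fourier_coeff \<mu> (l - k)))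
         \<le> C * (\<Sum>j. 2 ^ ((j + J) * (CARD('d) - 2)) * shell_sup \<mu> (j + J))"
      using decay_tail[OF d prob sets_\<mu> decay] by blast
    have "\<exists>N. \<forall>n\<ge>N. norm (\<Sum>j. 2 ^ ((j + n) * (CARD('d) - 2)) * shell_sup \<mu> (j + n)) < \<delta> / (2 * C)"
      by (rule suminf_exist_split[OF _ decay]) (use \<delta> C in simp)
    then obtain J where J: "(\<Sum>j. 2 ^ ((j + J) * (CARD('d) - 2)) * shell_sup \<mu> (j + J)) < \<delta> / (2 * C)"
      by (metis abs_less_iff order_refl real_norm_def)
    have "C * (\<Sum>j. 2 ^ ((j + J) * (CARD('d) - 2)) * shell_sup \<mu> (j + J)) \<le> C * (\<delta> / (2 * C))"
      using J C by (intro mult_left_mono) auto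
    then have CJ: "C * (\<Sum>j. 2 ^ ((j + J) * (CARD('d) - 2)) * shell_sup \<mu> (j + J)) \<le> \<delta> / 2"
      using C by simp
    define R :: real where "R = 2 ^ J"
    have R: "0 \<le> R" by (simp add: R_def)
    obtain D :: real where D:
      "\<And>r U (A :: (int ^ 'd::finite) set) B. A \<subseteq> lattice_sphere r \<Longrightarrow> subspace U \<Longrightarrow>
       (\<And>k l. k \<in> A \<Longrightarrow> l \<in> A \<Longrightarrow> real_vec (l - k) \<in> U) \<Longrightarrow>
       B \<subseteq> A \<Longrightarrow> B \<noteq> {} \<Longrightarrow> chain_connected R B \<Longrightarrow>
       (\<exists>W. subspace W \<and> dim W < dim U \<and> (\<forall>k\<in>B. \<forall>l\<in>B. real_vec (l - k) \<in> W)) \<or>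
       (\<forall>k\<in>A. \<forall>l\<in>A. norm (real_vec (l - k)) \<le> D)"
      using cluster_dichotomy[OF R, where 'd = 'd] by blast
    obtain \<delta>D :: real where \<delta>D: "0 < \<delta>D" "\<And>A c. (\<And>k l. k \<in> A \<Longrightarrow> l \<in> A \<Longrightarrow> norm (real_vec (l - k)) \<le> D) \<Longrightarrow>
      \<delta>D * (\<Sum>k\<in>A. (cmod (c k))\<^sup>2) \<le> (\<integral>x. (cmod (trig_sum A c x))\<^sup>2 \<partial>\<mu>)"
      using coercive_bounded_diameter[OF prob sets_\<mu> Bd, of D] by blast
    show ?case
    proof (intro exI[of _ "min (\<delta> / 2) \<delta>D"] conjI allI impI)
      show "0 < min (\<delta> / 2) \<delta>D" using \<delta> \<delta>D by simp
      fix r U and A :: "(int ^ 'd) set" and c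
      assume A: "A \<subseteq> lattice_sphere r" and U: "subspace U" "dim U \<le> Suc n"
        and diff: "\<forall>k\<in>A. \<forall>l\<in>A. real_vec (l - k) \<in> U"
      have finA: "finite A" using A finite_lattice_sphere by (rule finite_subset)
      define s where "s = (\<Sum>k\<in>A. (cmod (c k))\<^sup>2)"
      have s0: "0 \<le> s" unfolding s_def by (intro sum_nonneg) auto
      have "min (\<delta> / 2) \<delta>D * s \<le> (\<integral>x. (cmod (trig_sum A c x))\<^sup>2 \<partial>\<mu>)"
      proof (cases "\<forall>k\<in>A. \<forall>l\<in>A. norm (real_vec (l - k)) \<le> D")
        case True
        have "min (\<delta> / 2) \<delta>D * s \<le> \<delta>D * s" using s0 by (intro mult_right_mono) auto
        also have "\<dots> \<le> (\<integral>x. (cmod (trig_sum A c x))\<^sup>2 \<partial>\<mu>)"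
          unfolding s_def using True by (intro \<delta>D) auto
        finally show ?thesis .
      next
        case False
        obtain P where P: "\<Union>P = A" "finite P" "\<And>B. B \<in> P \<Longrightarrow> B \<noteq> {}" "\<And>B. B \<in> P \<Longrightarrow> chain_connected R B"
          "\<And>B B'. B \<in> P \<Longrightarrow> B' \<in> P \<Longrightarrow> B \<noteq> B' \<Longrightarrow> B \<inter> B' = {}"
          "\<And>B B' k l. B \<in> P \<Longrightarrow> B' \<in> P \<Longrightarrow> B \<noteq> B' \<Longrightarrow> k \<in> B \<Longrightarrow> l \<in> B' \<Longrightarrow> R < norm (real_vec (l - k))"
          using chain_components[OF finA, of R] by blast
        have block: "\<delta> * (\<Sum>k\<in>B. (cmod (c k))\<^sup>2) \<le> (\<integral>x. (cmod (trig_sum B c x))\<^sup>2 \<partial>\<mu>)" if B: "B \<in> P" for B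
        proof -
          have BA: "B \<subseteq> A" using B P(1) by blast
          obtain W where W: "subspace W" "dim W < dim U" "\<forall>k\<in>B. \<forall>l\<in>B. real_vec (l - k) \<in> W"
            using D[OF A U(1) _ BA P(3)[OF B] P(4)[OF B]] diff False by blast
          show ?thesis
            by (rule IH[of B r W]) (use W U(2) A BA in auto)
        qed
        have "\<delta> * s = (\<Sum>B\<in>P. \<delta> * (\<Sum>k\<in>B. (cmod (c k))\<^sup>2))"
        proof -
          have "s = (\<Sum>B\<in>P. \<Sum>k\<in>B. (cmod (c k))\<^sup>2)"
            unfolding s_def P(1)[symmetric] using P(1,5) finA
            by (subst sum.Union_disjoint) (auto intro: finite_subset)
          then show ?thesis by (simp add: sum_distrib_left)
        qed
        also have "\<dots> \<le> (\<Sum>B\<in>P. \<integral>x. (cmod (trig_sum B c x))\<^sup>2 \<partial>\<mu>)"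
          by (intro sum_mono block)
        finally have 1: "\<delta> * s \<le> (\<Sum>B\<in>P. \<integral>x. (cmod (trig_sum B c x))\<^sup>2 \<partial>\<mu>)" .
        have 2: "(\<Sum>B\<in>P. \<integral>x. (cmod (trig_sum B c x))\<^sup>2 \<partial>\<mu>) - \<delta> / 2 * s \<le> (\<integral>x. (cmod (trig_sum A c x))\<^sup>2 \<partial>\<mu>)"
          unfolding s_def
        proof (rule coercive_decoupled[OF prob sets_\<mu> finA P(1,2,5,6)])
          fix k assume k: "k \<in> A"
          have "(\<Sum>l\<in>{l \<in> A. R \<le> norm (real_vec (l - k))}. cmod (fourier_coeff \<mu> (l - k))) \<le>
              (\<Sum>l\<in>{l \<in> lattice_sphere r. 2 ^ J \<le> norm (real_vec (l - k))}. cmod (fourier_coeff \<mu> (l - k)))"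
            unfolding R_def using A by (intro sum_mono2) (auto simp: finite_lattice_sphere)
          also have "\<dots> \<le> \<delta> / 2" using tail[of k r J] k A CJ by (meson order_trans subsetD)
          finally show "(\<Sum>l\<in>{l \<in> A. R \<le> norm (real_vec (l - k))}. cmod (fourier_coeff \<mu> (l - k))) \<le> \<delta> / 2" .
        qed
        have "min (\<delta> / 2) \<delta>D * s \<le> \<delta> / 2 * s" using s0 by (intro mult_right_mono) auto
        with 1 2 show ?thesis by linarith
      qed
      then show "min (\<delta> / 2) \<delta>D * (\<Sum>k\<in>A. (cmod (c k))\<^sup>2) \<le> (\<integral>x. (cmod (trig_sum A c x))\<^sup>2 \<partial>\<mu>)"
        by (simp only: s_def)
    qed
  qed
qed

lemma observability_inequality_if_decay: "observability_inequality \<mu>"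
proof -
  obtain \<delta> :: real where \<delta>: "0 < \<delta>" and le: "\<And>r U A c. A \<subseteq> lattice_sphere r \<Longrightarrow> subspace U \<Longrightarrow> dim U \<le> CARD('d) \<Longrightarrow>
     (\<forall>k\<in>A. \<forall>l\<in>A. real_vec (l - k) \<in> U) \<Longrightarrow>
     \<delta> * (\<Sum>k\<in>A. (cmod (c k))\<^sup>2) \<le> (\<integral>x. (cmod (trig_sum A c x))\<^sup>2 \<partial>\<mu>)"
    using coercive_sphere_slices[of "CARD('d)"] by blast
  show ?thesis
    unfolding observability_inequality_def
  proof (intro exI ballI)
    fix u :: "'d torus \<Rightarrow> complex" assume "u \<in> eigenfunctions"
    then obtain r c where u: "u = trig_sum (lattice_sphere r) c"
      by (auto simp: eigenfunctions_def eigenspace_def trig_sum_def[abs_def])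
    have "\<delta> * (\<integral>x. (cmod (u x))\<^sup>2 \<partial>torus_lebesgue) \<le> (\<integral>x. (cmod (u x))\<^sup>2 \<partial>\<mu>)"
      unfolding u parseval_trig_sum[OF finite_lattice_sphere]
      by (rule le[of _ r UNIV]) (auto simp: dim_UNIV)
    then show "(\<integral>x. (cmod (u x))\<^sup>2 \<partial>torus_lebesgue) \<le> (1 / \<delta>) * (\<integral>x. (cmod (u x))\<^sup>2 \<partial>\<mu>)"
      using \<delta> by (simp add: field_simps)
  qed
qed

end

theorem theorem1p4:
  fixes \<mu> :: "'d::finite torus measure"
  assumes "CARD('d) \<ge> 5"
    and "prob_space \<mu>"
    and "sets \<mu> = sets borel"
    and "summable (\<lambda>j::nat. 2 ^ (j * (CARD('d) - 2)) *
           (SUP k\<in>{k. norm (real_vec k) \<in> {2 ^ j .. 2 ^ (j + 1)}}. cmod (fourier_coeff \<mu> k)))"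
  shows "trace_inequality \<mu> \<and> observability_inequality \<mu>"
proof -
  have "summable (\<lambda>j. 2 ^ (j * (CARD('d) - 2)) * shell_sup \<mu> j)"
    using assms(4) by (simp only: shell_sup_def)
  then show ?thesis using trace_inequality_if_decay observability_inequality_if_decay assms(1-3) by blast
qed

end
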